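(* Let $D$ be a multidigraph. For each $e \in E(D)$, let $C_e$ be a connected chordal graph with two distinct distinguished vertices $T(e), H(e) \in V(C_e)$, and suppose that $D/\{C_e\}$ is a thickening of $D$. For each $e\in E(D)$, let $P_e$ be a shortest path from $T(e)$ to $H(e)$ in $C_e$ (regarded as a path graph with distinguished vertices its endpoints $T(e),H(e)$). Then \[\epsilon(D / \{C_e\}) = \epsilon(D / \{P_e\}).\]
   Context: All graphs are finite, nonempty, undirected, without multiple edges, and by convention every loop $\{i,i\}$ is an edge (loops are ignored when speaking of cycles, paths, triangles and chordality). A graph is chordal if it has no induced cycle with at least 4 vertices. A clique is a set of pairwise adjacent vertices (singletons included). Additive distance. For a graph $G$ a $G$-partial matrix is a symmetric real array $X$ with entries $X_{ij}=X_{ji}$ specified exactly for $\{i,j\}\in E(G)$ (including all diagonal entries); the vector space of these is $\mathrm{Sym}(G)$. $\mathcal{S}(G)\subseteq \mathrm{Sym}(G)$ is the cone of PSD-completable partial matrices, i.e. those whose unspecified entries can be chosen to give a positive semidefinite (PSD) matrix. $\mathcal{P}(G)$ is the cone of $X\in\mathrm{Sym}(G)$ such that for every clique $C$ of $G$ the fully specified submatrix $X|_C$ is PSD. Let $\mathrm{tr}(X)=\sum_i X_{ii}$, $\tilde{\mathcal{P}}(G)=\{X\in\mathcal{P}(G):\mathrm{tr}(X)=1\}$, and let $I_G$ be the projection of the identity matrix to $\mathrm{Sym}(G)$. Define $\epsilon_G(X)=\min\{\epsilon\in\mathbb{R} : X+\epsilon I_G\in\mathcal{S}(G)\}$ and $\epsilon(G)=\max\{\epsilon_G(X):X\in\tilde{\mathcal{P}}(G)\}$.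 Thickenings. A multidigraph $D$ consists of finite sets $V(D)$, $E(D)$ and maps $t,h:E(D)\to V(D)$ (tail and head) with $t(e)\ne h(e)$ for all $e$; parallel edges are allowed. Given for each $e\in E(D)$ a connected graph $C_e$ with two distinct distinguished vertices $T(e),H(e)$, the graph $D/\{C_e\}$ is obtained from the disjoint union of $V(D)$ and all the $C_e$ by identifying $T(e)$ with $t(e)$ and $H(e)$ with $h(e)$ for every $e\in E(D)$ (resulting parallel edges are merged into one). When all the $C_e$ are connected chordal graphs, $D/\{C_e\}$ is called a thickening of $D$ if every triangle (clique of size 3) of $D/\{C_e\}$ is contained, as a subgraph (all three vertices and all three edges), in $C_e$ for some $e\in E(D)$. *)

theory Defs
  imports "HOL-Analysis.Analysis" "Graph_Theory.Graph_Theory"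
begin

section \<open>Graphs\<close>

text \<open>
  A finite undirected graph is a pair digraph satisfying the library locale \<open>pair_graph\<close>:
  finitely many vertices, and an arc set that is symmetric and irreflexive. The conventional loops
  are therefore not stored in \<open>parcs\<close>; wherever the diagonal counts as an edge it is
  added explicitly.
\<close>

definition connected_graph :: "'a pair_pre_digraph \<Rightarrow> bool" where
  "connected_graph G \<longleftrightarrow> pair_graph G \<and> Digraph_Component.connected (with_proj G)"

definition is_clique :: "'a pair_pre_digraph \<Rightarrow> 'a set \<Rightarrow> bool" where
  "is_clique G K \<longleftrightarrow>
     K \<noteq> {} \<and> K \<subseteq> pverts G \<and> (\<forall>u\<in>K. \<forall>v\<in>K. u \<noteq> v \<longrightarrow> (u, v) \<in> parcs G)"

text \<open>The list enumerates the vertices of the cycle in cyclic order.\<close>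

definition induced_cycle :: "'a pair_pre_digraph \<Rightarrow> 'a list \<Rightarrow> bool" where
  "induced_cycle G cs \<longleftrightarrow>
     3 \<le> length cs \<and> distinct cs \<and> set cs \<subseteq> pverts G \<and>
     (\<forall>i < length cs. \<forall>j < length cs.
        (cs ! i, cs ! j) \<in> parcs G \<longleftrightarrow>
        j = Suc i mod length cs \<or> i = Suc j mod length cs)"

definition chordal :: "'a pair_pre_digraph \<Rightarrow> bool" where
  "chordal G \<longleftrightarrow> \<not> (\<exists>cs. induced_cycle G cs \<and> 4 \<le> length cs)"

definition path_between :: "'a pair_pre_digraph \<Rightarrow> 'a \<Rightarrow> 'a \<Rightarrow> 'a list \<Rightarrow> bool" where
  "path_between G u v p \<longleftrightarrow> vpath p (with_proj G) \<and> hd p = u \<and> last p = v"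

definition shortest_path :: "'a pair_pre_digraph \<Rightarrow> 'a \<Rightarrow> 'a \<Rightarrow> 'a list \<Rightarrow> bool" where
  "shortest_path G u v p \<longleftrightarrow>
     path_between G u v p \<and> (\<forall>q. path_between G u v q \<longrightarrow> vwalk_length p \<le> vwalk_length q)"

definition path_graph :: "'a list \<Rightarrow> 'a pair_pre_digraph" where
  "path_graph p =
     \<lparr> pverts = set p, parcs = set (vwalk_arcs p) \<union> (set (vwalk_arcs p))\<inverse> \<rparr>"


section \<open>Partial matrices and additive distance\<close>

definition psd_on :: "'a set \<Rightarrow> ('a \<Rightarrow> 'a \<Rightarrow> real) \<Rightarrow> bool" where
  "psd_on V A \<longleftrightarrow>
     (\<forall>i\<in>V. \<forall>j\<in>V. A i j = A j i) \<and>
     (\<forall>x. 0 \<le> (\<Sum>i\<in>V. \<Sum>j\<in>V. x i * A i j * x j))"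

definition specified :: "'a pair_pre_digraph \<Rightarrow> ('a \<times> 'a) set" where
  "specified G = parcs G \<union> Id_on (pverts G)"

text \<open>
  The value 0 outside \<open>specified G\<close> is only a normal form for functions on
  \<open>specified G\<close>; those entries are never read below except through a completion, which is free
  to change them.
\<close>

definition partial_matrices :: "'a pair_pre_digraph \<Rightarrow> ('a \<Rightarrow> 'a \<Rightarrow> real) set" where
  "partial_matrices G =
     {X. (\<forall>(i, j)\<in>specified G. X i j = X j i) \<and> (\<forall>i j. (i, j) \<notin> specified G \<longrightarrow> X i j = 0)}"

definition psd_completable :: "'a pair_pre_digraph \<Rightarrow> ('a \<Rightarrow> 'a \<Rightarrow> real) set" where
  "psd_completable G =
     {X \<in> partial_matrices G.
        \<exists>A. psd_on (pverts G) A \<and> (\<forall>(i, j)\<in>specified G. A i j = X i j)}"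

definition clique_psd :: "'a pair_pre_digraph \<Rightarrow> ('a \<Rightarrow> 'a \<Rightarrow> real) set" where
  "clique_psd G = {X \<in> partial_matrices G. \<forall>K. is_clique G K \<longrightarrow> psd_on K X}"

definition pm_trace :: "'a pair_pre_digraph \<Rightarrow> ('a \<Rightarrow> 'a \<Rightarrow> real) \<Rightarrow> real" where
  "pm_trace G X = (\<Sum>i\<in>pverts G. X i i)"

definition clique_psd_normalized :: "'a pair_pre_digraph \<Rightarrow> ('a \<Rightarrow> 'a \<Rightarrow> real) set" where
  "clique_psd_normalized G = {X \<in> clique_psd G. pm_trace G X = 1}"

definition pm_identity :: "'a pair_pre_digraph \<Rightarrow> 'a \<Rightarrow> 'a \<Rightarrow> real" where
  "pm_identity G i j = (if i = j \<and> i \<in> pverts G then 1 else 0)"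

definition eps_at :: "'a pair_pre_digraph \<Rightarrow> ('a \<Rightarrow> 'a \<Rightarrow> real) \<Rightarrow> real" where
  "eps_at G X = (LEAST \<epsilon>. (\<lambda>i j. X i j + \<epsilon> * pm_identity G i j) \<in> psd_completable G)"

definition additive_distance :: "'a pair_pre_digraph \<Rightarrow> real" where
  "additive_distance G = (GREATEST r. r \<in> eps_at G ` clique_psd_normalized G)"


section \<open>Gluing along a multidigraph, thickenings\<close>

definition multidigraph :: "('v, 'e) pre_digraph \<Rightarrow> bool" where
  "multidigraph D \<longleftrightarrow> fin_digraph D \<and> loopfree_digraph D"

definition gluing_data ::
  "('v, 'e) pre_digraph \<Rightarrow> ('e \<Rightarrow> 'c pair_pre_digraph) \<Rightarrow> ('e \<Rightarrow> 'c) \<Rightarrow> ('e \<Rightarrow> 'c) \<Rightarrow> bool" where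
  "gluing_data D C T H \<longleftrightarrow>
     (\<forall>e\<in>arcs D. connected_graph (C e) \<and> T e \<in> pverts (C e) \<and> H e \<in> pverts (C e) \<and> T e \<noteq> H e)"

text \<open>
  The disjoint union of \<open>verts D\<close> and the vertex sets of the \<open>C e\<close> lives in \<open>'v + 'e \<times> 'c\<close>. The
  vertices of the glued graph are the classes of the equivalence relation generated by
  \<open>T e \<sim> tail D e\<close> and \<open>H e \<sim> head D e\<close>.
\<close>

definition glue_ident ::
  "('v, 'e) pre_digraph \<Rightarrow> ('e \<Rightarrow> 'c) \<Rightarrow> ('e \<Rightarrow> 'c) \<Rightarrow> ('v + 'e \<times> 'c) rel" where
  "glue_ident D T H =
     {(Inr (e, T e), Inl (tail D e)) |e. e \<in> arcs D} \<union>
     {(Inr (e, H e), Inl (head D e)) |e. e \<in> arcs D}"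

definition glue_equiv ::
  "('v, 'e) pre_digraph \<Rightarrow> ('e \<Rightarrow> 'c) \<Rightarrow> ('e \<Rightarrow> 'c) \<Rightarrow> ('v + 'e \<times> 'c) rel" where
  "glue_equiv D T H = (glue_ident D T H \<union> (glue_ident D T H)\<inverse>)\<^sup>*"

definition glue_class ::
  "('v, 'e) pre_digraph \<Rightarrow> ('e \<Rightarrow> 'c) \<Rightarrow> ('e \<Rightarrow> 'c) \<Rightarrow> 'v + 'e \<times> 'c \<Rightarrow> ('v + 'e \<times> 'c) set" where
  "glue_class D T H x = glue_equiv D T H `` {x}"

text \<open>The image of \<open>C e\<close> in the glued graph.\<close>

definition glue_piece ::
  "('v, 'e) pre_digraph \<Rightarrow> ('e \<Rightarrow> 'c pair_pre_digraph) \<Rightarrow> ('e \<Rightarrow> 'c) \<Rightarrow> ('e \<Rightarrow> 'c) \<Rightarrow> 'e \<Rightarrow>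
   ('v + 'e \<times> 'c) set pair_pre_digraph" where
  "glue_piece D C T H e =
     \<lparr> pverts = (\<lambda>a. glue_class D T H (Inr (e, a))) ` pverts (C e),
       parcs = (\<lambda>(a, b). (glue_class D T H (Inr (e, a)), glue_class D T H (Inr (e, b)))) ` parcs (C e) \<rparr>"

definition glue ::
  "('v, 'e) pre_digraph \<Rightarrow> ('e \<Rightarrow> 'c pair_pre_digraph) \<Rightarrow> ('e \<Rightarrow> 'c) \<Rightarrow> ('e \<Rightarrow> 'c) \<Rightarrow>
   ('v + 'e \<times> 'c) set pair_pre_digraph" where
  "glue D C T H =
     \<lparr> pverts = glue_class D T H ` (verts D <+> (SIGMA e : arcs D. pverts (C e))),
       parcs = (\<Union>e\<in>arcs D. parcs (glue_piece D C T H e)) \<rparr>"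

definition thickening ::
  "('v, 'e) pre_digraph \<Rightarrow> ('e \<Rightarrow> 'c pair_pre_digraph) \<Rightarrow> ('e \<Rightarrow> 'c) \<Rightarrow> ('e \<Rightarrow> 'c) \<Rightarrow> bool" where
  "thickening D C T H \<longleftrightarrow>
     gluing_data D C T H \<and> (\<forall>e\<in>arcs D. chordal (C e)) \<and>
     (\<forall>K. is_clique (glue D C T H) K \<and> card K = 3 \<longrightarrow>
        (\<exists>e\<in>arcs D. is_clique (glue_piece D C T H e) K))"


text \<open>
  The identification has no side effects: \<open>glue_rep\<close> chooses a representative of each class, and
  the glued graph is a graph in the sense above; in particular no arc becomes a loop.
\<close>

definition glue_rep ::
  "('v, 'e) pre_digraph \<Rightarrow> ('e \<Rightarrow> 'c) \<Rightarrow> ('e \<Rightarrow> 'c) \<Rightarrow> 'v + 'e \<times> 'c \<Rightarrow> 'v + 'e \<times> 'c" where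
  "glue_rep D T H x =
     (case x of Inl v \<Rightarrow> Inl v
      | Inr (e, a) \<Rightarrow> if e \<in> arcs D \<and> a = T e then Inl (tail D e)
                      else if e \<in> arcs D \<and> a = H e then Inl (head D e) else Inr (e, a))"

lemma glue_equiv_iff:
  assumes "\<And>e. e \<in> arcs D \<Longrightarrow> T e \<noteq> H e"
  shows "(x, y) \<in> glue_equiv D T H \<longleftrightarrow> glue_rep D T H x = glue_rep D T H y"
proof
  assume "(x, y) \<in> glue_equiv D T H"
  then show "glue_rep D T H x = glue_rep D T H y"
    unfolding glue_equiv_def
  proof (induction rule: rtrancl_induct)
    case (step y z)
    then show ?case using assms assms[symmetric] by (auto simp: glue_ident_def glue_rep_def)
  qed simp
next
  let ?R = "glue_ident D T H \<union> (glue_ident D T H)\<inverse>"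
  have rep: "(x, glue_rep D T H x) \<in> ?R\<^sup>*" for x
    by (auto simp: glue_rep_def glue_ident_def split: sum.splits)
  have "sym (?R\<^sup>*)"
    by (intro sym_rtrancl) (auto simp: sym_def)
  moreover assume "glue_rep D T H x = glue_rep D T H y"
  ultimately show "(x, y) \<in> glue_equiv D T H"
    using rep[of x] rep[of y] unfolding glue_equiv_def by (metis rtrancl_trans symD)
qed

lemma glue_class_eq_iff:
  assumes "\<And>e. e \<in> arcs D \<Longrightarrow> T e \<noteq> H e"
  shows "glue_class D T H x = glue_class D T H y \<longleftrightarrow> glue_rep D T H x = glue_rep D T H y"
  using glue_equiv_iff[of D T H, OF assms] unfolding glue_class_def by (auto simp: set_eq_iff)

lemma pair_graph_glue:
  assumes D: "multidigraph D" and C: "gluing_data D C T H"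
  shows "pair_graph (glue D C T H)"
proof -
  interpret D: fin_digraph D using D by (simp add: multidigraph_def)
  interpret D: loopfree_digraph D using D by (simp add: multidigraph_def)
  have TH: "T e \<noteq> H e" if "e \<in> arcs D" for e using C that by (auto simp: gluing_data_def)
  have G: "pair_graph (C e)" if "e \<in> arcs D" for e
    using C that by (auto simp: gluing_data_def connected_graph_def)
  have in_verts: "a \<in> pverts (C e) \<and> b \<in> pverts (C e) \<and> a \<noteq> b \<and> (b, a) \<in> parcs (C e)"
    if "e \<in> arcs D" "(a, b) \<in> parcs (C e)" for e a b
  proof -
    interpret pair_graph "C e" by (rule G[OF that(1)])
    show ?thesis
      using pair_no_loops[OF that(2)] arc_fst_in_verts[OF that(2)] arc_snd_in_verts[OF that(2)]
        arcs_ends_symmetric[OF pair_sym_arcs, of a b] that(2) by simp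
  qed
  have fin: "finite (pverts (C e))" "finite (parcs (C e))" if "e \<in> arcs D" for e
  proof -
    interpret pair_graph "C e" by (rule G[OF that])
    show "finite (pverts (C e))" "finite (parcs (C e))"
      by (rule pair_finite_verts pair_finite_arcs)+
  qed
  have arcI: "(glue_class D T H (Inr (e, a)), glue_class D T H (Inr (e, b))) \<in> parcs (glue D C T H)"
    if "e \<in> arcs D" "(a, b) \<in> parcs (C e)" for e a b
    using that by (auto simp: glue_def glue_piece_def intro!: rev_image_eqI)
  have arcE: thesis
    if "(x, y) \<in> parcs (glue D C T H)"
      and "\<And>e a b. \<lbrakk>e \<in> arcs D; (a, b) \<in> parcs (C e); x = glue_class D T H (Inr (e, a));
             y = glue_class D T H (Inr (e, b))\<rbrakk> \<Longrightarrow> thesis" for x y thesis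
    using that by (auto simp: glue_def glue_piece_def)
  show ?thesis
  proof
    show "finite (pverts (glue D C T H))"
      by (auto simp: glue_def intro!: finite_imageI finite_Plus finite_SigmaI fin)
    show "finite (parcs (glue D C T H))"
      by (auto simp: glue_def glue_piece_def intro!: fin)
    show "symmetric (with_proj (glue D C T H))"
      unfolding symmetric_def with_proj_simps
    proof (rule symI)
      fix x y assume "(x, y) \<in> parcs (glue D C T H)"
      then show "(y, x) \<in> parcs (glue D C T H)"
        by (elim arcE) (use in_verts arcI in blast)
    qed
    show "fst z \<in> pverts (glue D C T H)" "snd z \<in> pverts (glue D C T H)" "fst z \<noteq> snd z"
      if "z \<in> parcs (glue D C T H)" for z
    proof -
      obtain x y where z: "z = (x, y)" by (cases z)
      obtain e a b where e: "e \<in> arcs D" "(a, b) \<in> parcs (C e)"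
        and xy: "x = glue_class D T H (Inr (e, a))" "y = glue_class D T H (Inr (e, b))"
        using \<open>z \<in> _\<close> unfolding z by (elim arcE)
      note ab = in_verts[OF e]
      show "fst z \<in> pverts (glue D C T H)" "snd z \<in> pverts (glue D C T H)"
        using e(1) ab by (auto simp: z xy glue_def)
      show "fst z \<noteq> snd z"
        using ab e(1) D.no_loops[OF e(1)]
        by (auto simp: z xy glue_class_eq_iff[of D T H, OF TH] glue_rep_def)
    qed
  qed
qed

end

theory Submission
  imports Defs
begin

text \<open>
  Write \<open>G\<close> for the thickening and \<open>L\<close> for the glued paths. As \<open>L\<close> is an induced subgraph of \<open>G\<close>,
  extension by zero gives \<open>\<epsilon>(L) \<le> \<epsilon>(G)\<close>. For the converse it suffices that \<open>X + \<epsilon>(L) tr(X) I\<close> is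
  completable for every \<open>X\<close> in \<open>P(G)\<close>; such \<open>X\<close> form a convex cone.

  On a piece \<open>C e\<close> whose end points are not adjacent, \<open>X\<close> is completable, because \<open>C e\<close> is chordal,
  and the completion is a sum of rank one matrices \<open>y y\<^sup>T\<close> in which the two diagonal entries at \<open>T e\<close>
  and \<open>H e\<close> keep their ratio. Each summand extends to an element of \<open>P(G)\<close> by rescaling \<open>X\<close> off the
  piece, so one may assume that \<open>X\<close> has the form \<open>x x\<^sup>T\<close> on each such piece. Now let \<open>z\<close> be the vector
  on the path whose \<open>k\<close>-th entry is the Euclidean norm of \<open>x\<close> on the \<open>k\<close>-th distance layer of \<open>C e\<close>.
  This preserves the trace, and as \<open>L\<close> has no triangles the matrices \<open>z z\<^sup>T\<close> define an element of \<open>P(L)\<close>.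
  A completion \<open>M\<close> of its shift by \<open>\<epsilon> I\<close> yields the completion \<open>U M U\<^sup>T + \<epsilon> (I - U U\<^sup>T)\<close> on \<open>C e\<close>, where the
  columns of \<open>U\<close> are the unit vectors in the directions of the layers of \<open>x\<close>; it agrees with \<open>M\<close> at
  the end points, so that these completions amalgamate.
\<close>

section \<open>Positive semidefinite matrices\<close>

text \<open>The obstacle is that pieces share vertices, so no change to one piece may disturb the
  others. If the ends of a piece are not adjacent in it, \<open>X\<close> prescribes only the two
  diagonal entries there. A summand that scales both by the same weight \<open>l\<close> therefore
  fits \<open>l X\<close> on the rest of the graph, and the weights sum to 1. If the ends are
  adjacent, their off-diagonal entry is prescribed too, and a rank one summand need not scale it by
  \<open>l\<close>. Such a piece is left as it is: its path is one edge without interior, and a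
  chordal completion of \<open>X\<close> plus \<epsilon> on the diagonal serves it.

  The triangle condition is used twice. It makes \<open>L\<close> free of triangles, so that
  membership in \<open>P(L)\<close> is a condition on single edges; and it forces a clique of
  \<open>G\<close> through an interior vertex of a piece into that piece, so that entries on one
  piece can be exchanged without leaving \<open>P(G)\<close>.

  Layer norms are the right entries for \<open>z\<close> because then \<open>x = U z\<close> with
  orthonormal columns: the trace is kept, and \<open>I - U U^T\<close> is positive semidefinite. Its
  factor must be nonnegative, whence the need for \<epsilon>(L) \<ge> 0.\<close>

definition qform :: "'a set \<Rightarrow> ('a \<Rightarrow> 'a \<Rightarrow> real) \<Rightarrow> ('a \<Rightarrow> real) \<Rightarrow> real" where
  "qform V A x = (\<Sum>i\<in>V. \<Sum>j\<in>V. x i * A i j * x j)"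

lemma psd_onI:
  assumes "\<And>i j. i \<in> V \<Longrightarrow> j \<in> V \<Longrightarrow> A i j = A j i" "\<And>x. 0 \<le> qform V A x"
  shows "psd_on V A"
  using assms unfolding psd_on_def qform_def by blast

lemma psd_on_sym: "psd_on V A \<Longrightarrow> i \<in> V \<Longrightarrow> j \<in> V \<Longrightarrow> A i j = A j i"
  unfolding psd_on_def by blast

lemma psd_on_qform: "psd_on V A \<Longrightarrow> 0 \<le> qform V A x"
  unfolding psd_on_def qform_def by blast

lemma qform_cong:
  "(\<And>i. i \<in> V \<Longrightarrow> x i = y i) \<Longrightarrow> (\<And>i j. i \<in> V \<Longrightarrow> j \<in> V \<Longrightarrow> A i j = B i j) \<Longrightarrow> qform V A x = qform V B y"
  unfolding qform_def by (auto intro!: sum.cong)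

lemma psd_on_cong:
  assumes "\<And>i j. i \<in> V \<Longrightarrow> j \<in> V \<Longrightarrow> A i j = B i j"
  shows "psd_on V A \<longleftrightarrow> psd_on V B"
proof -
  have "qform V A x = qform V B x" for x using assms by (intro qform_cong) auto
  then show ?thesis using assms unfolding psd_on_def qform_def[symmetric] by auto
qed

lemma qform_add: "qform V (\<lambda>i j. A i j + B i j) x = qform V A x + qform V B x"
  unfolding qform_def by (simp add: algebra_simps sum.distrib)

lemma qform_scale: "qform V (\<lambda>i j. c * A i j) x = c * qform V A x"
  unfolding qform_def by (simp add: sum_distrib_left algebra_simps)

lemma qform_rank_one: "qform V (\<lambda>i j. y i * y j) x = (\<Sum>i\<in>V. x i * y i)\<^sup>2"
  unfolding qform_def power2_eq_square sum_product by (simp add: algebra_simps)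

lemma qform_diagonal:
  assumes "finite V" shows "qform V (\<lambda>i j. if i = j then d i else 0) x = (\<Sum>i\<in>V. d i * (x i)\<^sup>2)"
proof -
  have "x i * (if i = j then d i else 0) * x j = (if i = j then d i * (x i)\<^sup>2 else 0)" for i j
    by (simp add: power2_eq_square)
  then show ?thesis using assms unfolding qform_def by simp
qed

lemma qform_unit:
  assumes "finite V" "i \<in> V"
  shows "qform V A (\<lambda>k. if k = i then 1 else 0) = A i i"
proof -
  have "qform V A (\<lambda>k. if k = i then 1 else 0) = (\<Sum>k\<in>V. if k = i then A i i else 0)"
    unfolding qform_def
  proof (intro sum.cong refl)
    fix k assume "k \<in> V"
    show "(\<Sum>j\<in>V. (if k = i then 1 else 0) * A k j * (if j = i then 1 else 0)) = (if k = i then A i i else 0)"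
      using assms by (simp add: if_distrib cong: if_cong)
  qed
  then show ?thesis using assms by simp
qed

lemma psd_on_diag_nonneg: "psd_on V A \<Longrightarrow> finite V \<Longrightarrow> i \<in> V \<Longrightarrow> 0 \<le> A i i"
  using psd_on_qform[of V A "\<lambda>k. if k = i then 1 else 0"] by (simp add: qform_unit)

lemma psd_on_add: "psd_on V A \<Longrightarrow> psd_on V B \<Longrightarrow> psd_on V (\<lambda>i j. A i j + B i j)"
  by (rule psd_onI) (simp_all add: qform_add psd_on_qform, metis psd_on_sym)

lemma psd_on_scale: "psd_on V A \<Longrightarrow> 0 \<le> c \<Longrightarrow> psd_on V (\<lambda>i j. c * A i j)"
  by (rule psd_onI) (simp_all add: qform_scale psd_on_qform, metis psd_on_sym)

lemma psd_on_rank_one: "psd_on V (\<lambda>i j. y i * y j)"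
  by (rule psd_onI) (auto simp: qform_rank_one)

lemma psd_on_diagonal:
  assumes "finite V" "\<And>i. i \<in> V \<Longrightarrow> 0 \<le> d i"
  shows "psd_on V (\<lambda>i j. if i = j then d i else 0)"
  using assms by (intro psd_onI) (auto simp: qform_diagonal intro!: sum_nonneg)

lemma psd_on_zero: "psd_on V (\<lambda>i j. 0)"
  by (rule psd_onI) (auto simp: qform_def)

lemma sum_group_fibres:
  fixes f :: "'a \<Rightarrow> real"
  assumes "finite W" "finite V" "\<pi> ` W \<subseteq> V"
  shows "(\<Sum>i\<in>W. f i) = (\<Sum>k\<in>V. \<Sum>i\<in>{i\<in>W. \<pi> i = k}. f i)"
  using sum.group[OF assms(1,2,3), of f] by simp

text \<open>The matrix on the left is \<open>U M U^T\<close>, where column \<open>k\<close> of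
  \<open>U\<close> carries \<open>u\<close> on the fibre of \<pi> over \<open>k\<close>; its form at
  \<open>x\<close> is the form of \<open>M\<close> at \<open>U^T x\<close>.\<close>

lemma qform_pullback:
  assumes "finite W" "finite V" "\<pi> ` W \<subseteq> V"
  shows "qform W (\<lambda>i j. u i * u j * M (\<pi> i) (\<pi> j)) x =
         qform V M (\<lambda>k. \<Sum>i\<in>{i\<in>W. \<pi> i = k}. u i * x i)"
proof -
  have "qform V M (\<lambda>k. \<Sum>i\<in>{i\<in>W. \<pi> i = k}. u i * x i) =
    (\<Sum>k\<in>V. \<Sum>l\<in>V. \<Sum>i\<in>{i\<in>W. \<pi> i = k}. \<Sum>j\<in>{j\<in>W. \<pi> j = l}. u i * x i * M k l * (u j * x j))"
    unfolding qform_def by (simp only: sum_distrib_right) (simp only: sum_distrib_left)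
  also have "\<dots> = (\<Sum>k\<in>V. \<Sum>i\<in>{i\<in>W. \<pi> i = k}. \<Sum>l\<in>V. \<Sum>j\<in>{j\<in>W. \<pi> j = l}. u i * x i * M k l * (u j * x j))"
    by (rule sum.cong[OF refl], rule sum.swap)
  also have "\<dots> = (\<Sum>k\<in>V. \<Sum>i\<in>{i\<in>W. \<pi> i = k}. \<Sum>l\<in>V. \<Sum>j\<in>{j\<in>W. \<pi> j = l}. u i * x i * M (\<pi> i) (\<pi> j) * (u j * x j))"
    by (intro sum.cong) auto
  also have "\<dots> = (\<Sum>i\<in>W. \<Sum>l\<in>V. \<Sum>j\<in>{j\<in>W. \<pi> j = l}. u i * x i * M (\<pi> i) (\<pi> j) * (u j * x j))"
    by (rule sum_group_fibres[OF assms, symmetric])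
  also have "\<dots> = (\<Sum>i\<in>W. \<Sum>j\<in>W. u i * x i * M (\<pi> i) (\<pi> j) * (u j * x j))"
    by (intro sum.cong refl sum_group_fibres[OF assms, symmetric])
  finally show ?thesis unfolding qform_def by (simp add: mult_ac)
qed

lemma psd_on_pullback:
  assumes "psd_on V M" "finite W" "finite V" "\<pi> ` W \<subseteq> V"
  shows "psd_on W (\<lambda>i j. u i * u j * M (\<pi> i) (\<pi> j))"
proof (rule psd_onI)
  show "u i * u j * M (\<pi> i) (\<pi> j) = u j * u i * M (\<pi> j) (\<pi> i)" if "i \<in> W" "j \<in> W" for i j
    using psd_on_sym[OF assms(1), of "\<pi> i" "\<pi> j"] assms(4) that by (auto simp: image_subset_iff)
qed (simp add: qform_pullback[OF assms(2-4)] psd_on_qform[OF assms(1)])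

lemma psd_on_compose:
  assumes "psd_on V M" "finite W" "finite V" "\<pi> ` W \<subseteq> V"
  shows "psd_on W (\<lambda>i j. M (\<pi> i) (\<pi> j))"
  using psd_on_pullback[OF assms, of "\<lambda>_. 1"] by simp

lemma psd_on_subset: "psd_on V A \<Longrightarrow> finite V \<Longrightarrow> W \<subseteq> V \<Longrightarrow> psd_on W A"
  using psd_on_compose[of V A W id] by (simp add: finite_subset)

section \<open>Schur complements and amalgamation along a common principal block\<close>

lemma qform_insert:
  assumes "finite V" "v \<notin> V" "\<And>i. i \<in> V \<Longrightarrow> A i v = A v i"
  shows "qform (insert v V) A x = qform V A x + 2 * x v * (\<Sum>j\<in>V. A v j * x j) + A v v * (x v)\<^sup>2"
proof -
  have "(\<Sum>i\<in>V. x i * A i v * x v) = x v * (\<Sum>j\<in>V. A v j * x j)"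
    using assms(3) unfolding sum_distrib_left by (intro sum.cong) (auto simp: mult_ac)
  moreover have "(\<Sum>j\<in>V. x v * A v j * x j) = x v * (\<Sum>j\<in>V. A v j * x j)"
    unfolding sum_distrib_left by (simp add: mult_ac)
  ultimately show ?thesis
    using assms(1,2) unfolding qform_def by (simp add: sum.distrib power2_eq_square algebra_simps)
qed

lemma psd_on_off_diag:
  assumes "psd_on V A" "finite V" "i \<in> V" "j \<in> V"
  shows "(A i j)\<^sup>2 \<le> A i i * A j j"
proof (cases "i = j")
  case False
  have psd: "psd_on {i, j} A" by (rule psd_on_subset[OF assms(1,2)]) (use assms in auto)
  have s: "A j i = A i j" by (rule psd_on_sym[OF assms(1,4,3)])
  have q: "0 \<le> A j j * b\<^sup>2 + 2 * a * (A i j * b) + A i i * a\<^sup>2" for a b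
  proof -
    have "qform {i, j} A (\<lambda>k. if k = i then a else b) = A j j * b\<^sup>2 + 2 * a * (A i j * b) + A i i * a\<^sup>2"
      using False by (subst qform_insert) (simp_all add: s, simp add: qform_def power2_eq_square)
    then show ?thesis using psd_on_qform[OF psd, of "\<lambda>k. if k = i then a else b"] by simp
  qed
  have nn: "0 \<le> A i i" "0 \<le> A j j" by (rule psd_on_diag_nonneg[OF assms(1,2)], fact)+
  show ?thesis
  proof (cases "A i i = 0")
    case True
    have "A i j = 0"
    proof (rule ccontr)
      assume ne: "A i j \<noteq> 0"
      \<comment> \<open>With \<open>A i i = 0\<close> and \<open>b = 1\<close> the form is affine in
        \<open>a\<close> with slope \<open>2 * A i j\<close>; this \<open>a\<close> is chosen to
        give it the value -1.\<close>
      have "0 \<le> A j j + 2 * (- (A j j + 1) / (2 * A i j)) * A i j"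
        using q[of 1 "- (A j j + 1) / (2 * A i j)"] True by simp
      also have "\<dots> = -1" using ne by (simp add: field_simps)
      finally show False by simp
    qed
    then show ?thesis using nn by simp
  next
    case ne: False
    have "0 \<le> A j j * (A i i)\<^sup>2 + 2 * (- A i j) * (A i j * A i i) + A i i * (A i j)\<^sup>2"
      using q[of "A i i" "- A i j"] by simp
    also have "\<dots> = A i i * (A i i * A j j - (A i j)\<^sup>2)"
      by (simp add: power2_eq_square algebra_simps)
    finally show ?thesis using ne nn by (simp add: zero_le_mult_iff)
  qed
qed (simp add: power2_eq_square)

lemma psd_on_zero_row:
  "psd_on V A \<Longrightarrow> finite V \<Longrightarrow> i \<in> V \<Longrightarrow> A i i = 0 \<Longrightarrow> j \<in> V \<Longrightarrow> A i j = 0"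
  using psd_on_off_diag[of V A i j] by simp

text \<open>The form of the complement at \<open>x\<close> is the form of the whole matrix at
  \<open>x\<close> extended by \<open>- r / A v v\<close> at \<open>v\<close>, the minimiser when
  the pivot is positive. For \<open>A v v = 0\<close> division yields 0, nothing is subtracted, and
  the claim is that for a principal submatrix.\<close>

lemma psd_on_schur:
  assumes "psd_on (insert v V) A" "finite V" "v \<notin> V"
  shows "psd_on V (\<lambda>i j. A i j - A i v * A v j / A v v)"
proof (rule psd_onI)
  have s: "A i j = A j i" if "i \<in> insert v V" "j \<in> insert v V" for i j
    using psd_on_sym[OF assms(1)] that by blast
  show "A i j - A i v * A v j / A v v = A j i - A j v * A v i / A v v" if "i \<in> V" "j \<in> V" for i j
  proof -
    have "A i j = A j i" "A i v = A v i" "A v j = A j v" using that s by blast+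
    then show ?thesis by (simp only: mult.commute)
  qed
  fix x
  define r where "r = (\<Sum>j\<in>V. A v j * x j)"
  define y where "y = x(v := - r / A v v)"
  have "qform V (\<lambda>i j. A i j - A i v * A v j / A v v) x
      = qform V (\<lambda>i j. A i j + (- 1 / A v v) * (A v i * A v j)) x"
  proof (intro qform_cong refl)
    fix i j assume "i \<in> V" "j \<in> V"
    then show "A i j - A i v * A v j / A v v = A i j + (- 1 / A v v) * (A v i * A v j)"
      using s[of i v] by simp
  qed
  also have "\<dots> = qform V A x - r\<^sup>2 / A v v"
    by (subst qform_add, subst qform_scale, subst qform_rank_one) (simp add: r_def mult.commute)
  also have "\<dots> = qform (insert v V) A y"
  proof -
    have y: "qform V A y = qform V A x" "(\<Sum>j\<in>V. A v j * y j) = r"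
      using assms(3) unfolding r_def by (auto simp: y_def intro!: qform_cong sum.cong)
    have "qform (insert v V) A y = qform V A y + 2 * y v * (\<Sum>j\<in>V. A v j * y j) + A v v * (y v)\<^sup>2"
      using s by (intro qform_insert[OF assms(2,3)]) auto
    then show ?thesis unfolding y by (simp add: y_def power2_eq_square)
  qed
  finally show "0 \<le> qform V (\<lambda>i j. A i j - A i v * A v j / A v v) x"
    using psd_on_qform[OF assms(1)] by simp
qed

text \<open>In a positive semidefinite matrix the column of \<open>v\<close>, restricted to
  \<open>K\<close>, lies in the range of the block on \<open>K\<close>, even if that block is
  singular. Gaussian elimination of one index \<open>w\<close> at a time shows this, since the Schur
  complement stays positive semidefinite.\<close>

lemma psd_on_range:
  assumes "finite K" "v \<notin> K" "psd_on (insert v K) B"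
  shows "\<exists>y. \<forall>k\<in>K. B k v = (\<Sum>j\<in>K. B k j * y j)"
  using assms
proof (induction K arbitrary: B rule: finite_induct)
  case (insert w K)
  have v: "v \<notin> K" "v \<noteq> w" using insert.prems by auto
  define B' where "B' = (\<lambda>i j. B i j - B i w * B w j / B w w)"
  have psd: "psd_on (insert w (insert v K)) B" using insert.prems(2) by (simp add: insert_commute)
  then have "psd_on (insert v K) B'"
    unfolding B'_def using insert v by (intro psd_on_schur) auto
  then obtain y where y: "\<And>k. k \<in> K \<Longrightarrow> B' k v = (\<Sum>j\<in>K. B' k j * y j)"
    using insert.IH[OF v(1)] by metis
  \<comment> \<open>Solves the equation of row \<open>w\<close>; the remaining rows then follow from
    those of the complement. If \<open>B w w = 0\<close>, the row and column of \<open>w\<close>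
    vanish and the value 0 given by division does no harm.\<close>
  define c where "c = (B w v - (\<Sum>j\<in>K. B w j * y j)) / B w w"
  have sK: "(\<Sum>j\<in>insert w K. B k j * (y(w := c)) j) = B k w * c + (\<Sum>j\<in>K. B k j * y j)" for k
    using insert(1,2) by (simp add: sum.insert) (intro sum.cong, auto)
  have sym: "B i j = B j i" if "i \<in> insert w (insert v K)" "j \<in> insert w (insert v K)" for i j
    using psd_on_sym[OF psd] that by blast
  have "B k v = (\<Sum>j\<in>insert w K. B k j * (y(w := c)) j)" if k: "k \<in> insert w K" for k
  proof (cases "B w w = 0")
    case True
    have z: "B w j = 0" "B j w = 0" if "j \<in> insert w (insert v K)" for j
      using psd_on_zero_row[OF psd _ _ True] that insert(1) sym by auto
    show ?thesis
    proof (cases "k = w")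
      case True
      then show ?thesis using z unfolding sK by simp
    next
      case False
      then have "k \<in> K" using k by auto
      then show ?thesis using y[of k] z k unfolding sK B'_def by (simp add: True)
    qed
  next
    case nz: False
    show ?thesis
    proof (cases "k = w")
      case True
      then show ?thesis unfolding sK by (simp add: c_def nz)
    next
      case False
      then have "k \<in> K" using k by auto
      then have "B k v - B k w * B w v / B w w = (\<Sum>j\<in>K. B k j * y j) - B k w / B w w * (\<Sum>j\<in>K. B w j * y j)"
        using y[of k] unfolding B'_def
        by (simp add: left_diff_distrib sum_subtractf sum_distrib_left mult.assoc)
      then show ?thesis unfolding sK by (simp add: c_def nz field_simps)
    qed
  qed
  then show ?case by blast
qed simp

text \<open>The new column is \<open>A z\<close>, where \<open>z\<close> is supported on
  \<open>K\<close> and solves the range equation for the column of \<open>v\<close> in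
  \<open>B\<close>. Completing the square turns the extended form into the form of \<open>A\<close>
  at \<open>x + x v * z\<close> plus \<open>(x v)\<^sup>2 * (B v v - c)\<close>, where
  \<open>c\<close> is the form of \<open>A\<close> at \<open>z\<close>.\<close>

lemma psd_on_extend_vertex:
  assumes A: "psd_on W A" and B: "psd_on (insert v K) B"
    and K: "finite W" "K \<subseteq> W" "v \<notin> W" and agree: "\<And>i j. i \<in> K \<Longrightarrow> j \<in> K \<Longrightarrow> A i j = B i j"
  shows "\<exists>A'. psd_on (insert v W) A' \<and> (\<forall>i\<in>W. \<forall>j\<in>W. A' i j = A i j) \<and>
           (\<forall>i\<in>insert v K. \<forall>j\<in>insert v K. A' i j = B i j)"
proof -
  have fK: "finite K" "v \<notin> K" using K finite_subset by auto
  obtain y where y: "\<And>k. k \<in> K \<Longrightarrow> B k v = (\<Sum>j\<in>K. B k j * y j)"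
    using psd_on_range[OF fK B] by metis
  define z where "z = (\<lambda>k. if k \<in> K then y k else 0)"
  define b where "b = (\<lambda>j. \<Sum>k\<in>W. z k * A k j)"
  define A' where "A' = (\<lambda>i j. if i = v then (if j = v then B v v else b j) else if j = v then b i else A i j)"
  have symA: "A i j = A j i" if "i \<in> W" "j \<in> W" for i j using psd_on_sym[OF A that] .
  have symB: "B i j = B j i" if "i \<in> insert v K" "j \<in> insert v K" for i j using psd_on_sym[OF B that] .
  have zK: "(\<Sum>k\<in>W. z k * f k) = (\<Sum>k\<in>K. y k * f k)" for f
    using K fK by (intro sum.mono_neutral_cong_right) (auto simp: z_def)
  have bK: "b k = B k v" if "k \<in> K" for k
    unfolding b_def zK y[OF that]
  proof (intro sum.cong refl)
    fix j assume "j \<in> K"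
    then show "y j * A j k = B k j * y j" using that agree symB[of j k] by simp
  qed
  define c where "c = qform W A z"
  have cb: "c = (\<Sum>j\<in>W. z j * b j)"
    unfolding c_def qform_def b_def sum_distrib_left by (subst sum.swap) (simp add: mult_ac)
  \<comment> \<open>The form of \<open>B\<close> at the vector with entry 1 at \<open>v\<close> and
    \<open>- y\<close> on \<open>K\<close> equals \<open>B v v - c\<close>.\<close>
  have cB: "c \<le> B v v"
  proof -
    define w where "w = (\<lambda>k. if k = v then 1 else - y k)"
    have w: "(\<Sum>k\<in>K. f k * w k) = - (\<Sum>k\<in>K. f k * y k)" for f
    proof -
      have "(\<Sum>k\<in>K. f k * w k) = (\<Sum>k\<in>K. - (f k * y k))"
        using fK by (intro sum.cong) (auto simp: w_def)
      then show ?thesis by (simp add: sum_negf)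
    qed
    have c2: "c = (\<Sum>k\<in>K. B v k * y k)"
      unfolding cb zK using bK symB by (intro sum.cong) auto
    have q: "qform K B w = c"
    proof -
      have "qform K B w = (\<Sum>i\<in>K. w i * (\<Sum>j\<in>K. B i j * w j))"
        unfolding qform_def by (simp add: sum_distrib_left mult_ac)
      also have "\<dots> = (\<Sum>i\<in>K. - B i v * w i)"
        using y by (intro sum.cong) (auto simp: w)
      also have "\<dots> = c" unfolding w c2 using symB by (auto simp: sum_negf intro!: sum.cong)
      finally show ?thesis .
    qed
    have "0 \<le> qform (insert v K) B w" using psd_on_qform[OF B] .
    also have "\<dots> = c + 2 * w v * (- (\<Sum>k\<in>K. B v k * y k)) + B v v * (w v)\<^sup>2"
      using fK symB by (subst qform_insert) (auto simp: q w)
    finally show ?thesis by (simp add: w_def c2[symmetric])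
  qed
  have "psd_on (insert v W) A'"
  proof (rule psd_onI)
    show "A' i j = A' j i" if "i \<in> insert v W" "j \<in> insert v W" for i j
      using that symA unfolding A'_def by auto
    fix x
    have e1: "qform W A' x = qform W A x"
      using K(3) by (intro qform_cong) (auto simp: A'_def)
    have e2: "(\<Sum>j\<in>W. A' v j * x j) = (\<Sum>j\<in>W. b j * x j)"
      using K(3) by (intro sum.cong) (auto simp: A'_def)
    have cross: "(\<Sum>i\<in>W. \<Sum>j\<in>W. x i * A i j * z j) = (\<Sum>j\<in>W. b j * x j)"
      unfolding b_def sum_distrib_right using symA
      by (intro sum.cong refl) (auto simp: mult_ac)
    have cross2: "(\<Sum>i\<in>W. \<Sum>j\<in>W. z i * A i j * x j) = (\<Sum>j\<in>W. b j * x j)"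
      unfolding b_def sum_distrib_right by (subst sum.swap) simp
    have "qform W A (\<lambda>i. x i + x v * z i) = qform W A x + x v * (\<Sum>i\<in>W. \<Sum>j\<in>W. x i * A i j * z j)
        + x v * (\<Sum>i\<in>W. \<Sum>j\<in>W. z i * A i j * x j) + (x v)\<^sup>2 * c"
      unfolding c_def qform_def sum_distrib_left sum.distrib[symmetric]
      by (intro sum.cong refl) (simp add: algebra_simps power2_eq_square)
    also have "\<dots> = qform W A x + 2 * x v * (\<Sum>j\<in>W. b j * x j) + (x v)\<^sup>2 * c"
      unfolding cross cross2 by simp
    finally have e3: "qform W A (\<lambda>i. x i + x v * z i) =
        qform W A x + 2 * x v * (\<Sum>j\<in>W. b j * x j) + (x v)\<^sup>2 * c" .
    have "qform (insert v W) A' x = qform W A' x + 2 * x v * (\<Sum>j\<in>W. A' v j * x j) + A' v v * (x v)\<^sup>2"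
      using K by (intro qform_insert) (auto simp: A'_def)
    also have "\<dots> = qform W A (\<lambda>i. x i + x v * z i) + (x v)\<^sup>2 * (B v v - c)"
      unfolding e1 e2 e3 by (simp add: A'_def algebra_simps)
    finally have "qform (insert v W) A' x = qform W A (\<lambda>i. x i + x v * z i) + (x v)\<^sup>2 * (B v v - c)" .
    then show "0 \<le> qform (insert v W) A' x"
      using psd_on_qform[OF A, of "\<lambda>i. x i + x v * z i"] cB by simp
  qed
  moreover have "\<forall>i\<in>W. \<forall>j\<in>W. A' i j = A i j" using K(3) unfolding A'_def by auto
  moreover have "\<forall>i\<in>insert v K. \<forall>j\<in>insert v K. A' i j = B i j"
    using bK symB agree fK(2) unfolding A'_def by auto
  ultimately show ?thesis by blast
qed

text \<open>Entries between \<open>V - W\<close> and \<open>W - V\<close> are free, so the vertices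
  of \<open>W - V\<close> can be joined one at a time. Each new vertex has its column prescribed by
  \<open>B\<close> exactly on the vertices of \<open>W\<close> already present, which is the block
  \<open>K\<close> of \<open>psd_on_extend_vertex\<close>.\<close>

lemma psd_on_amalgamate:
  assumes "psd_on V A" "psd_on W B" "finite V" "finite W"
    and "\<And>i j. i \<in> V \<inter> W \<Longrightarrow> j \<in> V \<inter> W \<Longrightarrow> A i j = B i j"
  shows "\<exists>M. psd_on (V \<union> W) M \<and> (\<forall>i\<in>V. \<forall>j\<in>V. M i j = A i j) \<and> (\<forall>i\<in>W. \<forall>j\<in>W. M i j = B i j)"
proof -
  have "\<exists>M. psd_on (V \<union> U) M \<and> (\<forall>i\<in>V. \<forall>j\<in>V. M i j = A i j) \<and>
      (\<forall>i\<in>(V \<inter> W) \<union> U. \<forall>j\<in>(V \<inter> W) \<union> U. M i j = B i j)"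
    if "finite U" "U \<subseteq> W - V" for U
    using that
  proof (induction U rule: finite_induct)
    case empty
    then show ?case using assms by (intro exI[of _ A]) auto
  next
    case (insert v U)
    then obtain M where M: "psd_on (V \<union> U) M" "\<forall>i\<in>V. \<forall>j\<in>V. M i j = A i j"
      "\<forall>i\<in>(V \<inter> W) \<union> U. \<forall>j\<in>(V \<inter> W) \<union> U. M i j = B i j" by auto
    have "psd_on (insert v ((V \<inter> W) \<union> U)) B"
      using assms insert by (intro psd_on_subset[OF assms(2)]) auto
    then have "\<exists>M'. psd_on (insert v (V \<union> U)) M' \<and> (\<forall>i\<in>V \<union> U. \<forall>j\<in>V \<union> U. M' i j = M i j) \<and>
      (\<forall>i\<in>insert v ((V \<inter> W) \<union> U). \<forall>j\<in>insert v ((V \<inter> W) \<union> U). M' i j = B i j)"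
      by (rule psd_on_extend_vertex[OF M(1)]) (use insert assms M(3) in auto)
    then obtain M' where
      "psd_on (insert v (V \<union> U)) M'" "\<forall>i\<in>V \<union> U. \<forall>j\<in>V \<union> U. M' i j = M i j"
      "\<forall>i\<in>insert v ((V \<inter> W) \<union> U). \<forall>j\<in>insert v ((V \<inter> W) \<union> U). M' i j = B i j"
      by blast
    then show ?case using M(2) by (intro exI[of _ M']) auto
  qed
  from this[of "W - V"] show ?thesis using assms by (auto simp: Int_Un_distrib)
qed


section \<open>Rank one decompositions\<close>

text \<open>Cholesky elimination: the normalised column of \<open>v\<close> is split off and the
  Schur complement is decomposed recursively. For a zero pivot the column vanishes, in agreement
  with the value of \<open>x0\<close> under division by zero.\<close>

lemma psd_on_gram:
  assumes "finite V" "psd_on V A"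
  shows "\<exists>L. \<forall>i\<in>V. \<forall>j\<in>V. A i j = (\<Sum>x\<leftarrow>L. x i * x j)"
  using assms
proof (induction V arbitrary: A rule: finite_induct)
  case (insert v V)
  have "psd_on V (\<lambda>i j. A i j - A i v * A v j / A v v)"
    using insert by (intro psd_on_schur) auto
  then obtain L where L: "\<forall>i\<in>V. \<forall>j\<in>V. A i j - A i v * A v j / A v v = (\<Sum>x\<leftarrow>L. x i * x j)"
    using insert.IH by blast
  have sym: "A i j = A j i" if "i \<in> insert v V" "j \<in> insert v V" for i j
    by (rule psd_on_sym[OF insert.prems that])
  have nn: "0 \<le> A v v" using insert by (intro psd_on_diag_nonneg[OF insert.prems]) auto
  have zero: "A v j = 0" if "A v v = 0" "j \<in> insert v V" for j
    using psd_on_zero_row[OF insert.prems _ _ that(1) that(2)] insert.hyps by auto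
  define x0 where "x0 = (\<lambda>i. A i v / sqrt (A v v))"
  have x0: "x0 i * x0 j = A i v * A v j / A v v" if "i \<in> insert v V" "j \<in> insert v V" for i j
    using nn sym[of j v] that unfolding x0_def by simp
  have x0v: "x0 v * x0 j = A v j" if "j \<in> insert v V" for j
    using zero[OF _ that] x0[of v j] that by (cases "A v v = 0") auto
  \<comment> \<open>The recursive vectors are controlled on \<open>V\<close> only, hence the reset
    at \<open>v\<close>.\<close>
  define L' where "L' = x0 # map (\<lambda>x. x(v := 0)) L"
  have L'V: "(\<Sum>x\<leftarrow>L'. x i * x j) = x0 i * x0 j + (\<Sum>x\<leftarrow>L. x i * x j)" if "i \<in> V" "j \<in> V" for i j
    using that insert.hyps unfolding L'_def
    by (auto simp: o_def intro!: arg_cong[where f = sum_list])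
  have L'v: "(\<Sum>x\<leftarrow>L'. x v * x j) = x0 v * x0 j" "(\<Sum>x\<leftarrow>L'. x j * x v) = x0 j * x0 v" for j
    unfolding L'_def by (simp_all add: o_def)
  have "A i j = (\<Sum>x\<leftarrow>L'. x i * x j)" if ij: "i \<in> insert v V" "j \<in> insert v V" for i j
  proof (cases "i = v \<or> j = v")
    case True
    then show ?thesis using L'v[of i] L'v[of j] x0v[of i] x0v[of j] ij sym[of i j]
      by (auto simp: mult.commute)
  next
    case False
    then have "i \<in> V" "j \<in> V" using ij by auto
    then show ?thesis using L'V[of i j] L x0[of i j] by force
  qed
  then show ?case by blast
qed simp

text \<open>Opposite signs of \<open>a\<close> and \<open>c\<close> make the discriminant of
  \<open>a + 2 r b + r^2 c\<close> positive; \<open>(s, t)\<close> is \<open>(1, r)\<close> for a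
  root \<open>r\<close>, scaled to unit length so that it defines a rotation.\<close>

lemma quadratic_rotation_zero:
  fixes a b c :: real
  assumes "a * c < 0"
  shows "\<exists>s t. s\<^sup>2 + t\<^sup>2 = 1 \<and> s\<^sup>2 * a + 2 * s * t * b + t\<^sup>2 * c = 0"
proof -
  have c: "c \<noteq> 0" using assms by auto
  define D where "D = sqrt (b\<^sup>2 - a * c)"
  define r where "r = (D - b) / c"
  have "0 \<le> b\<^sup>2 - a * c" using assms zero_le_power2[of b] by linarith
  then have "D\<^sup>2 = b\<^sup>2 - a * c" unfolding D_def by simp
  moreover have cr: "c * r = D - b" using c by (simp add: r_def)
  have "c * (a + 2 * r * b + r\<^sup>2 * c) = a * c + 2 * (c * r) * b + (c * r)\<^sup>2"
    by (simp add: algebra_simps power2_eq_square)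
  then have "c * (a + 2 * r * b + r\<^sup>2 * c) = a * c + 2 * (D - b) * b + (D - b)\<^sup>2"
    unfolding cr .
  ultimately have "c * (a + 2 * r * b + r\<^sup>2 * c) = 0"
    by (simp add: power2_eq_square algebra_simps)
  then have r: "a + 2 * r * b + r\<^sup>2 * c = 0" using c by simp
  define s where "s = 1 / sqrt (1 + r\<^sup>2)"
  have pos: "0 < 1 + r\<^sup>2" by (simp add: add_pos_nonneg)
  have s2: "s\<^sup>2 = 1 / (1 + r\<^sup>2)" using pos by (simp add: s_def power_divide)
  have "s\<^sup>2 + (s * r)\<^sup>2 = s\<^sup>2 * (1 + r\<^sup>2)" by (simp add: algebra_simps power_mult_distrib)
  also have "\<dots> = 1" using pos unfolding s2 by simp
  finally have 1: "s\<^sup>2 + (s * r)\<^sup>2 = 1" .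
  have "s\<^sup>2 * a + 2 * s * (s * r) * b + (s * r)\<^sup>2 * c = s\<^sup>2 * (a + 2 * r * b + r\<^sup>2 * c)"
    by (simp add: algebra_simps power2_eq_square)
  then show ?thesis using 1 r by (intro exI[of _ s] exI[of _ "s * r"]) simp
qed

text \<open>Rotating two vectors against each other preserves the sum of their rank one matrices. As
  the values of \<open>q\<close> sum to zero, a vector with nonzero value has a partner with a value
  of opposite sign, and a suitable rotation makes one of the two isotropic. The other one returns to
  the list, which is shorter by one and still has sum zero.\<close>

lemma isotropic_rank_one_decomposition:
  fixes xs :: "('a \<Rightarrow> real) list" and \<alpha> \<beta> :: real and a b :: 'a
  defines "q \<equiv> \<lambda>x::'a \<Rightarrow> real. \<alpha> * (x a)\<^sup>2 + \<beta> * (x b)\<^sup>2"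
  assumes "(\<Sum>x\<leftarrow>xs. q x) = 0"
  shows "\<exists>ys. (\<forall>y\<in>set ys. q y = 0) \<and> (\<forall>i j. (\<Sum>x\<leftarrow>xs. x i * x j) = (\<Sum>y\<leftarrow>ys. y i * y j))"
  using assms(2)
proof (induction "length xs" arbitrary: xs)
  case (Suc n)
  then obtain x zs where xs: "xs = x # zs" "length zs = n" by (cases xs) auto
  show ?case
  proof (cases "q x = 0")
    case True
    then have "(\<Sum>x\<leftarrow>zs. q x) = 0" using Suc xs by simp
    with Suc.hyps(1)[of zs] xs obtain ys where
      "\<forall>y\<in>set ys. q y = 0" "\<forall>i j. (\<Sum>x\<leftarrow>zs. x i * x j) = (\<Sum>y\<leftarrow>ys. y i * y j)" by auto
    then show ?thesis using True xs by (intro exI[of _ "x # ys"]) auto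
  next
    case False
    have "\<exists>y\<in>set zs. q x * q y < 0"
    proof (rule ccontr)
      assume "\<not> ?thesis"
      then have "0 \<le> (\<Sum>y\<leftarrow>zs. q x * q y)" by (intro sum_list_nonneg) (auto simp: not_less)
      also have "\<dots> = q x * (\<Sum>y\<leftarrow>zs. q y)" by (simp add: sum_list_const_mult)
      also have "(\<Sum>y\<leftarrow>zs. q y) = - q x" using Suc.prems xs by simp
      finally have "(q x)\<^sup>2 \<le> 0" by (simp add: power2_eq_square)
      then show False using False by simp
    qed
    then obtain y where y: "y \<in> set zs" "q x * q y < 0" by blast
    from quadratic_rotation_zero[OF y(2), of "\<alpha> * x a * y a + \<beta> * x b * y b"] obtain s t where
      st: "s\<^sup>2 + t\<^sup>2 = 1"
        "s\<^sup>2 * q x + 2 * s * t * (\<alpha> * x a * y a + \<beta> * x b * y b) + t\<^sup>2 * q y = 0" by blast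
    define x' where "x' = (\<lambda>i. s * x i + t * y i)"
    define y' where "y' = (\<lambda>i. s * y i - t * x i)"
    define ws where "ws = y' # remove1 y zs"
    have "q x' = s\<^sup>2 * q x + 2 * s * t * (\<alpha> * x a * y a + \<beta> * x b * y b) + t\<^sup>2 * q y"
      unfolding q_def x'_def by (simp add: power2_eq_square algebra_simps)
    then have qx': "q x' = 0" using st by simp
    have rot: "x' i * x' j + y' i * y' j = x i * x j + y i * y j" for i j
    proof -
      have "x' i * x' j + y' i * y' j = (s\<^sup>2 + t\<^sup>2) * (x i * x j + y i * y j)"
        unfolding x'_def y'_def by (simp add: power2_eq_square algebra_simps)
      then show ?thesis using st by simp
    qed
    have zs: "(\<Sum>z\<leftarrow>zs. f z) = f y + (\<Sum>z\<leftarrow>remove1 y zs. f z)" for f :: "('a \<Rightarrow> real) \<Rightarrow> real"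
      by (rule sum_list_map_remove1[OF y(1)])
    have outer: "(\<Sum>x\<leftarrow>xs. x i * x j) = x' i * x' j + (\<Sum>z\<leftarrow>ws. z i * z j)" for i j
      using rot[of i j] unfolding xs ws_def by (simp add: zs)
    have "q x' + q y' = q x + q y"
    proof -
      have "q x' + q y' = \<alpha> * (x' a * x' a + y' a * y' a) + \<beta> * (x' b * x' b + y' b * y' b)"
        unfolding q_def by (simp add: power2_eq_square algebra_simps)
      also have "\<dots> = q x + q y" unfolding rot q_def by (simp add: power2_eq_square algebra_simps)
      finally show ?thesis .
    qed
    then have "(\<Sum>z\<leftarrow>ws. q z) = 0"
      using Suc.prems qx' unfolding xs ws_def by (simp add: zs)
    moreover have "length ws = n"
      using xs y(1) unfolding ws_def by (simp add: length_remove1) (metis Suc_pred length_pos_if_in_set)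
    ultimately obtain ys where "\<forall>y\<in>set ys. q y = 0" "\<forall>i j. (\<Sum>x\<leftarrow>ws. x i * x j) = (\<Sum>y\<leftarrow>ys. y i * y j)"
      using Suc.hyps(1)[of ws] by auto
    then show ?thesis using qx' outer by (intro exI[of _ "x' # ys"]) auto
  qed
qed (auto intro: exI[of _ "[]"])

text \<open>The form with coefficients \<open>A b b\<close> and \<open>- A a a\<close> sums to zero
  over any Gram decomposition. Being isotropic for it means that the squares of the entries at
  \<open>a\<close> and \<open>b\<close> are in the ratio of \<open>A a a\<close> to
  \<open>A b b\<close>; the common factor is the weight \<open>l\<close>.\<close>

lemma psd_on_weighted_rank_one_decomposition:
  assumes "finite W" "psd_on W A" "a \<in> W" "b \<in> W"
  shows "\<exists>L :: (real \<times> ('a \<Rightarrow> real)) list.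
     (\<forall>(l, y)\<in>set L. 0 \<le> l \<and> (y a)\<^sup>2 = l * A a a \<and> (y b)\<^sup>2 = l * A b b) \<and>
     (\<Sum>(l, y)\<leftarrow>L. l) = 1 \<and> (\<forall>i\<in>W. \<forall>j\<in>W. A i j = (\<Sum>(l, y)\<leftarrow>L. y i * y j))"
proof -
  obtain xs where xs: "\<forall>i\<in>W. \<forall>j\<in>W. A i j = (\<Sum>x\<leftarrow>xs. x i * x j)"
    using psd_on_gram[OF assms(1,2)] by blast
  have nn: "0 \<le> A a a" "0 \<le> A b b" using assms psd_on_diag_nonneg[OF assms(2,1)] by auto
  have "(\<Sum>x\<leftarrow>xs. A b b * (x a)\<^sup>2 + - A a a * (x b)\<^sup>2) = A b b * A a a - A a a * A b b"
    using xs assms by (simp add: sum_list_addf sum_list_subtractf sum_list_const_mult power2_eq_square)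
  then obtain ys where ys: "\<forall>y\<in>set ys. A b b * (y a)\<^sup>2 + - A a a * (y b)\<^sup>2 = 0"
    "\<forall>i j. (\<Sum>x\<leftarrow>xs. x i * x j) = (\<Sum>y\<leftarrow>ys. y i * y j)"
    using isotropic_rank_one_decomposition[of "A b b" a "- A a a" b xs] by auto
  have A: "A i j = (\<Sum>y\<leftarrow>ys. y i * y j)" if "i \<in> W" "j \<in> W" for i j using xs ys that by auto
  define \<tau> where "\<tau> = A a a + A b b"
  show ?thesis
  proof (cases "\<tau> = 0")
    case True
    then have 0: "A a a = 0" "A b b = 0" using nn unfolding \<tau>_def by linarith+
    have z: "y c = 0" if "y \<in> set ys" "(\<Sum>y\<leftarrow>ys. y c * y c) = 0" for y c
    proof -
      have "\<forall>r\<in>set (map (\<lambda>y. y c * y c) ys). r = 0"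
        using that(2) by (subst sum_list_nonneg_eq_0_iff[symmetric]) auto
      then show ?thesis using that(1) by auto
    qed
    \<comment> \<open>All vectors vanish at \<open>a\<close> and \<open>b\<close> and get weight 0;
      an additional zero vector carries the total weight 1.\<close>
    show ?thesis
      using 0 z A assms by (intro exI[of _ "(1, \<lambda>_. 0) # map (Pair 0) ys"]) (auto simp: o_def)
  next
    case False
    define l where "l = (\<lambda>y::'a \<Rightarrow> real. ((y a)\<^sup>2 + (y b)\<^sup>2) / \<tau>)"
    have pos: "0 < \<tau>" using False nn unfolding \<tau>_def by linarith
    have "(\<Sum>y\<leftarrow>ys. l y) = (\<Sum>y\<leftarrow>ys. (1 / \<tau>) * ((y a)\<^sup>2 + (y b)\<^sup>2))"
      unfolding l_def by simp
    also have "\<dots> = ((\<Sum>y\<leftarrow>ys. (y a)\<^sup>2) + (\<Sum>y\<leftarrow>ys. (y b)\<^sup>2)) / \<tau>"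
      unfolding sum_list_const_mult sum_list_addf by simp
    also have "\<dots> = 1" using A[of a a] A[of b b] assms pos by (simp add: \<tau>_def power2_eq_square)
    finally have 1: "(\<Sum>y\<leftarrow>ys. l y) = 1" .
    have "(y a)\<^sup>2 = l y * A a a \<and> (y b)\<^sup>2 = l y * A b b" if "y \<in> set ys" for y
    proof -
      have "A b b * (y a)\<^sup>2 = A a a * (y b)\<^sup>2" using ys that by auto
      then have "(y a)\<^sup>2 * \<tau> = ((y a)\<^sup>2 + (y b)\<^sup>2) * A a a" "(y b)\<^sup>2 * \<tau> = ((y a)\<^sup>2 + (y b)\<^sup>2) * A b b"
        unfolding \<tau>_def by (simp_all add: algebra_simps)
      then show ?thesis using pos by (simp add: l_def field_simps)
    qed
    then show ?thesis
      using 1 A pos by (intro exI[of _ "map (\<lambda>y. (l y, y)) ys"]) (auto simp: o_def l_def)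
  qed
qed


section \<open>Completion on chordal graphs\<close>

text \<open>A walk of minimal length among those with interior in \<open>A\<close> works: a repeated
  vertex or a forward chord would allow a shortcut, whose interior is again in
  \<open>A\<close>.\<close>

lemma chordless_walk:
  assumes "f 0 = x" "f n = y" "\<forall>i<n. (f i, f (Suc i)) \<in> R" "\<forall>i. 0 < i \<and> i < n \<longrightarrow> f i \<in> A"
  shows "\<exists>g m. m \<le> n \<and> g 0 = x \<and> g m = y \<and> (\<forall>i<m. (g i, g (Suc i)) \<in> R) \<and>
    (\<forall>i. 0 < i \<and> i < m \<longrightarrow> g i \<in> A) \<and> inj_on g {..m} \<and>
    (\<forall>i j. i < j \<and> j \<le> m \<and> (g i, g j) \<in> R \<longrightarrow> j = Suc i)"
proof -
  define P where "P m g \<longleftrightarrow> g 0 = x \<and> g m = y \<and> (\<forall>i<m. (g i, g (Suc i)) \<in> R) \<and>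
    (\<forall>i. 0 < i \<and> i < m \<longrightarrow> g i \<in> A)" for m g
  define m where "m = (LEAST m. \<exists>g. P m g)"
  have ex: "\<exists>g. P n g" using assms unfolding P_def by auto
  then have "\<exists>g. P m g" unfolding m_def by (rule LeastI)
  then obtain g where g: "P m g" by blast
  have min: "m \<le> k" if "P k h" for k h unfolding m_def using that by (intro Least_le) auto
  have no: False if ij: "i < j" "j \<le> m" and c: "g i = g j \<or> ((g i, g j) \<in> R \<and> j \<noteq> Suc i)" for i j
  proof (cases "g i = g j")
    case True
    define h where "h = (\<lambda>k. if k \<le> i then g k else g (k + (j - i)))"
    have "P (m - (j - i)) h"
      unfolding P_def
    proof (intro conjI allI impI)
      show "h 0 = x" using g unfolding P_def h_def by simp
      show "h (m - (j - i)) = y"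
        using g ij True unfolding P_def h_def by (cases "j = m") auto
      show "(h k, h (Suc k)) \<in> R" if "k < m - (j - i)" for k
      proof -
        consider "Suc k \<le> i" | "k = i" | "k > i" by linarith
        then show ?thesis
        proof cases
          case 2
          then have "h k = g j" "h (Suc k) = g (Suc j)" using True ij by (auto simp: h_def)
          then show ?thesis using g that 2 ij unfolding P_def by auto
        qed (use g that ij in \<open>auto simp: P_def h_def\<close>)
      qed
      show "h k \<in> A" if "0 < k \<and> k < m - (j - i)" for k
        using g ij that unfolding P_def h_def by auto
    qed
    from min[OF this] ij show False by linarith
  next
    case False
    then have c: "(g i, g j) \<in> R" "Suc i < j" using c ij by auto
    \<comment> \<open>Here \<open>g i\<close> stays and is followed by \<open>g j\<close>, so one
      vertex fewer is cut out than for a repetition.\<close>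
    define d where "d = j - Suc i"
    define h where "h = (\<lambda>k. if k \<le> i then g k else g (k + d))"
    have d: "Suc i + d = j" "0 < d" using c ij unfolding d_def by auto
    have "P (m - d) h"
      unfolding P_def
    proof (intro conjI allI impI)
      show "h 0 = x" using g unfolding P_def h_def by simp
      show "h (m - d) = y"
        using g ij d unfolding P_def h_def by auto
      show "(h k, h (Suc k)) \<in> R" if "k < m - d" for k
      proof -
        consider "Suc k \<le> i" | "k = i" | "k > i" by linarith
        then show ?thesis
        proof cases
          case 2
          then have "h k = g i" "h (Suc k) = g j" using d by (auto simp: h_def)
          then show ?thesis using c by simp
        qed (use g that ij in \<open>auto simp: P_def h_def\<close>)
      qed
      show "h k \<in> A" if "0 < k \<and> k < m - d" for k
        using g ij that unfolding P_def h_def by auto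
    qed
    from min[OF this] d ij show False by linarith
  qed
  have "inj_on g {..m}"
  proof (rule inj_onI)
    fix i j assume "i \<in> {..m}" "j \<in> {..m}" "g i = g j"
    then show "i = j" using no[of i j] no[of j i] by (cases i j rule: linorder_cases) auto
  qed
  moreover have "m \<le> n" using ex min by blast
  ultimately show ?thesis
    using g no unfolding P_def by (intro exI[of _ g] exI[of _ m]) blast
qed

lemma pair_graph_symD: "pair_graph G \<Longrightarrow> (u, v) \<in> parcs G \<Longrightarrow> (v, u) \<in> parcs G"
proof -
  assume G: "pair_graph G" "(u, v) \<in> parcs G"
  interpret pair_graph G by (rule G(1))
  show ?thesis using pair_sym_arcs G(2) unfolding symmetric_def by (auto dest: symD)
qed

lemma pair_graph_vertsD: "pair_graph G \<Longrightarrow> (u, v) \<in> parcs G \<Longrightarrow> u \<in> pverts G \<and> v \<in> pverts G \<and> u \<noteq> v"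
proof -
  assume G: "pair_graph G" "(u, v) \<in> parcs G"
  interpret pair_graph G by (rule G(1))
  show ?thesis using arc_fst_in_verts[OF G(2)] arc_snd_in_verts[OF G(2)] pair_no_loops[OF G(2)] by simp
qed

lemma pair_graph_finite: "pair_graph G \<Longrightarrow> finite (pverts G)"
proof -
  assume G: "pair_graph G"
  interpret pair_graph G by (rule G)
  show ?thesis by (rule pair_finite_verts)
qed

text \<open>If \<open>x\<close> and \<open>y\<close> were not adjacent, a chordless walk between
  them through \<open>A\<close> would have length at least 2. Together with \<open>v\<close>, which
  has no neighbour in \<open>A\<close>, it would close up to an induced cycle with at least four
  vertices.\<close>

lemma chordal_common_neighbours_adjacent:
  assumes G: "pair_graph G" "chordal G"
    and A: "A \<subseteq> pverts G" "\<And>a b. a \<in> A \<Longrightarrow> b \<in> A \<Longrightarrow> (a, b) \<in> (parcs G \<inter> A \<times> A)\<^sup>*"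
      "\<And>a. a \<in> A \<Longrightarrow> (v, a) \<notin> parcs G" "v \<notin> A"
    and x: "(v, x) \<in> parcs G" "(x, a) \<in> parcs G" "a \<in> A" "x \<notin> A"
    and y: "(v, y) \<in> parcs G" "(b, y) \<in> parcs G" "b \<in> A" "y \<notin> A"
    and "x \<noteq> y"
  shows "(x, y) \<in> parcs G"
proof (rule ccontr)
  assume nadj: "(x, y) \<notin> parcs G"
  note sym = pair_graph_symD[OF G(1)] and verts = pair_graph_vertsD[OF G(1)]
  obtain n f where f: "f 0 = a" "f n = b" "\<forall>i<n. (f i, f (Suc i)) \<in> parcs G \<inter> A \<times> A"
    using A(2)[OF x(3) y(3)] by (auto dest!: rtrancl_imp_relpow simp: relpow_fun_conv)
  have fA: "f i \<in> A" if "i \<le> n" for i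
    using that f x(3) by (cases i) auto
  define h where "h = (\<lambda>i. if i = 0 then x else if i \<le> Suc n then f (i - 1) else y)"
  have "\<exists>g m. m \<le> Suc (Suc n) \<and> g 0 = x \<and> g m = y \<and> (\<forall>i<m. (g i, g (Suc i)) \<in> parcs G) \<and>
    (\<forall>i. 0 < i \<and> i < m \<longrightarrow> g i \<in> A) \<and> inj_on g {..m} \<and>
    (\<forall>i j. i < j \<and> j \<le> m \<and> (g i, g j) \<in> parcs G \<longrightarrow> j = Suc i)"
  proof (rule chordless_walk)
    show "h 0 = x" "h (Suc (Suc n)) = y" by (auto simp: h_def)
    show "\<forall>i<Suc (Suc n). (h i, h (Suc i)) \<in> parcs G"
    proof (intro allI impI)
      fix i assume "i < Suc (Suc n)"
      then consider "i = 0" | k where "i = Suc k" "k < n" | "i = Suc n" by (cases i) force+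
      then show "(h i, h (Suc i)) \<in> parcs G" using f x y by cases (auto simp: h_def)
    qed
    show "\<forall>i. 0 < i \<and> i < Suc (Suc n) \<longrightarrow> h i \<in> A" using fA by (auto simp: h_def)
  qed
  then obtain g m where g: "g 0 = x" "g m = y" "\<forall>i<m. (g i, g (Suc i)) \<in> parcs G"
    "\<forall>i. 0 < i \<and> i < m \<longrightarrow> g i \<in> A" "inj_on g {..m}"
    "\<forall>i j. i < j \<and> j \<le> m \<and> (g i, g j) \<in> parcs G \<longrightarrow> j = Suc i" by blast
  have m2: "2 \<le> m"
  proof -
    have "m \<noteq> 0" using g \<open>x \<noteq> y\<close> by metis
    moreover have "m \<noteq> 1" using g nadj by auto
    ultimately show ?thesis by linarith
  qed
  have mA: "g k \<in> A" if "k \<le> m" "k \<noteq> 0" "k \<noteq> m" for k using g(4) that by auto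
  have vg: "(v, g k) \<in> parcs G \<longleftrightarrow> k = 0 \<or> k = m" if "k \<le> m" for k
    using that g(1,2) x(1) y(1) A(3) mA[OF that] by auto
  have gg: "(g k, g l) \<in> parcs G \<longleftrightarrow> l = Suc k \<or> k = Suc l" if "k \<le> m" "l \<le> m" for k l
  proof (cases k l rule: linorder_cases)
    case less
    then show ?thesis using g(3,6) that by auto
  next
    case equal
    then show ?thesis using verts by auto
  next
    case greater
    then show ?thesis using g(3,6) that sym by (metis less_irrefl_nat less_le_trans lessI less_asym)
  qed
  define cs where "cs = v # map g [0..<Suc m]"
  have len: "length cs = Suc (Suc m)" by (simp add: cs_def)
  have cs0: "cs ! 0 = v" by (simp add: cs_def)
  have csS: "cs ! Suc k = g k" if "k \<le> m" for k
    using that by (auto simp: cs_def simp del: upt_Suc)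
  have "induced_cycle G cs"
    unfolding induced_cycle_def
  proof (intro conjI allI impI)
    show "3 \<le> length cs" using m2 len by simp
    have "v \<noteq> g k" if "k \<le> m" for k
      using mA[OF that] A(4) g(1,2) verts[OF x(1)] verts[OF y(1)] by metis
    then have "v \<notin> g ` {0..<Suc m}" by (metis atLeastLessThan_iff imageE less_Suc_eq_le)
    moreover have "inj_on g {0..<Suc m}" using g(5) by (rule inj_on_subset) auto
    ultimately show "distinct cs" by (simp add: cs_def distinct_map del: upt_Suc)
    have "g k \<in> pverts G" if "k \<le> m" for k
      using mA[OF that] A(1) g(1,2) verts[OF x(1)] verts[OF y(1)] by (metis subsetD)
    then show "set cs \<subseteq> pverts G" using verts[OF x(1)] by (auto simp: cs_def simp del: upt_Suc)
    fix i j assume ij: "i < length cs" "j < length cs"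
    show "(cs ! i, cs ! j) \<in> parcs G \<longleftrightarrow> j = Suc i mod length cs \<or> i = Suc j mod length cs"
    proof (cases i)
      case 0
      show ?thesis
      proof (cases j)
        case 0
        then show ?thesis using \<open>i = 0\<close> verts cs0 m2 unfolding len by auto
      next
        case (Suc l)
        then have l: "l \<le> m" using ij len by auto
        show ?thesis using \<open>i = 0\<close> Suc l cs0 csS[OF l] vg[OF l] unfolding len by (auto simp: mod_Suc)
      qed
    next
      case (Suc k)
      then have k: "k \<le> m" using ij len by auto
      show ?thesis
      proof (cases j)
        case 0
        have "(g k, v) \<in> parcs G \<longleftrightarrow> (v, g k) \<in> parcs G" using sym by blast
        then show ?thesis using 0 Suc k cs0 csS[OF k] vg[OF k] unfolding len by (auto simp: mod_Suc)
      next
        case (Suc l)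
        then have l: "l \<le> m" using ij len by auto
        have "(cs ! i, cs ! j) \<in> parcs G \<longleftrightarrow> l = Suc k \<or> k = Suc l"
          using \<open>i = Suc k\<close> Suc csS[OF k] csS[OF l] gg[OF k l] by simp
        then show ?thesis using \<open>i = Suc k\<close> Suc k l unfolding len by (auto simp: mod_Suc)
      qed
    qed
  qed
  then show False using G(2) m2 len unfolding chordal_def by auto
qed

text \<open>The completion theorem for chordal graphs, by clique separators. For nonadjacent
  \<open>u\<close> and \<open>v\<close> let \<open>A\<close> be the component of \<open>u\<close>
  among the non-neighbours of \<open>v\<close>. Its boundary \<open>S\<close> consists of neighbours
  of both \<open>v\<close> and \<open>A\<close>, hence is a clique, on which all entries are
  specified. There are no edges between \<open>A\<close> and the vertices outside
  \<open>A \<union> S\<close>, so completions of the two sides amalgamate along \<open>S\<close>.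
  The induction runs over vertex sets of a fixed \<open>G\<close>, so that chordality and cliques
  always refer to \<open>G\<close> itself.\<close>

lemma chordal_psd_completion_subset:
  assumes G: "pair_graph G" "chordal G"
    and "W \<subseteq> pverts G" "\<And>K. is_clique G K \<Longrightarrow> K \<subseteq> W \<Longrightarrow> psd_on K X"
  shows "\<exists>A. psd_on W A \<and> (\<forall>i\<in>W. \<forall>j\<in>W. (i, j) \<in> specified G \<longrightarrow> A i j = X i j)"
  using assms(3,4)
proof (induction "card W" arbitrary: W rule: less_induct)
  case less
  note sym = pair_graph_symD[OF G(1)] and verts = pair_graph_vertsD[OF G(1)]
  have fin: "finite W" using less.prems(1) pair_graph_finite[OF G(1)] finite_subset by blast
  show ?case
  proof (cases "\<forall>u\<in>W. \<forall>v\<in>W. u \<noteq> v \<longrightarrow> (u, v) \<in> parcs G")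
    case True
    then have "psd_on W X"
      using less.prems unfolding is_clique_def by (cases "W = {}") (auto simp: psd_on_def)
    then show ?thesis by blast
  next
    case False
    then obtain v u where vu: "v \<in> W" "u \<in> W" "u \<noteq> v" "(v, u) \<notin> parcs G" by blast
    define R where "R = {w \<in> W. w \<noteq> v \<and> (v, w) \<notin> parcs G}"
    define A where "A = (parcs G \<inter> R \<times> R)\<^sup>* `` {u}"
    define S where "S = {s \<in> W - A. \<exists>b\<in>A. (b, s) \<in> parcs G}"
    have uR: "u \<in> R" and uA: "u \<in> A" using vu by (auto simp: R_def A_def)
    have AR: "A \<subseteq> R"
    proof
      fix b assume "b \<in> A"
      then have "(u, b) \<in> (parcs G \<inter> R \<times> R)\<^sup>*" by (simp add: A_def)
      then show "b \<in> R" using uR by (induction rule: rtrancl_induct) auto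
    qed
    have AA: "(u, b) \<in> (parcs G \<inter> A \<times> A)\<^sup>*" if "b \<in> A" for b
    proof -
      have "(u, b) \<in> (parcs G \<inter> R \<times> R)\<^sup>*" using that by (simp add: A_def)
      then show ?thesis
      proof (induction rule: rtrancl_induct)
        case (step y z)
        have "y \<in> A" using step(1) by (simp add: A_def)
        moreover have "z \<in> A" using step(1,2) unfolding A_def by (auto intro: rtrancl_into_rtrancl)
        ultimately show ?case using step by (auto intro: rtrancl_into_rtrancl)
      qed simp
    qed
    have symA: "sym ((parcs G \<inter> A \<times> A)\<^sup>*)" by (intro sym_rtrancl) (auto simp: sym_def sym)
    have conn: "(a, b) \<in> (parcs G \<inter> A \<times> A)\<^sup>*" if "a \<in> A" "b \<in> A" for a b
      using AA[OF that(1)] AA[OF that(2)] symA by (meson rtrancl_trans symD)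
    have S: "(v, s) \<in> parcs G" "s \<noteq> v" if s: "s \<in> S" for s
    proof -
      obtain b where b: "b \<in> A" "(b, s) \<in> parcs G" "s \<in> W" "s \<notin> A" using s by (auto simp: S_def)
      have "s \<notin> R"
      proof
        assume "s \<in> R"
        then have "(b, s) \<in> parcs G \<inter> R \<times> R" using b AR by auto
        then have "s \<in> A" using b(1) unfolding A_def by (auto intro: rtrancl_into_rtrancl)
        then show False using b by simp
      qed
      moreover show "s \<noteq> v" using b AR sym by (auto simp: R_def)
      ultimately show "(v, s) \<in> parcs G" using b by (auto simp: R_def)
    qed
    have clS: "(x, y) \<in> parcs G" if xy: "x \<in> S" "y \<in> S" "x \<noteq> y" for x y
    proof -
      obtain a where a: "a \<in> A" "(x, a) \<in> parcs G" using xy(1) sym by (auto simp: S_def)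
      obtain b where b: "b \<in> A" "(b, y) \<in> parcs G" using xy(2) by (auto simp: S_def)
      show ?thesis
      proof (rule chordal_common_neighbours_adjacent[OF G _ conn _ _ _ a(2,1) _ _ b(2,1)])
        show "A \<subseteq> pverts G" using AR less.prems(1) by (auto simp: R_def)
        show "(v, a) \<notin> parcs G" if "a \<in> A" for a using that AR by (auto simp: R_def)
        show "v \<notin> A" using AR by (auto simp: R_def)
      qed (use xy S in \<open>auto simp: S_def\<close>)
    qed
    have AW: "A \<subseteq> W" "v \<notin> A" using AR by (auto simp: R_def)
    define W1 where "W1 = A \<union> S"
    define W2 where "W2 = W - A"
    have sub: "W1 \<subseteq> W - {v}" "W2 \<subseteq> W - {u}" using AW uA S by (auto simp: W1_def W2_def S_def)
    have "card W1 < card W" "card W2 < card W"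
      using sub vu fin by (auto intro!: psubset_card_mono)
    moreover have ih: "\<exists>A. psd_on U A \<and> (\<forall>i\<in>U. \<forall>j\<in>U. (i, j) \<in> specified G \<longrightarrow> A i j = X i j)"
      if "card U < card W" "U \<subseteq> W" for U
      by (rule less.hyps[OF that(1)]) (use that(2) less.prems in auto)
    ultimately obtain A1 A2 where A1: "psd_on W1 A1" "\<forall>i\<in>W1. \<forall>j\<in>W1. (i, j) \<in> specified G \<longrightarrow> A1 i j = X i j"
      and A2: "psd_on W2 A2" "\<forall>i\<in>W2. \<forall>j\<in>W2. (i, j) \<in> specified G \<longrightarrow> A2 i j = X i j"
      using ih[of W1] ih[of W2] sub by blast
    have un: "W1 \<union> W2 = W" using AW by (auto simp: W1_def W2_def S_def)
    have int: "W1 \<inter> W2 = S" by (auto simp: W1_def W2_def S_def)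
    have spS: "(i, j) \<in> specified G" if "i \<in> S" "j \<in> S" for i j
      using clS[OF that] that less.prems(1) by (cases "i = j") (auto simp: specified_def S_def)
    have "\<exists>M. psd_on (W1 \<union> W2) M \<and> (\<forall>i\<in>W1. \<forall>j\<in>W1. M i j = A1 i j) \<and> (\<forall>i\<in>W2. \<forall>j\<in>W2. M i j = A2 i j)"
    proof (rule psd_on_amalgamate[OF A1(1) A2(1)])
      show "finite W1" "finite W2" using un fin by auto
      show "A1 i j = A2 i j" if "i \<in> W1 \<inter> W2" "j \<in> W1 \<inter> W2" for i j
        using A1(2) A2(2) spS that int by auto
    qed
    then obtain M where M: "psd_on W M" "\<forall>i\<in>W1. \<forall>j\<in>W1. M i j = A1 i j" "\<forall>i\<in>W2. \<forall>j\<in>W2. M i j = A2 i j"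
      unfolding un by blast
    have "M i j = X i j" if ij: "i \<in> W" "j \<in> W" "(i, j) \<in> specified G" for i j
    proof -
      have "(i \<in> W1 \<and> j \<in> W1) \<or> (i \<in> W2 \<and> j \<in> W2)"
        using ij sym by (auto simp: W1_def W2_def S_def specified_def)
      then show ?thesis using M A1 A2 ij(3) by auto
    qed
    then show ?thesis using M(1) by blast
  qed
qed

lemma chordal_psd_completion:
  assumes "pair_graph G" "chordal G" "\<And>K. is_clique G K \<Longrightarrow> psd_on K X"
  shows "\<exists>A. psd_on (pverts G) A \<and> (\<forall>(i, j)\<in>specified G. A i j = X i j)"
proof -
  have "specified G \<subseteq> pverts G \<times> pverts G"
    using pair_graph_vertsD[OF assms(1)] by (auto simp: specified_def)
  then show ?thesis
    using chordal_psd_completion_subset[OF assms(1,2) subset_refl, of X] assms(3) by fast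
qed


section \<open>The additive distance\<close>

lemma continuous_on_entry [continuous_intros]:
  fixes i j :: 'a
  shows "continuous_on S (\<lambda>X::'a \<Rightarrow> 'a \<Rightarrow> real. X i j)"
  by (rule continuous_on_subset[OF _ subset_UNIV],
      rule continuous_on_product_then_coordinatewise[OF continuous_on_product_coordinates])

text \<open>The function type carries the product topology, so this is Tychonoff's theorem, applied
  to the rows and then to the matrix. The index type may be infinite, which is why bounds are needed
  at all indices and not only at the vertices.\<close>

lemma compact_entrywise_box:
  fixes B :: "'a \<Rightarrow> 'a \<Rightarrow> real"
  shows "compact {X. \<forall>i j. \<bar>X i j\<bar> \<le> B i j}"
proof -
  have row: "compact (\<Pi>\<^sub>E j\<in>UNIV. {- B i j..B i j})" for i
  proof -
    have "compactin (product_topology (\<lambda>_. euclidean) UNIV) (\<Pi>\<^sub>E j\<in>UNIV. {- B i j..B i j})"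
      unfolding compactin_PiE by simp
    then show ?thesis by (simp add: euclidean_product_topology)
  qed
  have "compactin (product_topology (\<lambda>_. euclidean) UNIV) (\<Pi>\<^sub>E i\<in>UNIV. \<Pi>\<^sub>E j\<in>UNIV. {- B i j..B i j})"
    unfolding compactin_PiE using row by simp
  then have "compact (\<Pi>\<^sub>E i\<in>UNIV. \<Pi>\<^sub>E j\<in>UNIV. {- B i j..B i j})"
    by (simp add: euclidean_product_topology)
  moreover have "(\<Pi>\<^sub>E i\<in>UNIV. \<Pi>\<^sub>E j\<in>UNIV. {- B i j..B i j}) = {X. \<forall>i j. \<bar>X i j\<bar> \<le> B i j}"
    by (auto simp: PiE_UNIV_domain Pi_iff abs_le_iff) (metis minus_le_iff)+
  ultimately show ?thesis by simp
qed

lemma compact_of_entrywise_bounded: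
  fixes S :: "('a \<Rightarrow> 'a \<Rightarrow> real) set"
  assumes "closed S" "\<And>X i j. X \<in> S \<Longrightarrow> \<bar>X i j\<bar> \<le> B i j"
  shows "compact S"
proof -
  have "S = {X. \<forall>i j. \<bar>X i j\<bar> \<le> B i j} \<inter> S" using assms(2) by auto
  then show ?thesis using compact_Int_closed[OF compact_entrywise_box assms(1), of B] by simp
qed

lemma closed_psd_on: "closed {A. psd_on V A}"
proof -
  have "{A. psd_on V A} = (\<Inter>i\<in>V. \<Inter>j\<in>V. {A. A i j = A j i}) \<inter>
      (\<Inter>x. {A. 0 \<le> (\<Sum>i\<in>V. \<Sum>j\<in>V. x i * A i j * x j)})"
    unfolding psd_on_def by auto
  also have "closed \<dots>"
    by (intro closed_Int closed_INT ballI closed_Collect_eq closed_Collect_le continuous_intros)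
  finally show ?thesis .
qed

lemma abs_qform_le:
  assumes "finite V"
  shows "\<bar>qform V A x\<bar> \<le> (\<Sum>i\<in>V. \<Sum>j\<in>V. \<bar>A i j\<bar>) * (\<Sum>k\<in>V. (x k)\<^sup>2)"
proof -
  have "\<bar>x i * A i j * x j\<bar> \<le> \<bar>A i j\<bar> * (\<Sum>k\<in>V. (x k)\<^sup>2)" if "i \<in> V" "j \<in> V" for i j
  proof -
    have le: "(x k)\<^sup>2 \<le> (\<Sum>k\<in>V. (x k)\<^sup>2)" if "k \<in> V" for k
      using assms that by (intro member_le_sum) auto
    have "\<bar>x i * x j\<bar> \<le> (\<Sum>k\<in>V. (x k)\<^sup>2)"
    proof (cases "\<bar>x i\<bar> \<le> \<bar>x j\<bar>")
      case True
      then have "\<bar>x i\<bar> * \<bar>x j\<bar> \<le> \<bar>x j\<bar> * \<bar>x j\<bar>" by (intro mult_right_mono) auto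
      then show ?thesis using le[OF \<open>j \<in> V\<close>] by (simp add: abs_mult power2_eq_square)
    next
      case False
      then have "\<bar>x i\<bar> * \<bar>x j\<bar> \<le> \<bar>x i\<bar> * \<bar>x i\<bar>" by (intro mult_left_mono) auto
      then show ?thesis using le[OF \<open>i \<in> V\<close>] by (simp add: abs_mult power2_eq_square)
    qed
    from mult_left_mono[OF this, of "\<bar>A i j\<bar>"] show ?thesis by (simp add: abs_mult mult_ac)
  qed
  then have "(\<Sum>i\<in>V. \<Sum>j\<in>V. \<bar>x i * A i j * x j\<bar>) \<le> (\<Sum>i\<in>V. \<Sum>j\<in>V. \<bar>A i j\<bar> * (\<Sum>k\<in>V. (x k)\<^sup>2))"
    by (intro sum_mono)
  moreover have "\<bar>qform V A x\<bar> \<le> (\<Sum>i\<in>V. \<Sum>j\<in>V. \<bar>x i * A i j * x j\<bar>)"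
    unfolding qform_def by (rule order_trans[OF sum_abs]) (intro sum_mono sum_abs)
  ultimately show ?thesis by (simp add: sum_distrib_right)
qed

text \<open>The sum of the absolute entries bounds the form relative to the squared norm. This crude
  constant provides one admissible shift for every partial matrix, and the Lipschitz bound for
  \<open>eps_at\<close>.\<close>

lemma psd_on_shift:
  assumes "finite V" "\<And>i j. i \<in> V \<Longrightarrow> j \<in> V \<Longrightarrow> A i j = A j i" "(\<Sum>i\<in>V. \<Sum>j\<in>V. \<bar>A i j\<bar>) \<le> s"
  shows "psd_on V (\<lambda>i j. A i j + (if i = j then s else 0))"
proof (rule psd_onI)
  show "A i j + (if i = j then s else 0) = A j i + (if j = i then s else 0)" if "i \<in> V" "j \<in> V" for i j
    using assms(2)[OF that] by auto
  fix x
  have "(\<Sum>i\<in>V. \<Sum>j\<in>V. \<bar>A i j\<bar>) * (\<Sum>k\<in>V. (x k)\<^sup>2) \<le> s * (\<Sum>k\<in>V. (x k)\<^sup>2)"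
    using assms(3) by (intro mult_right_mono sum_nonneg) auto
  then have "- qform V A x \<le> s * (\<Sum>k\<in>V. (x k)\<^sup>2)"
    using abs_qform_le[OF assms(1), of A x] by linarith
  then show "0 \<le> qform V (\<lambda>i j. A i j + (if i = j then s else 0)) x"
    unfolding qform_add qform_diagonal[OF assms(1)] by (simp add: sum_distrib_left)
qed

section \<open>Shifts by multiples of the identity and their minimum\<close>

definition shifted :: "'a pair_pre_digraph \<Rightarrow> ('a \<Rightarrow> 'a \<Rightarrow> real) \<Rightarrow> real \<Rightarrow> 'a \<Rightarrow> 'a \<Rightarrow> real" where
  "shifted G X \<epsilon> = (\<lambda>i j. X i j + \<epsilon> * pm_identity G i j)"

lemma shifted_apply: "shifted G X \<epsilon> i j = X i j + (if i = j \<and> i \<in> pverts G then \<epsilon> else 0)"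
  by (auto simp: shifted_def pm_identity_def)

lemma diag_specified [simp]: "(i, i) \<in> specified G \<longleftrightarrow> i \<in> pverts G \<or> (i, i) \<in> parcs G"
  by (auto simp: specified_def)

lemma partial_matrices_add:
  "X \<in> partial_matrices G \<Longrightarrow> Y \<in> partial_matrices G \<Longrightarrow> (\<lambda>i j. X i j + Y i j) \<in> partial_matrices G"
  unfolding partial_matrices_def by fastforce

lemma shifted_partial_matrices: "X \<in> partial_matrices G \<Longrightarrow> shifted G X \<epsilon> \<in> partial_matrices G"
  unfolding partial_matrices_def shifted_apply
  by (auto simp: specified_def split: if_splits)

lemma psd_completable_iff:
  "X \<in> psd_completable G \<longleftrightarrow> X \<in> partial_matrices G \<and>
     (\<exists>A. psd_on (pverts G) A \<and> (\<forall>(i, j)\<in>specified G. A i j = X i j))"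
  by (simp add: psd_completable_def)

lemma psd_completableE:
  assumes "X \<in> psd_completable G"
  obtains A where "psd_on (pverts G) A" "\<And>i j. (i, j) \<in> specified G \<Longrightarrow> A i j = X i j"
  using assms unfolding psd_completable_iff by blast

lemma psd_completableI:
  assumes "X \<in> partial_matrices G" "psd_on (pverts G) A" "\<And>i j. (i, j) \<in> specified G \<Longrightarrow> A i j = X i j"
  shows "X \<in> psd_completable G"
  using assms unfolding psd_completable_iff by blast

lemma psd_completable_add:
  assumes "X \<in> psd_completable G" "Y \<in> psd_completable G"
  shows "(\<lambda>i j. X i j + Y i j) \<in> psd_completable G"
proof -
  obtain A B where A: "psd_on (pverts G) A" "\<And>i j. (i, j) \<in> specified G \<Longrightarrow> A i j = X i j"
    and B: "psd_on (pverts G) B" "\<And>i j. (i, j) \<in> specified G \<Longrightarrow> B i j = Y i j"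
    using psd_completableE[OF assms(1)] psd_completableE[OF assms(2)] by metis
  show ?thesis
  proof (rule psd_completableI)
    show "psd_on (pverts G) (\<lambda>i j. A i j + B i j)" using A B by (intro psd_on_add)
  qed (use assms A B in \<open>auto intro: partial_matrices_add simp: psd_completable_def\<close>)
qed

lemma partial_matrices_sym:
  assumes "pair_graph G" "X \<in> partial_matrices G"
  shows "X i j = X j i"
proof (cases "(i, j) \<in> specified G")
  case True
  then show ?thesis using assms(2) unfolding partial_matrices_def by blast
next
  case False
  then have "(j, i) \<notin> specified G" using pair_graph_symD[OF assms(1)] by (auto simp: specified_def)
  then show ?thesis using False assms(2) unfolding partial_matrices_def by auto
qed

lemma shifted_specified:
  assumes "pair_graph G" "(i, j) \<in> specified G"
  shows "shifted G X \<epsilon> i j = X i j + (if i = j then \<epsilon> else 0)"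
  using assms pair_graph_vertsD[OF assms(1)] by (auto simp: shifted_apply specified_def)

lemma shifted_mono:
  assumes G: "pair_graph G" and "shifted G X \<epsilon> \<in> psd_completable G" "\<epsilon> \<le> \<delta>"
  shows "shifted G X \<delta> \<in> psd_completable G"
proof -
  have fin: "finite (pverts G)" using pair_graph_finite[OF G] .
  obtain A where A: "psd_on (pverts G) A" "\<forall>(i, j)\<in>specified G. A i j = shifted G X \<epsilon> i j"
    and X: "shifted G X \<epsilon> \<in> partial_matrices G"
    using assms(2) unfolding psd_completable_iff by blast
  have "shifted G X \<delta> = shifted G (shifted G X \<epsilon>) (\<delta> - \<epsilon>)"
    by (auto simp: shifted_apply fun_eq_iff)
  then have "shifted G X \<delta> \<in> partial_matrices G" using shifted_partial_matrices[OF X] by simp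
  moreover have "psd_on (pverts G) (\<lambda>i j. A i j + (if i = j then \<delta> - \<epsilon> else 0))"
    using assms fin by (intro psd_on_add[OF A(1)] psd_on_diagonal) auto
  moreover have "\<forall>(i, j)\<in>specified G. A i j + (if i = j then \<delta> - \<epsilon> else 0) = shifted G X \<delta> i j"
    using A(2) shifted_specified[OF G] by fastforce
  ultimately show ?thesis unfolding psd_completable_iff by blast
qed

text \<open>\<open>LEAST\<close> over the reals is meaningful only for an attained minimum. The set
  \<open>K\<close> consists of the completions of all shifts up to \<open>s\<close>; the shift is
  recovered as \<open>A i0 i0 - X i0 i0\<close>, so minimising one matrix entry over the compact set
  \<open>K\<close> suffices. The bound on the shift controls the diagonal, and the 2 by 2 minors
  control the other entries.\<close>

lemma eps_at_exists_least:
  assumes "pair_graph G" "pverts G \<noteq> {}" and X: "X \<in> partial_matrices G"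
  shows "\<exists>e. shifted G X e \<in> psd_completable G \<and> (\<forall>d. shifted G X d \<in> psd_completable G \<longrightarrow> e \<le> d)"
proof -
  let ?V = "pverts G"
  have fin: "finite ?V" by (rule pair_graph_finite[OF assms(1)])
  have arcs: "i \<in> ?V \<and> j \<in> ?V \<and> i \<noteq> j" if "(i, j) \<in> parcs G" for i j
    by (rule pair_graph_vertsD[OF assms(1) that])
  obtain i0 where i0: "i0 \<in> ?V" using assms(2) by blast
  have Xsym: "X i j = X j i" for i j by (rule partial_matrices_sym[OF assms(1) X])
  \<comment> \<open>A shift that is certainly admissible, by \<open>psd_on_shift\<close>; it makes
    \<open>K\<close> nonempty, and larger shifts cannot compete for the minimum.\<close>
  define s where "s = (\<Sum>i\<in>?V. \<Sum>j\<in>?V. \<bar>X i j\<bar>)"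
  \<comment> \<open>A completion is arbitrary off the vertex set; cutting it to zero there keeps
    \<open>K\<close> bounded.\<close>
  define Z where "Z = (\<lambda>A i j. if i \<in> ?V \<and> j \<in> ?V then A i j else (0::real))"
  define K where "K = {A. psd_on ?V A} \<inter> (\<Inter>(i, j)\<in>parcs G. {A. A i j = X i j}) \<inter>
    (\<Inter>i\<in>?V. {A. A i i - X i i = A i0 i0 - X i0 i0}) \<inter> {A. A i0 i0 - X i0 i0 \<le> s} \<inter>
    (\<Inter>(i, j)\<in>- (?V \<times> ?V). {A. A i j = 0})"
  have KI: "Z A \<in> K \<and> Z A i0 i0 - X i0 i0 = d"
    if A: "psd_on ?V A" "\<And>i j. (i, j) \<in> specified G \<Longrightarrow> A i j = shifted G X d i j" and d: "d \<le> s" for A d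
  proof -
    have "psd_on ?V (Z A)" using A(1) psd_on_cong[of ?V A "Z A"] by (auto simp: Z_def)
    moreover have "Z A i j = X i j" if "(i, j) \<in> parcs G" for i j
      using A(2)[of i j] arcs[OF that] that by (simp add: Z_def shifted_apply specified_def)
    moreover have diag: "Z A i i = X i i + d" if "i \<in> ?V" for i
      using A(2)[of i i] that by (simp add: Z_def shifted_apply)
    moreover have "\<And>i j. Z A i j \<noteq> 0 \<Longrightarrow> i \<in> ?V \<and> j \<in> ?V"
      by (auto simp: Z_def split: if_splits)
    ultimately show ?thesis using d i0 unfolding K_def by auto
  qed
  have KD: "shifted G X (A i0 i0 - X i0 i0) \<in> psd_completable G" if "A \<in> K" for A
    unfolding psd_completable_iff
  proof (intro conjI exI[of _ A])
    show "psd_on ?V A" using that by (simp add: K_def)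
    have "A i i = X i i + (A i0 i0 - X i0 i0)" if "i \<in> ?V" for i
    proof -
      have "A i i - X i i = A i0 i0 - X i0 i0" using \<open>A \<in> K\<close> that unfolding K_def by blast
      then show ?thesis by simp
    qed
    moreover have "A i j = X i j" if "(i, j) \<in> parcs G" for i j
      using \<open>A \<in> K\<close> that unfolding K_def by blast
    ultimately show "\<forall>(i, j)\<in>specified G. A i j = shifted G X (A i0 i0 - X i0 i0) i j"
      using arcs by (auto simp: specified_def shifted_apply)
  qed (rule shifted_partial_matrices[OF X])
  have "psd_on ?V (\<lambda>i j. X i j + (if i = j then s else 0))"
    using fin Xsym unfolding s_def by (intro psd_on_shift) auto
  then have ne: "Z (\<lambda>i j. X i j + (if i = j then s else 0)) \<in> K"
    using KI[of "\<lambda>i j. X i j + (if i = j then s else 0)" s] shifted_specified[OF assms(1), of _ _ X s]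
    by simp
  have "compact K"
  proof (rule compact_of_entrywise_bounded)
    show "closed K"
      unfolding K_def
      by (intro closed_Int closed_psd_on closed_INT ballI)
         (auto intro!: closed_Collect_eq closed_Collect_le continuous_intros)
    fix A i j assume A: "A \<in> K"
    show "\<bar>A i j\<bar> \<le> (if i \<in> ?V \<and> j \<in> ?V then X i i + X j j + 2 * s else 0)"
    proof (cases "i \<in> ?V \<and> j \<in> ?V")
      case True
      have psd: "psd_on ?V A" using A by (simp add: K_def)
      have d: "A k k \<le> X k k + s" "0 \<le> A k k" if "k \<in> ?V" for k
      proof -
        have "A k k - X k k = A i0 i0 - X i0 i0" "A i0 i0 - X i0 i0 \<le> s"
          using A that unfolding K_def by blast+
        then show "A k k \<le> X k k + s" by linarith
        show "0 \<le> A k k" by (rule psd_on_diag_nonneg[OF psd fin that])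
      qed
      have "(A i j)\<^sup>2 \<le> A i i * A j j" using psd_on_off_diag[OF psd fin] True by blast
      also have "\<dots> \<le> (A i i + A j j)\<^sup>2"
        using d True by (simp add: power2_eq_square algebra_simps)
      finally have "\<bar>A i j\<bar> \<le> A i i + A j j"
        using d True abs_le_square_iff[of "A i j" "A i i + A j j"] by force
      then show ?thesis using d(1)[of i] d(1)[of j] True by simp
    next
      case False
      then show ?thesis using A unfolding K_def by auto
    qed
  qed
  then obtain A where A: "A \<in> K" "\<forall>B\<in>K. A i0 i0 \<le> B i0 i0"
    using continuous_attains_inf[OF _ _ continuous_on_entry[of K i0 i0]] ne by blast
  have "A i0 i0 - X i0 i0 \<le> d" if "shifted G X d \<in> psd_completable G" for d
  proof (cases "d \<le> s")
    case True
    obtain B where "psd_on ?V B" "\<And>i j. (i, j) \<in> specified G \<Longrightarrow> B i j = shifted G X d i j"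
      using psd_completableE[OF \<open>shifted G X d \<in> psd_completable G\<close>] by blast
    from KI[OF this True] A(2) show ?thesis by fastforce
  next
    case False
    then show ?thesis using A(1) unfolding K_def by simp
  qed
  then show ?thesis using KD[OF A(1)] by blast
qed

text \<open>Since the minimum is attained and the admissible shifts are closed upwards, they form a
  closed half-line starting at \<open>eps_at G X\<close>.\<close>

lemma eps_at_le_iff:
  assumes "pair_graph G" "pverts G \<noteq> {}" "X \<in> partial_matrices G"
  shows "shifted G X e \<in> psd_completable G \<longleftrightarrow> eps_at G X \<le> e"
proof -
  obtain d where d: "shifted G X d \<in> psd_completable G"
    "\<And>d'. shifted G X d' \<in> psd_completable G \<Longrightarrow> d \<le> d'"
    using eps_at_exists_least[OF assms] by blast
  have "eps_at G X = d"
    unfolding eps_at_def shifted_def[symmetric] using d by (intro Least_equality) auto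
  then show ?thesis
    using d shifted_mono[OF assms(1), of X d e] by blast
qed

section \<open>Attainment of the maximum and homogeneity\<close>

lemma clique_psd_partial: "X \<in> clique_psd G \<Longrightarrow> X \<in> partial_matrices G"
  by (simp add: clique_psd_def)

lemma clique_psd_diag_nonneg:
  assumes "X \<in> clique_psd G" "i \<in> pverts G"
  shows "0 \<le> X i i"
proof -
  have "psd_on {i} X" using assms unfolding clique_psd_def is_clique_def by auto
  from psd_on_diag_nonneg[OF this, of i] show ?thesis by simp
qed

lemma clique_psd_normalized_entry_le_one:
  assumes G: "pair_graph G" and X: "X \<in> clique_psd_normalized G"
  shows "\<bar>X i j\<bar> \<le> 1"
proof -
  have cp: "X \<in> clique_psd G" and tr: "(\<Sum>i\<in>pverts G. X i i) = 1"
    using X by (auto simp: clique_psd_normalized_def pm_trace_def)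
  have diag: "X i i \<le> 1" if "i \<in> pverts G" for i
    using member_le_sum[of i "pverts G" "\<lambda>i. X i i"] tr clique_psd_diag_nonneg[OF cp]
      pair_graph_finite[OF G] that by auto
  consider "(i, j) \<in> parcs G" | "i = j" "i \<in> pverts G" | "(i, j) \<notin> specified G"
    by (auto simp: specified_def)
  then show ?thesis
  proof cases
    case 1
    then have ij: "i \<in> pverts G" "j \<in> pverts G" using pair_graph_vertsD[OF G] by blast+
    have "is_clique G {i, j}"
      using 1 ij pair_graph_symD[OF G 1] by (auto simp: is_clique_def)
    then have "psd_on {i, j} X" using cp by (auto simp: clique_psd_def)
    from psd_on_off_diag[OF this, of i j] have "(X i j)\<^sup>2 \<le> X i i * X j j" by simp
    also have "\<dots> \<le> 1 * 1" using ij diag clique_psd_diag_nonneg[OF cp] by (intro mult_mono) auto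
    finally show ?thesis by (simp add: abs_square_le_1)
  next
    case 2
    then show ?thesis using diag clique_psd_diag_nonneg[OF cp] by fastforce
  next
    case 3
    then show ?thesis using cp by (auto simp: clique_psd_def partial_matrices_def)
  qed
qed

lemma closed_clique_psd_normalized: "closed (clique_psd_normalized G)"
proof -
  have "clique_psd_normalized G = (\<Inter>(i, j)\<in>specified G. {X. X i j = X j i}) \<inter>
      (\<Inter>(i, j)\<in>- specified G. {X. X i j = 0}) \<inter> (\<Inter>K\<in>{K. is_clique G K}. {X. psd_on K X}) \<inter>
      {X. (\<Sum>i\<in>pverts G. X i i) = 1}"
    by (auto simp: clique_psd_normalized_def clique_psd_def partial_matrices_def pm_trace_def)
  also have "closed \<dots>"
    by (intro closed_Int closed_psd_on closed_INT ballI)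
       (auto intro!: closed_Collect_eq closed_psd_on continuous_intros)
  finally show ?thesis .
qed

lemma compact_clique_psd_normalized: "pair_graph G \<Longrightarrow> compact (clique_psd_normalized G)"
  by (rule compact_of_entrywise_bounded[OF closed_clique_psd_normalized, where B = "\<lambda>_ _. 1"])
     (rule clique_psd_normalized_entry_le_one)

definition vertex_matrix :: "'a \<Rightarrow> 'a \<Rightarrow> 'a \<Rightarrow> real" where
  "vertex_matrix v i j = (if i = v \<and> j = v then 1 else 0)"

lemma vertex_matrix_normalized:
  assumes "pair_graph G" "v \<in> pverts G"
  shows "vertex_matrix v \<in> clique_psd_normalized G"
proof -
  have "psd_on K (vertex_matrix v)" for K
    using psd_on_rank_one[of K "\<lambda>i. if i = v then 1 else 0"]
    by (rule psd_on_cong[THEN iffD1, rotated]) (auto simp: vertex_matrix_def)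
  then show ?thesis
    using assms pair_graph_finite[OF assms(1)]
    by (auto simp: clique_psd_normalized_def clique_psd_def partial_matrices_def pm_trace_def vertex_matrix_def)
qed

text \<open>Adding \<open>Y - X\<close> to a completion for \<open>X\<close> is compensated by a
  further shift by the sum of its absolute entries. The resulting continuity, on a compact set, is
  what gives \<open>GREATEST\<close> in \<open>additive_distance\<close> a value.\<close>

lemma eps_at_lipschitz:
  assumes G: "pair_graph G" "pverts G \<noteq> {}" and X: "X \<in> partial_matrices G" and Y: "Y \<in> partial_matrices G"
  shows "eps_at G Y \<le> eps_at G X + (\<Sum>i\<in>pverts G. \<Sum>j\<in>pverts G. \<bar>Y i j - X i j\<bar>)" (is "_ \<le> ?e + ?s")
proof -
  have sym: "Y i j - X i j = Y j i - X j i" for i j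
    using partial_matrices_sym[OF G(1)] X Y by metis
  obtain A where A: "psd_on (pverts G) A" "\<forall>(i, j)\<in>specified G. A i j = shifted G X ?e i j"
    using eps_at_le_iff[OF G X, of ?e] unfolding psd_completable_iff by blast
  have "psd_on (pverts G) (\<lambda>i j. A i j + ((Y i j - X i j) + (if i = j then ?s else 0)))"
    using pair_graph_finite[OF G(1)] sym by (intro psd_on_add A psd_on_shift) auto
  moreover have "\<forall>(i, j)\<in>specified G.
      A i j + ((Y i j - X i j) + (if i = j then ?s else 0)) = shifted G Y (?e + ?s) i j"
    using A(2) by (auto simp: shifted_specified[OF G(1)] split: prod.splits)
  ultimately have "shifted G Y (?e + ?s) \<in> psd_completable G"
    using shifted_partial_matrices[OF Y] unfolding psd_completable_iff by blast
  then show ?thesis using eps_at_le_iff[OF G Y] by blast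
qed

lemma continuous_on_eps_at:
  assumes G: "pair_graph G" "pverts G \<noteq> {}"
  shows "continuous_on (partial_matrices G) (eps_at G)"
  unfolding continuous_on_def
proof
  fix X assume X: "X \<in> partial_matrices G"
  let ?d = "\<lambda>Y. \<Sum>i\<in>pverts G. \<Sum>j\<in>pverts G. \<bar>Y i j - X i j\<bar>"
  have "continuous_on (partial_matrices G) ?d" by (intro continuous_intros)
  then have "(?d \<longlongrightarrow> ?d X) (at X within partial_matrices G)"
    using X unfolding continuous_on_def by blast
  then have lim: "(?d \<longlongrightarrow> 0) (at X within partial_matrices G)" by simp
  have "\<bar>eps_at G Y - eps_at G X\<bar> \<le> ?d Y" if Y: "Y \<in> partial_matrices G" for Y
    using eps_at_lipschitz[OF G X Y] eps_at_lipschitz[OF G Y X] by (simp add: abs_minus_commute)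
  then have "\<forall>\<^sub>F Y in at X within partial_matrices G. norm (eps_at G Y - eps_at G X) \<le> ?d Y"
    by (auto simp: eventually_at_filter)
  then have "((\<lambda>Y. eps_at G Y - eps_at G X) \<longlongrightarrow> 0) (at X within partial_matrices G)"
    by (rule Lim_null_comparison[OF _ lim])
  then show "(eps_at G \<longlongrightarrow> eps_at G X) (at X within partial_matrices G)" by (rule LIM_zero_cancel)
qed

lemma additive_distance_attained:
  assumes G: "pair_graph G" "pverts G \<noteq> {}"
  shows "\<exists>X\<in>clique_psd_normalized G. eps_at G X = additive_distance G"
    and "X \<in> clique_psd_normalized G \<Longrightarrow> eps_at G X \<le> additive_distance G"
proof -
  let ?P = "clique_psd_normalized G"
  obtain v where "v \<in> pverts G" using G(2) by blast
  then have ne: "?P \<noteq> {}" using vertex_matrix_normalized[OF G(1)] by blast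
  have "continuous_on ?P (eps_at G)"
    by (rule continuous_on_subset[OF continuous_on_eps_at[OF G]])
       (auto simp: clique_psd_normalized_def clique_psd_def)
  then obtain X0 where X0: "X0 \<in> ?P" "\<forall>Y\<in>?P. eps_at G Y \<le> eps_at G X0"
    using continuous_attains_sup[OF compact_clique_psd_normalized[OF G(1)] ne] by blast
  then have eq: "additive_distance G = eps_at G X0"
    unfolding additive_distance_def by (intro Greatest_equality) auto
  show "\<exists>X\<in>clique_psd_normalized G. eps_at G X = additive_distance G" using X0 eq by auto
  show "eps_at G X \<le> additive_distance G" if "X \<in> clique_psd_normalized G"
    using X0 eq that by auto
qed

lemma additive_distance_le_iff:
  assumes G: "pair_graph G" "pverts G \<noteq> {}"
  shows "additive_distance G \<le> e \<longleftrightarrow>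
    (\<forall>X\<in>clique_psd_normalized G. shifted G X e \<in> psd_completable G)"
proof -
  have "additive_distance G \<le> e \<longleftrightarrow> (\<forall>X\<in>clique_psd_normalized G. eps_at G X \<le> e)"
    using additive_distance_attained[OF G] by (metis order_trans)
  also have "\<dots> \<longleftrightarrow> (\<forall>X\<in>clique_psd_normalized G. shifted G X e \<in> psd_completable G)"
    using eps_at_le_iff[OF G] by (auto simp: clique_psd_normalized_def clique_psd_def)
  finally show ?thesis .
qed

text \<open>For \<open>vertex_matrix v\<close> the diagonal entry of a completion at the other
  vertex \<open>u\<close> is the shift itself. A second vertex is essential: for a one-vertex graph
  the distance is -1.\<close>

lemma additive_distance_nonneg:
  assumes G: "pair_graph G" and uv: "u \<in> pverts G" "v \<in> pverts G" "u \<noteq> v"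
  shows "0 \<le> additive_distance G"
proof -
  have "shifted G (vertex_matrix v) (additive_distance G) \<in> psd_completable G"
    using additive_distance_le_iff[OF G, of "additive_distance G"] vertex_matrix_normalized[OF G uv(2)] uv
    by blast
  then obtain A where A: "psd_on (pverts G) A"
    "\<And>i j. (i, j) \<in> specified G \<Longrightarrow> A i j = shifted G (vertex_matrix v) (additive_distance G) i j"
    using psd_completableE by blast
  have "0 \<le> A u u" by (rule psd_on_diag_nonneg[OF A(1) pair_graph_finite[OF G] uv(1)])
  also have "A u u = additive_distance G"
    using A(2)[of u u] uv by (simp add: shifted_apply vertex_matrix_def)
  finally show ?thesis .
qed

text \<open>Homogeneity reduces to trace 1. A matrix of trace zero cannot be normalised, but its 2
  by 2 clique blocks force it to vanish.\<close>

lemma clique_psd_shift_trace: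
  assumes G: "pair_graph G" and uv: "u \<in> pverts G" "v \<in> pverts G" "u \<noteq> v"
    and X: "X \<in> clique_psd G" and e: "additive_distance G * pm_trace G X \<le> e"
  shows "shifted G X e \<in> psd_completable G"
proof -
  have fin: "finite (pverts G)" by (rule pair_graph_finite[OF G])
  have ne: "pverts G \<noteq> {}" using uv by blast
  define \<tau> where "\<tau> = pm_trace G X"
  have nn: "0 \<le> \<tau>" unfolding \<tau>_def pm_trace_def
    using clique_psd_diag_nonneg[OF X] by (intro sum_nonneg)
  have "shifted G X (additive_distance G * \<tau>) \<in> psd_completable G"
  proof (cases "\<tau> = 0")
    case True
    then have d: "X i i = 0" if "i \<in> pverts G" for i
      using that clique_psd_diag_nonneg[OF X] fin unfolding \<tau>_def pm_trace_def
      by (subst (asm) sum_nonneg_eq_0_iff) auto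
    have "X i j = 0" for i j
    proof (cases "(i, j) \<in> parcs G")
      case True
      then have ij: "i \<in> pverts G" "j \<in> pverts G" using pair_graph_vertsD[OF G] by blast+
      have "is_clique G {i, j}"
        using True ij pair_graph_symD[OF G True] by (auto simp: is_clique_def)
      then have "psd_on {i, j} X" using X by (auto simp: clique_psd_def)
      from psd_on_off_diag[OF this, of i j] show ?thesis using d ij by simp
    next
      case False
      then show ?thesis
        using d X by (cases "i = j \<and> i \<in> pverts G") (auto simp: clique_psd_def partial_matrices_def specified_def)
    qed
    then show ?thesis
      using True psd_on_zero[of "pverts G"]
      by (auto simp: psd_completable_iff shifted_def partial_matrices_def)
  next
    case False
    then have pos: "0 < \<tau>" using nn by simp
    define Y where "Y = (\<lambda>i j. (1 / \<tau>) * X i j)"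
    have "psd_on K Y" if "psd_on K X" for K unfolding Y_def using pos that by (intro psd_on_scale) auto
    then have "Y \<in> clique_psd G"
      using X unfolding clique_psd_def partial_matrices_def by (auto simp: Y_def)
    moreover have "pm_trace G Y = 1"
      using pos unfolding pm_trace_def Y_def sum_distrib_left[symmetric] by (simp add: \<tau>_def pm_trace_def)
    ultimately have "shifted G Y (additive_distance G) \<in> psd_completable G"
      using additive_distance_le_iff[OF G ne, of "additive_distance G"] by (auto simp: clique_psd_normalized_def)
    then obtain A where A: "psd_on (pverts G) A"
      "\<forall>(i, j)\<in>specified G. A i j = shifted G Y (additive_distance G) i j"
      unfolding psd_completable_iff by blast
    have "psd_on (pverts G) (\<lambda>i j. \<tau> * A i j)" using A(1) nn by (rule psd_on_scale)
    moreover have "\<forall>(i, j)\<in>specified G. \<tau> * A i j = shifted G X (additive_distance G * \<tau>) i j"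
      using A(2) pos by (auto simp: shifted_specified[OF G] Y_def algebra_simps split: prod.splits)
    ultimately show ?thesis
      using shifted_partial_matrices[OF clique_psd_partial[OF X]] unfolding psd_completable_iff by blast
  qed
  then show ?thesis by (rule shifted_mono[OF G]) (use e in \<open>simp add: \<tau>_def\<close>)
qed


section \<open>Compression onto a shortest path\<close>

lemma set_vwalk_arcs: "set (vwalk_arcs p) = {(p ! k, p ! Suc k) |k. Suc k < length p}"
proof (induction p rule: vwalk_arcs.induct)
  case (3 x y xs)
  have "{(p ! k, p ! Suc k) |k. Suc k < length p} =
      insert (x, y) {((y # xs) ! k, (y # xs) ! Suc k) |k. Suc k < length (y # xs)}"
    if "p = x # y # xs" for p
  proof (intro equalityI subsetI)
    fix z assume "z \<in> {(p ! k, p ! Suc k) |k. Suc k < length p}"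
    then obtain k where k: "z = (p ! k, p ! Suc k)" "Suc k < length p" by blast
    then show "z \<in> insert (x, y) {((y # xs) ! k, (y # xs) ! Suc k) |k. Suc k < length (y # xs)}"
      using that by (cases k) auto
  next
    fix z assume z: "z \<in> insert (x, y) {((y # xs) ! k, (y # xs) ! Suc k) |k. Suc k < length (y # xs)}"
    show "z \<in> {(p ! k, p ! Suc k) |k. Suc k < length p}"
    proof (cases "z = (x, y)")
      case True
      then show ?thesis using that by (intro CollectI exI[of _ 0]) simp
    next
      case False
      then obtain k where "z = ((y # xs) ! k, (y # xs) ! Suc k)" "Suc k < length (y # xs)" using z by blast
      then show ?thesis using that by (intro CollectI exI[of _ "Suc k"]) simp
    qed
  qed
  then show ?case using 3 by simp
qed auto

lemma path_graph_arc_iff: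
  "(a, b) \<in> parcs (path_graph p) \<longleftrightarrow>
     (\<exists>k. Suc k < length p \<and> (a = p ! k \<and> b = p ! Suc k \<or> b = p ! k \<and> a = p ! Suc k))"
  unfolding path_graph_def by (auto simp: set_vwalk_arcs)

lemma path_graph_verts [simp]: "pverts (path_graph p) = set p"
  by (simp add: path_graph_def)

lemma pair_graph_path_graph:
  assumes "distinct p"
  shows "pair_graph (path_graph p)"
proof
  have fin: "finite (parcs (path_graph p))" by (simp add: path_graph_def)
  then show "finite (parcs (path_graph p))" .
  show "symmetric (with_proj (path_graph p))"
    unfolding symmetric_def with_proj_simps by (rule symI) (auto simp: path_graph_arc_iff)
  fix z assume "z \<in> parcs (path_graph p)"
  then obtain k where "Suc k < length p" "z = (p ! k, p ! Suc k) \<or> z = (p ! Suc k, p ! k)"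
    by (cases z) (auto simp: path_graph_arc_iff)
  then show "fst z \<in> pverts (path_graph p)" "snd z \<in> pverts (path_graph p)" "fst z \<noteq> snd z"
    using assms by (auto simp: nth_eq_iff_index_eq)
qed simp

lemma relpow_imp_path_between:
  assumes G: "pair_graph G" and "u \<in> pverts G" "(u, v) \<in> parcs G ^^ n"
  shows "\<exists>q. path_between G u v q \<and> vwalk_length q \<le> n"
proof -
  obtain f where f: "f 0 = u" "f n = v" "\<forall>i<n. (f i, f (Suc i)) \<in> parcs G"
    using assms(3) by (auto simp: relpow_fun_conv)
  obtain g m where g: "m \<le> n" "g 0 = u" "g m = v" "\<forall>i<m. (g i, g (Suc i)) \<in> parcs G" "inj_on g {..m}"
    using chordless_walk[OF f(1,2,3), of UNIV] by auto
  define q where "q = map g [0..<Suc m]"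
  have nth: "q ! i = g i" if "i \<le> m" for i using that by (simp add: q_def del: upt_Suc)
  have len: "length q = Suc m" by (simp add: q_def)
  have "g i \<in> pverts G" if "i \<le> m" for i
  proof (cases i)
    case 0
    then show ?thesis using g assms by simp
  next
    case (Suc k)
    then have "(g k, g i) \<in> parcs G" using g(4) that by auto
    then show ?thesis using pair_graph_vertsD[OF G] by blast
  qed
  then have "set q \<subseteq> pverts G" by (auto simp: q_def simp del: upt_Suc)
  moreover have "set (vwalk_arcs q) \<subseteq> parcs G"
    unfolding set_vwalk_arcs using g(4) nth len by auto
  moreover have "{0..<Suc m} = {..m}" by auto
  then have "distinct q" unfolding q_def distinct_map set_upt using g(5) by simp
  moreover have ne: "q \<noteq> []" using len by auto
  moreover have "hd q = u" "last q = v"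
    using g nth[of 0] nth[of m] len unfolding hd_conv_nth[OF ne] last_conv_nth[OF ne] by simp_all
  ultimately show ?thesis
    using g(1) len by (intro exI[of _ q]) (auto simp: path_between_def intro!: vpathI vwalkI)
qed

lemma path_betweenD:
  assumes "path_between G u v p"
  shows "p \<noteq> []" "distinct p" "p ! 0 = u" "p ! (length p - 1) = v" "set p \<subseteq> pverts G"
    "\<And>k. Suc k < length p \<Longrightarrow> (p ! k, p ! Suc k) \<in> parcs G"
proof -
  have p: "vpath p (with_proj G)" "hd p = u" "last p = v" using assms by (auto simp: path_between_def)
  show ne: "p \<noteq> []" "distinct p" "set p \<subseteq> pverts G" using p(1) by (auto elim!: vpathE vwalkE)
  show "p ! 0 = u" "p ! (length p - 1) = v" using p(2,3) ne(1) by (auto simp: hd_conv_nth last_conv_nth)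
  show "(p ! k, p ! Suc k) \<in> parcs G" if "Suc k < length p" for k
    using p(1) that unfolding vpath_def vwalk_def set_vwalk_arcs by auto
qed

text \<open>The level is the distance from \<open>u\<close>. It grows by at most one along an arc,
  and a vertex of \<open>p\<close> reached earlier than its position would yield a shorter path from
  \<open>u\<close> to \<open>v\<close>.\<close>

lemma shortest_path_level:
  assumes G: "pair_graph G" and p: "shortest_path G u v p"
  shows "\<exists>lev. (\<forall>a b. (a, b) \<in> parcs G \<longrightarrow> lev b \<le> Suc (lev a)) \<and> (\<forall>k<length p. lev (p ! k) = k)"
proof -
  have pb: "path_between G u v p" and short: "\<And>q. path_between G u v q \<Longrightarrow> vwalk_length p \<le> vwalk_length q"
    using p by (auto simp: shortest_path_def)
  note p = path_betweenD[OF pb]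
  define d where "d = length p - 1"
  \<comment> \<open>Truncating the distance at \<open>d\<close> gives \<open>LEAST\<close> a witness
    for every \<open>a\<close>, reachable or not, and does not affect the levels on
    \<open>p\<close>.\<close>
  define lev where "lev = (\<lambda>a. LEAST n. d \<le> n \<or> (u, a) \<in> parcs G ^^ n)"
  have lev: "d \<le> lev a \<or> (u, a) \<in> parcs G ^^ lev a" for a
    unfolding lev_def by (rule LeastI[of _ d]) simp
  have le: "lev a \<le> n" if "d \<le> n \<or> (u, a) \<in> parcs G ^^ n" for a n
    unfolding lev_def using that by (rule Least_le)
  have walk: "(p ! i, p ! (i + n)) \<in> parcs G ^^ n" if "i + n < length p" for i n
    unfolding relpow_fun_conv using p(6) that by (intro exI[of _ "\<lambda>k. p ! (i + k)"]) auto
  have "lev b \<le> Suc (lev a)" if "(a, b) \<in> parcs G" for a b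
    using lev[of a] that by (intro le) auto
  moreover have "lev (p ! k) = k" if k: "k < length p" for k
  proof (rule antisym)
    show "lev (p ! k) \<le> k" using walk[of 0 k] k p(3) by (intro le) auto
    show "k \<le> lev (p ! k)"
    proof (cases "d \<le> lev (p ! k)")
      case False
      then have 1: "(u, p ! k) \<in> parcs G ^^ lev (p ! k)" using lev by blast
      have 2: "(p ! k, v) \<in> parcs G ^^ (d - k)" using walk[of k "d - k"] k p(1,4) by (simp add: d_def)
      have "u \<in> pverts G" using p(1,3,5) by (metis length_greater_0_conv nth_mem subsetD)
      moreover have "(u, v) \<in> parcs G ^^ (lev (p ! k) + (d - k))"
        using 1 2 by (auto simp: relpow_add)
      ultimately obtain q where "path_between G u v q" "vwalk_length q \<le> lev (p ! k) + (d - k)"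
        using relpow_imp_path_between[OF G] by blast
      then have "d \<le> lev (p ! k) + (d - k)" using short[of q] by (simp add: d_def)
      then show ?thesis using k by (simp add: d_def)
    qed (use k in \<open>simp add: d_def\<close>)
  qed
  ultimately show ?thesis by blast
qed

lemma shortest_path_induced:
  assumes G: "pair_graph G" and p: "shortest_path G u v p"
    and ab: "a \<in> set p" "b \<in> set p" "(a, b) \<in> parcs G"
  shows "(a, b) \<in> parcs (path_graph p)"
proof -
  obtain lev where lev: "\<forall>a b. (a, b) \<in> parcs G \<longrightarrow> lev b \<le> Suc (lev a)" "\<forall>k<length p. lev (p ! k) = k"
    using shortest_path_level[OF G p] by blast
  obtain i j where ij: "i < length p" "a = p ! i" "j < length p" "b = p ! j"
    using ab(1,2) by (metis in_set_conv_nth)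
  have "j \<le> Suc i" "i \<le> Suc j" using lev ij ab(3) pair_graph_symD[OF G ab(3)] by metis+
  moreover have "i \<noteq> j" using ij ab(3) pair_graph_vertsD[OF G] by blast
  ultimately have "j = Suc i \<or> i = Suc j" by linarith
  then show ?thesis using ij unfolding path_graph_arc_iff by blast
qed

text \<open>Arcs of \<open>G\<close> join levels that differ by at most one, and three distinct
  positions on \<open>p\<close> are never pairwise that close.\<close>

lemma shortest_path_no_triangle:
  assumes G: "pair_graph G" and p: "shortest_path G u v p"
    and "a \<in> set p" "b \<in> set p" "c \<in> set p" "(a, b) \<in> parcs G" "(b, c) \<in> parcs G"
  shows "(a, c) \<notin> parcs G"
proof
  assume "(a, c) \<in> parcs G"
  obtain lev where lev: "\<forall>a b. (a, b) \<in> parcs G \<longrightarrow> lev b \<le> Suc (lev a)" "\<forall>k<length p. lev (p ! k) = k"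
    using shortest_path_level[OF G p] by blast
  obtain i j k where ij: "i < length p" "a = p ! i" "j < length p" "b = p ! j" "k < length p" "c = p ! k"
    using assms(3-5) by (metis in_set_conv_nth)
  have "j \<le> Suc i" "i \<le> Suc j" "k \<le> Suc j" "j \<le> Suc k" "k \<le> Suc i" "i \<le> Suc k"
    using lev ij assms(6,7) \<open>(a, c) \<in> parcs G\<close> pair_graph_symD[OF G] by metis+
  moreover have "i \<noteq> j" "j \<noteq> k" "i \<noteq> k" using ij assms(6,7) \<open>(a, c) \<in> parcs G\<close> pair_graph_vertsD[OF G] by blast+
  ultimately show False by linarith
qed

text \<open>The matrix is \<open>I - U U^T\<close>, where the columns of \<open>U\<close> are unit
  vectors with disjoint supports; Cauchy-Schwarz on each fibre is the projection inequality.\<close>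

lemma psd_on_fibre_projection:
  assumes "finite W" "finite P" "\<pi> ` W \<subseteq> P"
    and unit: "\<And>k. k \<in> P \<Longrightarrow> (\<Sum>i\<in>{i\<in>W. \<pi> i = k}. (u i)\<^sup>2) = 1"
  shows "psd_on W (\<lambda>i j. (if i = j then 1 else 0) + - 1 * (u i * u j * (if \<pi> i = \<pi> j then 1 else 0)))"
proof (rule psd_onI)
  fix x
  let ?F = "\<lambda>k. {i\<in>W. \<pi> i = k}"
  have "qform W (\<lambda>i j. u i * u j * (if \<pi> i = \<pi> j then 1 else 0)) x
      = (\<Sum>k\<in>P. (\<Sum>i\<in>?F k. u i * x i)\<^sup>2)"
    by (subst qform_pullback[OF assms(1-3), where M = "\<lambda>k l. if k = l then 1 else 0"])
       (simp add: qform_diagonal[OF assms(2), of "\<lambda>_. 1"])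
  also have "\<dots> \<le> (\<Sum>k\<in>P. (\<Sum>i\<in>?F k. (u i)\<^sup>2) * (\<Sum>i\<in>?F k. (x i)\<^sup>2))"
    by (intro sum_mono Cauchy_Schwarz_ineq_sum)
  also have "\<dots> = (\<Sum>i\<in>W. (x i)\<^sup>2)"
    unfolding sum_group_fibres[OF assms(1-3)] by (intro sum.cong) (auto simp: unit)
  finally show "0 \<le> qform W (\<lambda>i j. (if i = j then 1 else 0) + - 1 * (u i * u j * (if \<pi> i = \<pi> j then 1 else 0))) x"
    unfolding qform_add qform_scale using qform_diagonal[OF assms(1), of "\<lambda>_. 1" x] by simp
qed auto

text \<open>Where \<open>x\<close> vanishes, any unit vector serves with \<open>c = 0\<close>. The
  columns of \<open>U\<close> must have norm 1 even there, or \<open>I - U U^T\<close> would not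
  complement \<open>U U^T\<close> to a projection pair.\<close>

lemma unit_direction:
  fixes x :: "'a \<Rightarrow> real"
  assumes "finite F" "F \<noteq> {}"
  shows "\<exists>u c. (\<Sum>i\<in>F. (u i)\<^sup>2) = 1 \<and> (\<forall>i\<in>F. x i = c * u i) \<and> c\<^sup>2 = (\<Sum>i\<in>F. (x i)\<^sup>2)"
proof (cases "(\<Sum>i\<in>F. (x i)\<^sup>2) = 0")
  case True
  then have 0: "\<forall>i\<in>F. x i = 0" using assms by (subst (asm) sum_nonneg_eq_0_iff) auto
  obtain i0 where "i0 \<in> F" using assms by blast
  then have "(\<Sum>i\<in>F. (if i = i0 then 1 else 0 :: real)\<^sup>2) = 1"
    using assms by (simp add: if_distrib[of "\<lambda>t. t\<^sup>2"] cong: if_cong)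
  then show ?thesis using 0 by (intro exI[of _ "\<lambda>i. if i = i0 then 1 else 0"] exI[of _ 0]) simp
next
  case False
  define c where "c = sqrt (\<Sum>i\<in>F. (x i)\<^sup>2)"
  have c2: "c\<^sup>2 = (\<Sum>i\<in>F. (x i)\<^sup>2)" unfolding c_def by (simp add: sum_nonneg)
  then have c: "c \<noteq> 0" using False by auto
  have "(\<Sum>i\<in>F. (x i / c)\<^sup>2) = (\<Sum>i\<in>F. (x i)\<^sup>2) / c\<^sup>2" by (simp add: power_divide sum_divide_distrib)
  also have "\<dots> = 1" unfolding c2[symmetric] using c by simp
  finally show ?thesis using c c2 by (intro exI[of _ "\<lambda>i. x i / c"] exI[of _ c]) simp
qed

text \<open>
  The layers are clipped so that \<open>t\<close> and \<open>h\<close> are alone in the first and the last one; this needs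
  distance at least 2. In return \<open>A t h = M t h\<close>, whichever completion \<open>M\<close> is chosen on the path.
\<close>

lemma shortest_path_compression:
  fixes x :: "'c \<Rightarrow> real"
  assumes G: "pair_graph C" and sp: "shortest_path C t h p" and "t \<noteq> h" and nadj: "(t, h) \<notin> parcs C"
  shows "\<exists>z. z t = x t \<and> z h = x h \<and>
    (\<Sum>a\<in>set p - {t, h}. (z a)\<^sup>2) = (\<Sum>a\<in>pverts C - {t, h}. (x a)\<^sup>2) \<and>
    (\<forall>M \<epsilon>. 0 \<le> \<epsilon> \<and> psd_on (set p) M \<and>
        (\<forall>(a, b)\<in>specified (path_graph p). M a b = z a * z b + (if a = b then \<epsilon> else 0)) \<longrightarrow>
      (\<exists>A. psd_on (pverts C) A \<and> A t h = M t h \<and>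
        (\<forall>(a, b)\<in>specified C. A a b = x a * x b + (if a = b then \<epsilon> else 0))))"
proof -
  have pb: "path_between C t h p" using sp by (simp add: shortest_path_def)
  note p = path_betweenD[OF pb]
  define d where "d = length p - 1"
  have len: "length p = Suc d" using p(1) by (simp add: d_def)
  have pt: "p ! 0 = t" "p ! d = h" using p by (auto simp: d_def)
  have d2: "2 \<le> d"
  proof -
    have "d \<noteq> 0" using pt \<open>t \<noteq> h\<close> by metis
    moreover have "d \<noteq> 1" using p(6)[of 0] pt nadj len by auto
    ultimately show ?thesis by linarith
  qed
  have pinj: "p ! i = p ! j \<longleftrightarrow> i = j" if "i \<le> d" "j \<le> d" for i j
    using p(2) that len by (simp add: nth_eq_iff_index_eq)
  obtain lev where lev: "\<And>a b. (a, b) \<in> parcs C \<Longrightarrow> lev b \<le> Suc (lev a)" "\<And>k. k \<le> d \<Longrightarrow> lev (p ! k) = k"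
    using shortest_path_level[OF G sp] len by (auto simp: less_Suc_eq_le)
  have levt: "lev t = 0" "lev h = d" using lev(2)[of 0] lev(2)[of d] pt by auto
  define l where "l = (\<lambda>a. if a = t then 0 else if a = h then d else max 1 (min (d - 1) (lev a)))"
  have l_le: "l a \<le> d" for a using d2 by (auto simp: l_def)
  have l0: "l a = 0 \<longleftrightarrow> a = t" and ld: "l a = d \<longleftrightarrow> a = h" for a
    using d2 \<open>t \<noteq> h\<close> by (auto simp: l_def)
  have lp: "l (p ! k) = k" if "k \<le> d" for k
    using lev(2)[OF that] pinj[OF that, of 0] pinj[OF that, of d] pt d2 that by (auto simp: l_def)
  \<comment> \<open>Clipping could fail only at the ends. A neighbour of \<open>h\<close> has
    \<open>lev\<close> at least \<open>d - 1\<close> and differs from \<open>t\<close>, so unless it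
    is \<open>h\<close> it is clipped to exactly \<open>d - 1\<close>; a neighbour of
    \<open>t\<close> has \<open>lev\<close> at most 1.\<close>
  have l_arc': "l b \<le> Suc (l a)" if ab: "(a, b) \<in> parcs C" for a b
  proof -
    have ba: "(b, a) \<in> parcs C" using pair_graph_symD[OF G ab] .
    have lv: "lev b \<le> Suc (lev a)" using lev(1)[OF ab] .
    show ?thesis
    proof (cases "b = h")
      case True
      then have "a \<noteq> t" using nadj ab by auto
      then show ?thesis using True lv levt d2 by (auto simp: l_def)
    next
      case False
      then show ?thesis using lv levt d2 by (auto simp: l_def)
    qed
  qed
  define \<pi> where "\<pi> = (\<lambda>a. p ! l a)"
  have \<pi>_in: "\<pi> a \<in> set p" for a using l_le[of a] len by (simp add: \<pi>_def)
  have \<pi>_arc: "\<pi> a = \<pi> b \<or> (\<pi> a, \<pi> b) \<in> parcs (path_graph p)" if "(a, b) \<in> parcs C" for a b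
  proof -
    have "l b \<le> Suc (l a)" "l a \<le> Suc (l b)" using l_arc' that pair_graph_symD[OF G that] by blast+
    then have "l a = l b \<or> l b = Suc (l a) \<or> l a = Suc (l b)" by linarith
    then show ?thesis
    proof (elim disjE)
      assume "l a = l b"
      then show ?thesis by (simp add: \<pi>_def)
    next
      assume "l b = Suc (l a)"
      then show ?thesis using l_le[of b] len unfolding path_graph_arc_iff \<pi>_def
        by (intro disjI2 exI[of _ "l a"]) simp
    next
      assume "l a = Suc (l b)"
      then show ?thesis using l_le[of a] len unfolding path_graph_arc_iff \<pi>_def
        by (intro disjI2 exI[of _ "l b"]) simp
    qed
  qed
  have \<pi>t: "\<pi> a = t \<longleftrightarrow> a = t" and \<pi>h: "\<pi> a = h \<longleftrightarrow> a = h" for a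
    using pinj[OF l_le, of 0 a] pinj[OF l_le, of d a] pt l0 ld by (auto simp: \<pi>_def)
  have \<pi>p: "\<pi> k = k" if k: "k \<in> set p" for k
  proof -
    obtain i where "i \<le> d" "k = p ! i" using k len by (auto simp: in_set_conv_nth less_Suc_eq_le)
    then show ?thesis using lp by (simp add: \<pi>_def)
  qed
  let ?W = "pverts C" and ?F = "\<lambda>k. {i\<in>pverts C. \<pi> i = k}"
  have fin: "finite ?W" using pair_graph_finite[OF G] .
  have th: "t \<in> set p" "h \<in> set p" using pt len by (auto simp: in_set_conv_nth intro: exI[of _ 0] exI[of _ d])
  \<comment> \<open>At \<open>t\<close> and \<open>h\<close> the fibre is a single vertex, and the
    coefficient is the entry of \<open>x\<close> with its sign instead of a norm. As the direction
    is 1 there, the completion copies \<open>M\<close> at the ends without a change of sign.\<close>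
  define Q where "Q k u c \<longleftrightarrow> (\<Sum>i\<in>?F k. (u i)\<^sup>2) = 1 \<and> (\<forall>i\<in>?F k. x i = c * u i) \<and>
      c\<^sup>2 = (\<Sum>i\<in>?F k. (x i)\<^sup>2) \<and> (k \<in> {t, h} \<longrightarrow> c = x k \<and> u k = 1)" for k u c
  have "\<exists>u c. Q k u c" if k: "k \<in> set p" for k
  proof (cases "k \<in> {t, h}")
    case True
    then have "?F k = {k}" using \<pi>t \<pi>h th p(5) by auto
    then show ?thesis unfolding Q_def by (intro exI[of _ "\<lambda>_. 1"] exI[of _ "x k"]) simp
  next
    case False
    have "k \<in> ?F k" using \<pi>p[OF k] k p(5) by auto
    then have "?F k \<noteq> {}" "finite (?F k)" using fin by auto
    from unit_direction[OF this(2,1), of x] show ?thesis using False unfolding Q_def by simp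
  qed
  then obtain U z where "\<And>k. k \<in> set p \<Longrightarrow> Q k (U k) (z k)" by metis
  then have Uz: "(\<Sum>i\<in>?F k. (U k i)\<^sup>2) = 1 \<and> (\<forall>i\<in>?F k. x i = z k * U k i) \<and>
      (z k)\<^sup>2 = (\<Sum>i\<in>?F k. (x i)\<^sup>2) \<and> (k \<in> {t, h} \<longrightarrow> z k = x k \<and> U k k = 1)" if "k \<in> set p" for k
    using that unfolding Q_def by blast
  define u where "u = (\<lambda>i. U (\<pi> i) i)"
  have unit: "(\<Sum>i\<in>?F k. (u i)\<^sup>2) = 1" if "k \<in> set p" for k
  proof -
    have "(\<Sum>i\<in>?F k. (u i)\<^sup>2) = (\<Sum>i\<in>?F k. (U k i)\<^sup>2)" by (intro sum.cong) (auto simp: u_def)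
    then show ?thesis using Uz[OF that] by simp
  qed
  have xu: "x i = z (\<pi> i) * u i" if "i \<in> ?W" for i using Uz[OF \<pi>_in, of i] that by (auto simp: u_def)
  have uth: "u t = 1" "u h = 1" using Uz th \<pi>t[of t] \<pi>h[of h] by (auto simp: u_def)
  have zth: "z t = x t" "z h = x h" using Uz th by auto
  have sub: "\<pi> ` ?W \<subseteq> set p" using \<pi>_in by auto
  have "(\<Sum>a\<in>set p - {t, h}. (z a)\<^sup>2) = (\<Sum>k\<in>set p - {t, h}. \<Sum>i\<in>{i\<in>?W - {t, h}. \<pi> i = k}. (x i)\<^sup>2)"
  proof (intro sum.cong refl)
    fix k assume "k \<in> set p - {t, h}"
    moreover from this have "{i\<in>?W - {t, h}. \<pi> i = k} = ?F k" using \<pi>t \<pi>h by auto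
    ultimately show "(z k)\<^sup>2 = (\<Sum>i\<in>{i\<in>?W - {t, h}. \<pi> i = k}. (x i)\<^sup>2)" using Uz by auto
  qed
  also have "\<dots> = (\<Sum>a\<in>?W - {t, h}. (x a)\<^sup>2)"
    using fin \<pi>_in \<pi>t \<pi>h by (intro sum_group_fibres[symmetric]) auto
  finally have trace: "(\<Sum>a\<in>set p - {t, h}. (z a)\<^sup>2) = (\<Sum>a\<in>?W - {t, h}. (x a)\<^sup>2)" .
  have "\<exists>A. psd_on ?W A \<and> A t h = M t h \<and>
        (\<forall>(a, b)\<in>specified C. A a b = x a * x b + (if a = b then \<epsilon> else 0))"
    if \<epsilon>: "0 \<le> \<epsilon>" and M: "psd_on (set p) M"
      and Mz: "\<forall>(a, b)\<in>specified (path_graph p). M a b = z a * z b + (if a = b then \<epsilon> else 0)" for M \<epsilon>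
  proof -
    define A where "A = (\<lambda>i j. u i * u j * M (\<pi> i) (\<pi> j) +
      \<epsilon> * ((if i = j then 1 else 0) + - 1 * (u i * u j * (if \<pi> i = \<pi> j then 1 else 0))))"
    have "psd_on ?W A"
      unfolding A_def using \<epsilon> fin sub unit
      by (intro psd_on_add psd_on_scale psd_on_pullback[OF M] psd_on_fibre_projection[where P = "set p"]) auto
    moreover have "A t h = M t h"
      using uth \<pi>t[of t] \<pi>h[of h] \<open>t \<noteq> h\<close> by (simp add: A_def)
    moreover have "A a b = x a * x b + (if a = b then \<epsilon> else 0)" if ab: "(a, b) \<in> specified C" for a b
    proof -
      have W: "a \<in> ?W" "b \<in> ?W" using ab pair_graph_vertsD[OF G] by (auto simp: specified_def)
      \<comment> \<open>An arc of \<open>C\<close> maps to an arc of the path or collapses inside a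
        layer, so only entries of \<open>M\<close> that are known are read.\<close>
      have sp: "(\<pi> a, \<pi> b) \<in> specified (path_graph p)"
        using ab \<pi>_arc[of a b] \<pi>_in by (auto simp: specified_def)
      then have M: "M (\<pi> a) (\<pi> b) = z (\<pi> a) * z (\<pi> b) + (if \<pi> a = \<pi> b then \<epsilon> else 0)" using Mz by blast
      \<comment> \<open>Inside a layer the diagonal \<epsilon> of \<open>M\<close> contributes
        \<open>\<epsilon> * u a * u b\<close>, which the projection term cancels; only \<epsilon> at
        \<open>a = b\<close> remains.\<close>
      show ?thesis unfolding A_def M xu[OF W(1)] xu[OF W(2)] by (auto simp: algebra_simps)
    qed
    ultimately show ?thesis by blast
  qed
  then show ?thesis using zth trace by (intro exI[of _ z]) blast
qed


section \<open>Glued graphs\<close>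

lemma pair_graph_specified_verts:
  "pair_graph G \<Longrightarrow> (a, b) \<in> specified G \<Longrightarrow> a \<in> pverts G \<and> b \<in> pverts G"
  using pair_graph_vertsD by (fastforce simp: specified_def)

lemma pair_graph_specified_sym:
  "pair_graph G \<Longrightarrow> (a, b) \<in> specified G \<Longrightarrow> (b, a) \<in> specified G"
  using pair_graph_symD by (fastforce simp: specified_def)

lemma is_cliqueI:
  assumes "K \<noteq> {}" "K \<subseteq> pverts G" "\<And>u v. u \<in> K \<Longrightarrow> v \<in> K \<Longrightarrow> u \<noteq> v \<Longrightarrow> (u, v) \<in> parcs G"
  shows "is_clique G K"
  using assms by (simp add: is_clique_def)

lemma is_cliqueD:
  assumes "is_clique G K"
  shows "K \<noteq> {}" "K \<subseteq> pverts G" "\<And>u v. u \<in> K \<Longrightarrow> v \<in> K \<Longrightarrow> u \<noteq> v \<Longrightarrow> (u, v) \<in> parcs G"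
  using assms by (auto simp: is_clique_def)

lemma is_clique_subset: "is_clique G K \<Longrightarrow> K' \<subseteq> K \<Longrightarrow> K' \<noteq> {} \<Longrightarrow> is_clique G K'"
  by (rule is_cliqueI) (auto dest: is_cliqueD subsetD)

lemma is_clique_piece_verts:
  "is_clique (glue_piece D C T H e) K \<Longrightarrow> K \<subseteq> (\<lambda>a. glue_class D T H (Inr (e, a))) ` pverts (C e)"
  unfolding is_clique_def glue_piece_def by simp

text \<open>The classes depend on \<open>D\<close>, \<open>T\<close> and \<open>H\<close>, not on
  the pieces. Instantiating the locale with the \<open>C e\<close> and with the path graphs
  therefore yields vertices of the same kind, and the second glued graph is a subgraph of the first
  without any embedding.\<close>

locale gluing =
  fixes D :: "('v, 'e) pre_digraph" and C :: "'e \<Rightarrow> 'c pair_pre_digraph" and T H :: "'e \<Rightarrow> 'c"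
  assumes multidigraph: "multidigraph D"
    and pieces: "\<And>e. e \<in> arcs D \<Longrightarrow> pair_graph (C e) \<and> T e \<in> pverts (C e) \<and> H e \<in> pverts (C e) \<and> T e \<noteq> H e"
begin

abbreviation vtx :: "'v \<Rightarrow> ('v + 'e \<times> 'c) set" where "vtx v \<equiv> glue_class D T H (Inl v)"
abbreviation emb :: "'e \<Rightarrow> 'c \<Rightarrow> ('v + 'e \<times> 'c) set" where "emb e a \<equiv> glue_class D T H (Inr (e, a))"
abbreviation "B \<equiv> vtx ` verts D"

lemma finite_D: "finite (verts D)" "finite (arcs D)"
  and ends_in_verts: "e \<in> arcs D \<Longrightarrow> tail D e \<in> verts D" "e \<in> arcs D \<Longrightarrow> head D e \<in> verts D"
  and ends_neq: "e \<in> arcs D \<Longrightarrow> tail D e \<noteq> head D e"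
proof -
  interpret D: fin_digraph D using multidigraph by (simp add: multidigraph_def)
  interpret D: loopfree_digraph D using multidigraph by (simp add: multidigraph_def)
  show "finite (verts D)" "finite (arcs D)"
    "e \<in> arcs D \<Longrightarrow> tail D e \<in> verts D" "e \<in> arcs D \<Longrightarrow> head D e \<in> verts D" "e \<in> arcs D \<Longrightarrow> tail D e \<noteq> head D e"
    by (auto simp: D.no_loops)
qed

lemma class_eq_iff: "glue_class D T H x = glue_class D T H y \<longleftrightarrow> glue_rep D T H x = glue_rep D T H y"
  using pieces by (intro glue_class_eq_iff) auto

lemma emb_ends: "e \<in> arcs D \<Longrightarrow> emb e (T e) = vtx (tail D e)" "e \<in> arcs D \<Longrightarrow> emb e (H e) = vtx (head D e)"
  using pieces[of e] by (auto simp: class_eq_iff glue_rep_def)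

lemma vtx_eq_iff: "vtx v = vtx w \<longleftrightarrow> v = w"
  by (simp add: class_eq_iff glue_rep_def)

lemma emb_eq_iff:
  assumes "e \<in> arcs D"
  shows "emb e a = emb e b \<longleftrightarrow> a = b"
  using assms pieces[OF assms] ends_neq[OF assms] by (auto simp: class_eq_iff glue_rep_def)

lemma emb_eqD:
  assumes "e \<in> arcs D" "f \<in> arcs D" "emb e a = emb f b" "e \<noteq> f"
  shows "a \<in> {T e, H e}" "b \<in> {T f, H f}"
  using assms by (auto simp: class_eq_iff glue_rep_def split: if_splits)

lemma emb_in_B_iff:
  assumes "e \<in> arcs D"
  shows "emb e a \<in> B \<longleftrightarrow> a \<in> {T e, H e}"
  using assms ends_in_verts[OF assms] emb_ends[OF assms]
  by (auto simp: class_eq_iff glue_rep_def split: if_splits)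

lemma glue_verts: "pverts (glue D C T H) = B \<union> (\<Union>e\<in>arcs D. emb e ` pverts (C e))"
  unfolding glue_def by force

lemma glue_arc_iff:
  "(x, y) \<in> parcs (glue D C T H) \<longleftrightarrow>
     (\<exists>e\<in>arcs D. \<exists>a b. (a, b) \<in> parcs (C e) \<and> x = emb e a \<and> y = emb e b)"
  unfolding glue_def glue_piece_def by force

lemma glue_specified_cases:
  assumes "(x, y) \<in> specified (glue D C T H)"
  obtains v where "v \<in> verts D" "x = vtx v" "y = vtx v"
  | e a b where "e \<in> arcs D" "(a, b) \<in> specified (C e)" "x = emb e a" "y = emb e b"
  using assms unfolding specified_def glue_verts by (fastforce simp: glue_arc_iff)

lemma glue_specified_emb:
  "e \<in> arcs D \<Longrightarrow> (a, b) \<in> specified (C e) \<Longrightarrow> (emb e a, emb e b) \<in> specified (glue D C T H)"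
  unfolding specified_def glue_verts by (auto simp: glue_arc_iff)

text \<open>Different pieces meet only at end points, so \<open>B\<close> and the interiors of the
  pieces partition the vertices. This lets traces be compared piece by piece.\<close>

lemma sum_glue_verts:
  fixes f :: "('v + 'e \<times> 'c) set \<Rightarrow> real"
  shows "(\<Sum>u\<in>pverts (glue D C T H). f u) =
    (\<Sum>v\<in>verts D. f (vtx v)) + (\<Sum>e\<in>arcs D. \<Sum>a\<in>pverts (C e) - {T e, H e}. f (emb e a))"
proof -
  let ?I = "\<lambda>e. emb e ` (pverts (C e) - {T e, H e})"
  have fin: "finite (pverts (C e))" if "e \<in> arcs D" for e using pair_graph_finite pieces that by blast
  have "pverts (glue D C T H) = B \<union> (\<Union>e\<in>arcs D. ?I e)"
  proof -
    have "emb e a \<in> B \<union> (\<Union>e\<in>arcs D. ?I e)" if "e \<in> arcs D" "a \<in> pverts (C e)" for e a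
      using emb_in_B_iff[OF that(1), of a] that by (cases "a \<in> {T e, H e}") auto
    then show ?thesis unfolding glue_verts by blast
  qed
  moreover have "B \<inter> (\<Union>e\<in>arcs D. ?I e) = {}" using emb_in_B_iff by fastforce
  ultimately have "(\<Sum>u\<in>pverts (glue D C T H). f u) = (\<Sum>u\<in>B. f u) + (\<Sum>u\<in>(\<Union>e\<in>arcs D. ?I e). f u)"
    using finite_D fin by (simp add: sum.union_disjoint)
  also have "(\<Sum>u\<in>B. f u) = (\<Sum>v\<in>verts D. f (vtx v))"
    by (subst sum.reindex) (auto simp: inj_on_def vtx_eq_iff)
  also have "(\<Sum>u\<in>(\<Union>e\<in>arcs D. ?I e). f u) = (\<Sum>e\<in>arcs D. \<Sum>u\<in>?I e. f u)"
  proof (rule sum.UNION_disjoint)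
    show "\<forall>e\<in>arcs D. \<forall>f\<in>arcs D. e \<noteq> f \<longrightarrow> ?I e \<inter> ?I f = {}" using emb_eqD by fastforce
  qed (use finite_D fin in auto)
  also have "\<dots> = (\<Sum>e\<in>arcs D. \<Sum>a\<in>pverts (C e) - {T e, H e}. f (emb e a))"
    by (intro sum.cong refl, subst sum.reindex) (auto simp: inj_on_def emb_eq_iff)
  finally show ?thesis .
qed

lemma glue_piece_cliqueE:
  assumes "e \<in> arcs D" "is_clique (glue_piece D C T H e) K"
  obtains K' where "is_clique (C e) K'" "K = emb e ` K'"
proof
  let ?K' = "{a \<in> pverts (C e). emb e a \<in> K}"
  show K: "K = emb e ` ?K'" using assms(2) unfolding is_clique_def glue_piece_def by auto
  show "is_clique (C e) ?K'"
    unfolding is_clique_def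
  proof (intro conjI ballI impI)
    show "?K' \<noteq> {}" using K assms(2) by (auto simp: is_clique_def)
    fix a b assume ab: "a \<in> ?K'" "b \<in> ?K'" "a \<noteq> b"
    then have "emb e a \<noteq> emb e b" using emb_eq_iff[OF assms(1)] by simp
    then have "(emb e a, emb e b) \<in> parcs (glue_piece D C T H e)"
      using assms(2) ab unfolding is_clique_def by blast
    then show "(a, b) \<in> parcs (C e)" using emb_eq_iff[OF assms(1)] by (auto simp: glue_piece_def)
  qed auto
qed

lemma clique_emb:
  assumes "e \<in> arcs D" "is_clique (C e) K"
  shows "is_clique (glue D C T H) (emb e ` K)"
proof (rule is_cliqueI)
  show "emb e ` K \<noteq> {}" using is_cliqueD(1)[OF assms(2)] by simp
  show "emb e ` K \<subseteq> pverts (glue D C T H)"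
    using is_cliqueD(2)[OF assms(2)] assms(1) unfolding glue_verts by blast
  fix u v assume "u \<in> emb e ` K" "v \<in> emb e ` K" "u \<noteq> v"
  then obtain a b where "a \<in> K" "b \<in> K" "a \<noteq> b" "u = emb e a" "v = emb e b" by blast
  then show "(u, v) \<in> parcs (glue D C T H)"
    using is_cliqueD(3)[OF assms(2)] assms(1) unfolding glue_arc_iff by blast
qed

end

section \<open>The thickening and its subgraph of glued paths\<close>

locale path_replacement =
  fixes D :: "('v, 'e) pre_digraph" and C :: "'e \<Rightarrow> 'c pair_pre_digraph" and T H :: "'e \<Rightarrow> 'c"
    and p :: "'e \<Rightarrow> 'c list"
  assumes multidigraph: "multidigraph D" and thickening: "thickening D C T H"
    and shortest: "\<And>e. e \<in> arcs D \<Longrightarrow> shortest_path (C e) (T e) (H e) (p e)"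
begin

lemma gluing_data: "gluing_data D C T H" and chordal_piece: "e \<in> arcs D \<Longrightarrow> chordal (C e)"
  using thickening by (auto simp: thickening_def)

lemma pair_graph_piece: "e \<in> arcs D \<Longrightarrow> pair_graph (C e)"
  using gluing_data by (auto simp: gluing_data_def connected_graph_def)

sublocale gluing D C T H
  using multidigraph gluing_data pair_graph_piece by unfold_locales (auto simp: gluing_data_def)

lemma p_facts:
  assumes "e \<in> arcs D"
  shows "distinct (p e)" "T e \<in> set (p e)" "H e \<in> set (p e)" "set (p e) \<subseteq> pverts (C e)"
proof -
  have "path_between (C e) (T e) (H e) (p e)" using shortest[OF assms] by (simp add: shortest_path_def)
  note p = path_betweenD[OF this]
  show "distinct (p e)" "set (p e) \<subseteq> pverts (C e)" by fact+
  show "T e \<in> set (p e)" "H e \<in> set (p e)" using p(1,3,4) nth_mem[of 0 "p e"] nth_mem[of "length (p e) - 1" "p e"] by auto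
qed

lemma path_arc_in_piece:
  assumes "e \<in> arcs D" "(a, b) \<in> parcs (path_graph (p e))"
  shows "(a, b) \<in> parcs (C e)"
proof -
  have "path_between (C e) (T e) (H e) (p e)" using shortest[OF assms(1)] by (simp add: shortest_path_def)
  note p = path_betweenD(6)[OF this]
  then show ?thesis using assms(2) pair_graph_symD[OF pair_graph_piece[OF assms(1)]]
    unfolding path_graph_arc_iff by blast
qed

lemma path_specified_in_piece:
  "e \<in> arcs D \<Longrightarrow> (a, b) \<in> specified (path_graph (p e)) \<Longrightarrow> (a, b) \<in> specified (C e)"
  using path_arc_in_piece p_facts(4) by (fastforce simp: specified_def)

sublocale L: gluing D "\<lambda>e. path_graph (p e)" T H
proof
  show "multidigraph D" by (rule multidigraph)
  show "pair_graph (path_graph (p e)) \<and> T e \<in> pverts (path_graph (p e)) \<and> H e \<in> pverts (path_graph (p e)) \<and> T e \<noteq> H e"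
    if "e \<in> arcs D" for e
    using p_facts[OF that] pieces[OF that] pair_graph_path_graph by simp
qed

abbreviation "G \<equiv> glue D C T H"
abbreviation "L \<equiv> glue D (\<lambda>e. path_graph (p e)) T H"

lemma pair_graph_G: "pair_graph G"
  by (rule pair_graph_glue[OF multidigraph gluing_data])

lemma L_subset_G: "pverts L \<subseteq> pverts G" "parcs L \<subseteq> parcs G"
proof -
  have "emb e a \<in> pverts G" if "e \<in> arcs D" "a \<in> set (p e)" for e a
    using p_facts(4)[OF that(1)] that unfolding glue_verts by blast
  then show "pverts L \<subseteq> pverts G" unfolding L.glue_verts path_graph_verts unfolding glue_verts by blast
  show "parcs L \<subseteq> parcs G"
  proof clarify
    fix x y assume "(x, y) \<in> parcs L"
    then show "(x, y) \<in> parcs G"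
      using path_arc_in_piece unfolding L.glue_arc_iff glue_arc_iff by blast
  qed
qed

lemma pair_graph_L: "pair_graph L"
proof
  show "finite (pverts L)" using L_subset_G pair_graph_finite[OF pair_graph_G] finite_subset by blast
  have "parcs L \<subseteq> pverts G \<times> pverts G" using L_subset_G pair_graph_vertsD[OF pair_graph_G] by auto
  then show "finite (parcs L)" using pair_graph_finite[OF pair_graph_G] finite_subset finite_cartesian_product by metis
  show "symmetric (with_proj L)"
    unfolding symmetric_def with_proj_simps
  proof (rule symI)
    fix x y assume "(x, y) \<in> parcs L"
    then obtain e a b where "e \<in> arcs D" "(a, b) \<in> parcs (path_graph (p e))" "x = emb e a" "y = emb e b"
      unfolding L.glue_arc_iff by blast
    moreover from this have "(b, a) \<in> parcs (path_graph (p e))"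
      using pair_graph_symD[of "path_graph (p e)" a b] L.pieces[of e] by simp
    ultimately show "(y, x) \<in> parcs L" unfolding L.glue_arc_iff by blast
  qed
  fix z assume z: "z \<in> parcs L"
  obtain x y where xy: "z = (x, y)" by (cases z)
  obtain e a b where e: "e \<in> arcs D" "(a, b) \<in> parcs (path_graph (p e))" "x = emb e a" "y = emb e b"
    using z unfolding xy L.glue_arc_iff by blast
  then have "a \<in> set (p e)" "b \<in> set (p e)"
    using pair_graph_vertsD[of "path_graph (p e)" a b] L.pieces[of e] by auto
  then show "fst z \<in> pverts L" "snd z \<in> pverts L" using e unfolding xy L.glue_verts by auto
  show "fst z \<noteq> snd z" using z L_subset_G pair_graph_vertsD[OF pair_graph_G] unfolding xy by auto
qed

lemma emb_in_L:
  assumes e: "e \<in> arcs D" and "emb e a \<in> pverts L"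
  shows "a \<in> set (p e)"
proof (cases "a \<in> {T e, H e}")
  case True
  then show ?thesis using p_facts[OF e] by auto
next
  case False
  then have "emb e a \<notin> B" using emb_in_B_iff[OF e] by blast
  then obtain f b where "f \<in> arcs D" "b \<in> set (p f)" "emb e a = emb f b"
    using assms(2) unfolding L.glue_verts by auto
  then show ?thesis using emb_eqD(1)[OF e] emb_eq_iff[OF e] False by metis
qed

lemma L_induced: "u \<in> pverts L \<Longrightarrow> w \<in> pverts L \<Longrightarrow> (u, w) \<in> parcs G \<Longrightarrow> (u, w) \<in> parcs L"
proof -
  assume uw: "u \<in> pverts L" "w \<in> pverts L" "(u, w) \<in> parcs G"
  then obtain e a b where e: "e \<in> arcs D" "(a, b) \<in> parcs (C e)" "u = emb e a" "w = emb e b"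
    unfolding glue_arc_iff by blast
  then have "a \<in> set (p e)" "b \<in> set (p e)" using uw emb_in_L by auto
  then show ?thesis
    using e shortest_path_induced[OF pair_graph_piece shortest] unfolding L.glue_arc_iff by blast
qed

lemma triangle_in_piece:
  assumes "is_clique G {u, v, w}" "u \<noteq> v" "v \<noteq> w" "u \<noteq> w"
  obtains e where "e \<in> arcs D" "is_clique (glue_piece D C T H e) {u, v, w}"
proof -
  have "card {u, v, w} = 3" using assms(2-4) by simp
  then show ?thesis using assms(1) thickening that unfolding thickening_def by blast
qed

text \<open>The triangle would be one of \<open>G\<close>, hence by the thickening condition one of
  a single piece, with all vertices on the shortest path of that piece. Such a path spans no
  triangle, even with all arcs of \<open>C e\<close>.\<close>

lemma L_triangle_free:
  assumes "is_clique L {u, v, w}" "u \<noteq> v" "v \<noteq> w" "u \<noteq> w"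
  shows False
proof -
  have "is_clique G {u, v, w}"
  proof (rule is_cliqueI)
    show "{u, v, w} \<subseteq> pverts G" using is_cliqueD(2)[OF assms(1)] L_subset_G(1) by blast
    show "(x, y) \<in> parcs G" if "x \<in> {u, v, w}" "y \<in> {u, v, w}" "x \<noteq> y" for x y
      using is_cliqueD(3)[OF assms(1) that] L_subset_G(2) by blast
  qed simp
  then obtain e where e: "e \<in> arcs D" "is_clique (glue_piece D C T H e) {u, v, w}"
    using assms(2-4) by (rule triangle_in_piece)
  obtain K' where K': "is_clique (C e) K'" "{u, v, w} = emb e ` K'"
    using e by (rule glue_piece_cliqueE)
  have "u \<in> emb e ` K'" "v \<in> emb e ` K'" "w \<in> emb e ` K'" using K'(2) by auto
  then obtain a b c where abc: "a \<in> K'" "b \<in> K'" "c \<in> K'" "u = emb e a" "v = emb e b" "w = emb e c"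
    by blast
  then have "a \<noteq> b" "b \<noteq> c" "a \<noteq> c" using assms(2-4) by auto
  then have arcs: "(a, b) \<in> parcs (C e)" "(b, c) \<in> parcs (C e)" "(a, c) \<in> parcs (C e)"
    using is_cliqueD(3)[OF K'(1)] abc by auto
  have "{u, v, w} \<subseteq> pverts L" using is_cliqueD(2)[OF assms(1)] .
  then have "a \<in> set (p e)" "b \<in> set (p e)" "c \<in> set (p e)" using emb_in_L[OF e(1)] abc by auto
  then show False
    using shortest_path_no_triangle[OF pair_graph_piece[OF e(1)] shortest[OF e(1)]] arcs by blast
qed

lemma L_clique_cases:
  assumes "is_clique L K"
  obtains u where "K = {u}" "u \<in> pverts L" | u w where "K = {u, w}" "(u, w) \<in> parcs L"
proof -
  obtain u where u: "u \<in> K" using is_cliqueD(1)[OF assms] by blast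
  show ?thesis
  proof (cases "K = {u}")
    case True
    then show ?thesis using that(1) is_cliqueD(2)[OF assms] by blast
  next
    case False
    then obtain w where w: "w \<in> K" "w \<noteq> u" using u by blast
    have "K = {u, w}"
    proof (rule ccontr)
      assume "K \<noteq> {u, w}"
      then obtain v where v: "v \<in> K" "v \<noteq> u" "v \<noteq> w" using u w by blast
      have "is_clique L {u, v, w}" by (rule is_clique_subset[OF assms]) (use u v w in auto)
      then show False using L_triangle_free v w by blast
    qed
    then show ?thesis using that(2) is_cliqueD(3)[OF assms u w(1)] w by blast
  qed
qed

text \<open>All arcs at an interior vertex come from its own piece, so the clique lies in that piece
  as a vertex set. For two further members, say the ends, the joining arc might come from a parallel
  piece only; but the triangle with the interior vertex lies in some piece, which must be
  \<open>C e\<close>.\<close>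

lemma interior_clique:
  assumes K: "is_clique G K" and e: "e \<in> arcs D" and a: "a \<in> pverts (C e)" "a \<notin> {T e, H e}" "emb e a \<in> K"
  shows "is_clique (glue_piece D C T H e) K"
proof -
  let ?P = "glue_piece D C T H e"
  have nbr: "(emb e a, w) \<in> parcs ?P \<and> (w, emb e a) \<in> parcs ?P \<and> w \<in> pverts ?P"
    if w: "w \<in> K" "w \<noteq> emb e a" for w
  proof -
    have "(emb e a, w) \<in> parcs G" using is_cliqueD(3)[OF K a(3)] w by blast
    then obtain f b c where f: "f \<in> arcs D" "(b, c) \<in> parcs (C f)" "emb e a = emb f b" "w = emb f c"
      unfolding glue_arc_iff by blast
    then have "f = e" using emb_eqD(1)[OF e] a(2) by metis
    then have "(b, c) \<in> parcs (C e)" "w = emb e c" "emb e a = emb e b" using f by auto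
    then show ?thesis
      using pair_graph_symD[OF pair_graph_piece[OF e]] pair_graph_vertsD[OF pair_graph_piece[OF e]]
      unfolding glue_piece_def by force
  qed
  have av: "emb e a \<in> pverts ?P" using a(1) by (auto simp: glue_piece_def)
  show ?thesis
    unfolding is_clique_def
  proof (intro conjI ballI impI)
    show "K \<noteq> {}" using a(3) by blast
    show "K \<subseteq> pverts ?P" using nbr av by blast
    fix u w assume uw: "u \<in> K" "w \<in> K" "u \<noteq> w"
    show "(u, w) \<in> parcs ?P"
    proof (cases "u = emb e a \<or> w = emb e a")
      case True
      then show ?thesis using nbr uw by blast
    next
      case False
      have "is_clique G {emb e a, u, w}" by (rule is_clique_subset[OF K]) (use uw a(3) in auto)
      then obtain f where f: "f \<in> arcs D" "is_clique (glue_piece D C T H f) {emb e a, u, w}"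
        by (rule triangle_in_piece) (use False uw in auto)
      have "emb e a \<in> emb f ` pverts (C f)" using is_clique_piece_verts[OF f(2)] by blast
      then have "f = e" using emb_eqD(1)[OF e f(1)] a(2) by blast
      then show ?thesis using is_cliqueD(3)[OF f(2), of u w] uw by simp
    qed
  qed
qed

text \<open>By the zero normal form \<open>X\<close> is its own extension to \<open>G\<close>. A
  clique of \<open>G\<close> meets \<open>L\<close> in a clique of \<open>L\<close> or not at all,
  because \<open>L\<close> is induced, and the rest of its block is zero.\<close>

lemma additive_distance_L_le_G:
  assumes ne: "pverts L \<noteq> {}"
  shows "additive_distance L \<le> additive_distance G"
proof -
  have neG: "pverts G \<noteq> {}" using ne L_subset_G by blast
  have finG: "finite (pverts G)" using pair_graph_finite[OF pair_graph_G] .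
  have spLG: "specified L \<subseteq> specified G" using L_subset_G by (auto simp: specified_def)
  have spLv: "u \<in> pverts L \<and> w \<in> pverts L" if "(u, w) \<in> specified L" for u w
    using pair_graph_specified_verts[OF pair_graph_L that] .
  have "shifted L X (additive_distance G) \<in> psd_completable L" if X: "X \<in> clique_psd_normalized L" for X
  proof -
    have XL: "X \<in> clique_psd L" and tr: "pm_trace L X = 1" using X by (auto simp: clique_psd_normalized_def)
    have zero: "X u w = 0" if "(u, w) \<notin> specified L" for u w
      using XL that by (auto simp: clique_psd_def partial_matrices_def)
    have sym: "X u w = X w u" for u w
      by (rule partial_matrices_sym[OF pair_graph_L clique_psd_partial[OF XL]])
    have "psd_on K X" if K: "is_clique G K" for K
    proof -
      let ?K = "K \<inter> pverts L"
      have finK: "finite K" using K finG finite_subset unfolding is_clique_def by blast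
      have psd: "psd_on ?K X"
      proof (cases "?K = {}")
        case True
        then show ?thesis by (simp add: psd_on_def)
      next
        case False
        then have "is_clique L ?K" using K L_induced unfolding is_clique_def by auto
        then show ?thesis using XL unfolding clique_psd_def by blast
      qed
      show ?thesis
      proof (rule psd_onI)
        fix x
        have z: "X u w = 0" if "u \<notin> ?K \<or> w \<notin> ?K" "u \<in> K" "w \<in> K" for u w
          using that spLv zero by blast
        have "qform K X x = (\<Sum>u\<in>K. \<Sum>w\<in>?K. x u * X u w * x w)"
          unfolding qform_def using finK z by (intro sum.cong refl sum.mono_neutral_right) auto
        also have "\<dots> = qform ?K X x"
          unfolding qform_def using finK z by (intro sum.mono_neutral_right) auto
        finally show "0 \<le> qform K X x" using psd_on_qform[OF psd] by simp
      qed (rule sym)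
    qed
    then have XG: "X \<in> clique_psd G"
    proof -
      have "X u w = 0" if "(u, w) \<notin> specified G" for u w using zero that spLG by blast
      then show ?thesis using sym \<open>\<And>K. is_clique G K \<Longrightarrow> psd_on K X\<close>
        by (auto simp: clique_psd_def partial_matrices_def)
    qed
    have "\<forall>u\<in>pverts G - pverts L. X u u = 0" using zero spLv by blast
    then have "pm_trace G X = pm_trace L X"
      unfolding pm_trace_def using finG L_subset_G(1) by (intro sum.mono_neutral_right)
    then have "X \<in> clique_psd_normalized G" using XG tr by (simp add: clique_psd_normalized_def)
    then have "shifted G X (additive_distance G) \<in> psd_completable G"
      using additive_distance_le_iff[OF pair_graph_G neG, of "additive_distance G"] by blast
    then obtain A where A: "psd_on (pverts G) A"
      "\<And>u w. (u, w) \<in> specified G \<Longrightarrow> A u w = shifted G X (additive_distance G) u w"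
      using psd_completableE by blast
    show ?thesis
    proof (rule psd_completableI)
      show "psd_on (pverts L) A" by (rule psd_on_subset[OF A(1) finG L_subset_G(1)])
      show "A u w = shifted L X (additive_distance G) u w" if "(u, w) \<in> specified L" for u w
        using A(2)[OF subsetD[OF spLG that]] shifted_specified[OF pair_graph_L that]
          shifted_specified[OF pair_graph_G subsetD[OF spLG that]] by simp
    qed (rule shifted_partial_matrices[OF clique_psd_partial[OF XL]])
  qed
  then show ?thesis using additive_distance_le_iff[OF pair_graph_L ne] by blast
qed

end


section \<open>Replacing the pieces by paths\<close>

context path_replacement
begin

definition rank_one_on :: "'e \<Rightarrow> (('v + 'e \<times> 'c) set \<Rightarrow> ('v + 'e \<times> 'c) set \<Rightarrow> real) \<Rightarrow> bool" where
  "rank_one_on e X \<longleftrightarrow> (\<exists>x. \<forall>a b. (a, b) \<in> specified (C e) \<longrightarrow> X (emb e a) (emb e b) = x a * x b)"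

abbreviation nonadjacent :: "'e \<Rightarrow> bool" where
  "nonadjacent e \<equiv> (T e, H e) \<notin> parcs (C e)"

lemma adjacent_path:
  assumes e: "e \<in> arcs D" and "\<not> nonadjacent e"
  shows "set (p e) = {T e, H e}"
proof -
  have TH: "T e \<noteq> H e" using pieces[OF e] by blast
  have pb: "path_between (C e) (T e) (H e) (p e)" using shortest[OF e] by (simp add: shortest_path_def)
  note p = path_betweenD[OF pb]
  have "path_between (C e) (T e) (H e) [T e, H e]"
    using assms pieces[OF e] TH by (auto simp: path_between_def intro!: vpathI vwalkI)
  then have "length (p e) \<le> 2" using shortest[OF e] by (auto simp: shortest_path_def)
  then have "card (set (p e)) \<le> 2" using card_length[of "p e"] by linarith
  moreover have "{T e, H e} \<subseteq> set (p e)" using p_facts[OF e] by blast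
  ultimately show ?thesis using TH card_seteq[of "set (p e)" "{T e, H e}"] by simp
qed

lemma clique_psd_piece_completion:
  assumes e: "e \<in> arcs D" and X: "X \<in> clique_psd G"
  shows "\<exists>A. psd_on (pverts (C e)) A \<and> (\<forall>a b. (a, b) \<in> specified (C e) \<longrightarrow> A a b = X (emb e a) (emb e b))"
proof -
  have "psd_on K (\<lambda>a b. X (emb e a) (emb e b))" if K: "is_clique (C e) K" for K
  proof -
    have fin: "finite K" using is_cliqueD(2)[OF K] pair_graph_finite[OF pair_graph_piece[OF e]] finite_subset by blast
    have "psd_on (emb e ` K) X" using X clique_emb[OF e K] by (simp add: clique_psd_def)
    then show ?thesis using fin by (intro psd_on_compose[of "emb e ` K" X K "emb e"]) auto
  qed
  from chordal_psd_completion[OF pair_graph_piece[OF e] chordal_piece[OF e] this] show ?thesis by fast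
qed

text \<open>\<open>X\<close> does not prescribe the entry at two nonadjacent vertices of
  \<open>D\<close>, so completions chosen independently on parallel pieces could disagree. All
  vertices of \<open>D\<close> lie in \<open>L\<close>; a single completion \<open>M\<close> on
  \<open>L\<close> settles these entries, and every piece is completed so as to follow
  \<open>M\<close> at its ends.\<close>

lemma completion_of_rank_one_pieces:
  assumes X: "X \<in> clique_psd G"
    and rank1: "\<And>e. e \<in> arcs D \<Longrightarrow> nonadjacent e \<Longrightarrow> rank_one_on e X"
    and uv: "u0 \<in> pverts L" "v0 \<in> pverts L" "u0 \<noteq> v0"
    and \<epsilon>: "0 \<le> \<epsilon>" "additive_distance L * pm_trace G X \<le> \<epsilon>"
  shows "shifted G X \<epsilon> \<in> psd_completable G"
proof -
  have \<alpha>nn: "0 \<le> additive_distance L" by (rule additive_distance_nonneg[OF pair_graph_L uv])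
  have Xp: "X \<in> partial_matrices G" by (rule clique_psd_partial[OF X])
  have Xsym: "X u w = X w u" for u w by (rule partial_matrices_sym[OF pair_graph_G Xp])
  have Xnn: "0 \<le> X u u" if "u \<in> pverts G" for u by (rule clique_psd_diag_nonneg[OF X that])
  have emb_G: "emb e a \<in> pverts G" if "e \<in> arcs D" "a \<in> pverts (C e)" for e a
    using that unfolding glue_verts by blast
  \<comment> \<open>The quantification over \<open>M\<close> is kept inside: \<open>z\<close> has to
    be fixed before the matrix on \<open>L\<close> can be built, and \<open>M\<close> arises only
    from that matrix.\<close>
  define good where "good e x z \<longleftrightarrow>
    (\<forall>a b. (a, b) \<in> specified (C e) \<longrightarrow> X (emb e a) (emb e b) = x a * x b) \<and>
    z (T e) = x (T e) \<and> z (H e) = x (H e) \<and>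
    (\<Sum>a\<in>set (p e) - {T e, H e}. (z a)\<^sup>2) = (\<Sum>a\<in>pverts (C e) - {T e, H e}. (x a)\<^sup>2) \<and>
    (\<forall>M \<epsilon>. 0 \<le> \<epsilon> \<and> psd_on (set (p e)) M \<and>
        (\<forall>(a, b)\<in>specified (path_graph (p e)). M a b = z a * z b + (if a = b then \<epsilon> else 0)) \<longrightarrow>
      (\<exists>A. psd_on (pverts (C e)) A \<and> A (T e) (H e) = M (T e) (H e) \<and>
        (\<forall>(a, b)\<in>specified (C e). A a b = x a * x b + (if a = b then \<epsilon> else 0))))"
    for e and x z :: "'c \<Rightarrow> real"
  have "\<exists>x z. good e x z" if e: "e \<in> arcs D" "nonadjacent e" for e
  proof -
    obtain x where x: "\<forall>a b. (a, b) \<in> specified (C e) \<longrightarrow> X (emb e a) (emb e b) = x a * x b"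
      using rank1[OF e] by (auto simp: rank_one_on_def)
    have "T e \<noteq> H e" using pieces[OF e(1)] by blast
    note shortest_path_compression[OF pair_graph_piece[OF e(1)] shortest[OF e(1)] this e(2), of x]
    then show ?thesis
      using x unfolding good_def
      by (elim exE) (rule exI[of _ x], rule exI, rule conjI, assumption, assumption)
  qed
  then obtain x z where xz: "\<And>e. e \<in> arcs D \<Longrightarrow> nonadjacent e \<Longrightarrow> good e (x e) (z e)" by metis
  define Z where "Z e a b = (if nonadjacent e then z e a * z e b else X (emb e a) (emb e b))" for e a b
  have Zsym: "Z e a b = Z e b a" for e a b by (simp add: Z_def Xsym mult.commute)
  have TH_spec: "(a, a) \<in> specified (C e)" if "e \<in> arcs D" "a \<in> {T e, H e}" for e a
    using pieces[OF that(1)] that(2) by auto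
  \<comment> \<open>For nonadjacent ends the only specified pairs of ends are diagonal, where the
    squares of \<open>z\<close> and \<open>x\<close> agree; for adjacent ends \<open>Z\<close>
    copies \<open>X\<close>.\<close>
  have Z_ends: "Z e a b = X (emb e a) (emb e b)"
    if e: "e \<in> arcs D" and ab: "a \<in> {T e, H e}" "b \<in> {T e, H e}" "(a, b) \<in> specified (path_graph (p e))" for e a b
  proof (cases "nonadjacent e")
    case True
    have "(H e, T e) \<notin> parcs (C e)" using True pair_graph_symD[OF pair_graph_piece[OF e]] by blast
    moreover have "(a, b) \<in> specified (C e)" by (rule path_specified_in_piece[OF e ab(3)])
    ultimately have "a = b" using True ab(1,2) by (auto simp: specified_def)
    then show ?thesis using xz[OF e True] TH_spec[OF e ab(1)] ab(1) True unfolding good_def Z_def by auto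
  qed (simp add: Z_def)
  \<comment> \<open>A pair inside \<open>B\<close> may be an edge of several parallel paths, all of
    which carry the entry of \<open>X\<close> by \<open>Z_ends\<close>. Any other specified pair
    belongs to one path only, so that \<open>SOME\<close> has just one candidate.\<close>
  define R where "R u w r \<longleftrightarrow> (\<exists>e\<in>arcs D. \<exists>a b. (a, b) \<in> specified (path_graph (p e)) \<and>
      u = emb e a \<and> w = emb e b \<and> r = Z e a b)" for u w r
  define Y where "Y u w = (if (u, w) \<notin> specified L then 0 else if u \<in> B \<and> w \<in> B then X u w
      else (SOME r. R u w r))" for u w
  have Y_emb: "Y (emb e a) (emb e b) = Z e a b"
    if e: "e \<in> arcs D" and ab: "(a, b) \<in> specified (path_graph (p e))" for e a b
  proof -
    have spec: "(emb e a, emb e b) \<in> specified L" by (rule L.glue_specified_emb[OF e ab])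
    show ?thesis
    proof (cases "emb e a \<in> B \<and> emb e b \<in> B")
      case True
      then show ?thesis using spec Z_ends[OF e _ _ ab] emb_in_B_iff[OF e] by (simp add: Y_def)
    next
      case False
      have "R (emb e a) (emb e b) (Z e a b)" using e ab unfolding R_def by blast
      then have "R (emb e a) (emb e b) (SOME r. R (emb e a) (emb e b) r)" by (rule someI)
      then obtain f c d where f: "f \<in> arcs D" "emb e a = emb f c" "emb e b = emb f d"
        "(SOME r. R (emb e a) (emb e b) r) = Z f c d" unfolding R_def by blast
      have "f = e"
      proof (rule ccontr)
        assume "f \<noteq> e"
        then have "a \<in> {T e, H e}" "b \<in> {T e, H e}" using emb_eqD(1)[OF e f(1)] f(2,3) by blast+
        then show False using False emb_in_B_iff[OF e] by blast
      qed
      then have "c = a" "d = b" using f emb_eq_iff[OF e] by auto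
      then show ?thesis using False spec f(4) \<open>f = e\<close> by (auto simp: Y_def)
    qed
  qed
  have Y_vtx: "Y (vtx v) (vtx v) = X (vtx v) (vtx v)" if "v \<in> verts D" for v
    using that unfolding Y_def L.glue_verts by (auto simp: specified_def L.glue_verts)
  have Yp: "Y \<in> partial_matrices L"
  proof -
    have "Y u w = Y w u" if "(u, w) \<in> specified L" for u w
      using that
    proof (cases rule: L.glue_specified_cases)
      case (2 e a b)
      then have "(b, a) \<in> specified (path_graph (p e))"
        using pair_graph_specified_sym[of "path_graph (p e)" a b] L.pieces[OF 2(1)] by blast
      then show ?thesis using 2 Y_emb Zsym by simp
    qed simp
    then show ?thesis by (auto simp: partial_matrices_def Y_def)
  qed
  have Z_diag: "0 \<le> Z e a a" if "e \<in> arcs D" "a \<in> set (p e)" for e a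
    using Xnn[OF emb_G] that p_facts(4)[OF that(1)] by (auto simp: Z_def)
  have Y_diag: "0 \<le> Y u u" if u: "u \<in> pverts L" for u
  proof -
    have "(u, u) \<in> specified L" using u by simp
    then show ?thesis
    proof (cases rule: L.glue_specified_cases)
      case (1 v)
      then show ?thesis using Y_vtx Xnn unfolding glue_verts by simp
    next
      case (2 e a b)
      then have "a = b" using emb_eq_iff by blast
      then show ?thesis using 2 Y_emb[OF 2(1,2)] Z_diag[OF 2(1), of a]
          pair_graph_specified_verts[of "path_graph (p e)" a b] L.pieces[OF 2(1)] by simp
    qed
  qed
  \<comment> \<open>Only single vertices and edges occur. An edge in a piece with nonadjacent ends
    carries a rank one block; otherwise \<open>Y\<close> equals \<open>X\<close> on it, and the edge
    is a clique of \<open>G\<close>.\<close>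
  have "psd_on K Y" if K: "is_clique L K" for K
    using K
  proof (cases rule: L_clique_cases)
    case (1 u)
    have "qform {u} Y t = Y u u * (t u)\<^sup>2" for t by (simp add: qform_def power2_eq_square)
    then show ?thesis using Y_diag 1 by (intro psd_onI) auto
  next
    case (2 u w)
    then obtain e a b where e: "e \<in> arcs D" "(a, b) \<in> parcs (path_graph (p e))" "u = emb e a" "w = emb e b"
      unfolding L.glue_arc_iff by blast
    have pg: "pair_graph (path_graph (p e))" using L.pieces[OF e(1)] by blast
    have ab: "a \<in> set (p e)" "b \<in> set (p e)" "a \<noteq> b" "(b, a) \<in> parcs (path_graph (p e))"
      using pair_graph_vertsD[OF pg e(2)] pair_graph_symD[OF pg e(2)] by auto
    have uw: "u \<noteq> w" using ab e emb_eq_iff by blast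
    have spec: "(c, d) \<in> specified (path_graph (p e))" if "c \<in> {a, b}" "d \<in> {a, b}" for c d
      using that e(2) ab by (auto simp: specified_def)
    show ?thesis
    proof (cases "nonadjacent e")
      case True
      define y where "y v = (if v = u then z e a else z e b)" for v
      have "Y s t = y s * y t" if "s \<in> K" "t \<in> K" for s t
        using that 2(1) e(3,4) uw Y_emb[OF e(1) spec] True by (auto simp: y_def Z_def)
      then show ?thesis using psd_on_cong[of K Y "\<lambda>s t. y s * y t"] psd_on_rank_one by blast
    next
      case False
      have "(u, w) \<in> parcs G" using 2(2) L_subset_G by blast
      then have "is_clique G K"
        using 2(1) pair_graph_vertsD[OF pair_graph_G] pair_graph_symD[OF pair_graph_G]
        by (intro is_cliqueI) auto
      then have "psd_on K X" using X by (simp add: clique_psd_def)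
      moreover have "Y s t = X s t" if "s \<in> K" "t \<in> K" for s t
        using that 2(1) e(3,4) Y_emb[OF e(1) spec] False by (auto simp: Z_def)
      ultimately show ?thesis using psd_on_cong[of K Y X] by blast
    qed
  qed
  then have Y: "Y \<in> clique_psd L" using Yp by (simp add: clique_psd_def)
  \<comment> \<open>Inside pieces with nonadjacent ends the traces agree. A piece with adjacent ends
    has a path without interior, so its interior trace is lost, which is harmless because
    \<open>additive_distance L\<close> is nonnegative.\<close>
  have "pm_trace L Y \<le> pm_trace G X"
  proof -
    have "(\<Sum>a\<in>pverts (path_graph (p e)) - {T e, H e}. Y (emb e a) (emb e a))
        \<le> (\<Sum>a\<in>pverts (C e) - {T e, H e}. X (emb e a) (emb e a))" if e: "e \<in> arcs D" for e
    proof -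
      have "(\<Sum>a\<in>pverts (path_graph (p e)) - {T e, H e}. Y (emb e a) (emb e a))
          = (\<Sum>a\<in>set (p e) - {T e, H e}. Z e a a)"
        using Y_emb[OF e] by (intro sum.cong) auto
      also have "\<dots> \<le> (\<Sum>a\<in>pverts (C e) - {T e, H e}. X (emb e a) (emb e a))"
      proof (cases "nonadjacent e")
        case True
        have "(\<Sum>a\<in>set (p e) - {T e, H e}. Z e a a) = (\<Sum>a\<in>set (p e) - {T e, H e}. (z e a)\<^sup>2)"
          using True by (intro sum.cong) (auto simp: Z_def power2_eq_square)
        also have "\<dots> = (\<Sum>a\<in>pverts (C e) - {T e, H e}. (x e a)\<^sup>2)"
          using xz[OF e True] unfolding good_def by blast
        also have "\<dots> = (\<Sum>a\<in>pverts (C e) - {T e, H e}. X (emb e a) (emb e a))"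
          using xz[OF e True] unfolding good_def
          by (intro sum.cong) (auto simp: power2_eq_square)
        finally show ?thesis by simp
      next
        case False
        then have "set (p e) - {T e, H e} = {}" using adjacent_path[OF e] by simp
        then have "(\<Sum>a\<in>set (p e) - {T e, H e}. Z e a a) = 0" by (simp only: sum.empty)
        then show ?thesis using Xnn emb_G[OF e] by (auto intro!: sum_nonneg)
      qed
      finally show ?thesis .
    qed
    then show ?thesis
      unfolding pm_trace_def sum_glue_verts L.sum_glue_verts using Y_vtx
      by (intro add_mono sum_mono) auto
  qed
  then have "additive_distance L * pm_trace L Y \<le> \<epsilon>"
    using mult_left_mono[OF _ \<alpha>nn, of "pm_trace L Y" "pm_trace G X"] \<epsilon>(2) by linarith
  then have "shifted L Y \<epsilon> \<in> psd_completable L"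
    by (rule clique_psd_shift_trace[OF pair_graph_L uv Y])
  then obtain M where M: "psd_on (pverts L) M"
    "\<And>u w. (u, w) \<in> specified L \<Longrightarrow> M u w = shifted L Y \<epsilon> u w" using psd_completableE by blast
  have M_spec: "M u w = Y u w + (if u = w then \<epsilon> else 0)" if "(u, w) \<in> specified L" for u w
    using M(2)[OF that] shifted_specified[OF pair_graph_L that] by simp
  have M_emb: "M (emb e a) (emb e b) = Z e a b + (if a = b then \<epsilon> else 0)"
    if e: "e \<in> arcs D" and ab: "(a, b) \<in> specified (path_graph (p e))" for e a b
    using M_spec[OF L.glue_specified_emb[OF e ab]] Y_emb[OF e ab] emb_eq_iff[OF e] by simp
  have finL: "finite (pverts L)" by (rule pair_graph_finite[OF pair_graph_L])
  have emb_L: "emb e a \<in> pverts L" if "e \<in> arcs D" "a \<in> set (p e)" for e a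
    using that unfolding L.glue_verts by auto
  define fits where "fits e A \<longleftrightarrow> psd_on (pverts (C e)) A \<and>
     (\<forall>a b. (a, b) \<in> specified (C e) \<longrightarrow> A a b = X (emb e a) (emb e b) + (if a = b then \<epsilon> else 0)) \<and>
     A (T e) (H e) = M (emb e (T e)) (emb e (H e))" for e A
  have "\<exists>A. fits e A" if e: "e \<in> arcs D" for e
  proof (cases "nonadjacent e")
    case True
    let ?M = "\<lambda>a b. M (emb e a) (emb e b)"
    have "psd_on (set (p e)) ?M"
      using finL emb_L[OF e] by (intro psd_on_compose[OF M(1)]) auto
    moreover have "\<forall>(a, b)\<in>specified (path_graph (p e)). ?M a b = z e a * z e b + (if a = b then \<epsilon> else 0)"
      using M_emb[OF e] True by (auto simp: Z_def)
    ultimately obtain A where A: "psd_on (pverts (C e)) A" "A (T e) (H e) = ?M (T e) (H e)"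
      "\<forall>(a, b)\<in>specified (C e). A a b = x e a * x e b + (if a = b then \<epsilon> else 0)"
      using xz[OF e True] \<epsilon>(1) unfolding good_def by blast
    have "A a b = X (emb e a) (emb e b) + (if a = b then \<epsilon> else 0)" if "(a, b) \<in> specified (C e)" for a b
    proof -
      have "A a b = x e a * x e b + (if a = b then \<epsilon> else 0)" using A(3) that by blast
      moreover have "X (emb e a) (emb e b) = x e a * x e b"
        using xz[OF e True] that unfolding good_def by blast
      ultimately show ?thesis by simp
    qed
    then show ?thesis using A(1,2) unfolding fits_def by blast
  next
    case False
    obtain A where A: "psd_on (pverts (C e)) A"
      "\<forall>a b. (a, b) \<in> specified (C e) \<longrightarrow> A a b = X (emb e a) (emb e b)"
      using clique_psd_piece_completion[OF e X] by blast
    have TH: "T e \<noteq> H e" using pieces[OF e] by blast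
    \<comment> \<open>The ends form an edge of \<open>L\<close>, so \<open>M\<close> has the entry
      of \<open>X\<close> there, and any completion of \<open>X\<close> on the piece fits once
      \<epsilon> is added on its diagonal.\<close>
    have "(T e, H e) \<in> parcs (path_graph (p e))"
      using shortest_path_induced[OF pair_graph_piece[OF e] shortest[OF e]] p_facts[OF e] False by blast
    then have "M (emb e (T e)) (emb e (H e)) = X (emb e (T e)) (emb e (H e))"
      using M_emb[OF e, of "T e" "H e"] TH False by (simp add: Z_def specified_def)
    moreover have "(T e, H e) \<in> specified (C e)" using False by (simp add: specified_def)
    moreover have "psd_on (pverts (C e)) (\<lambda>a b. A a b + (if a = b then \<epsilon> else 0))"
      using pair_graph_finite[OF pair_graph_piece[OF e]] \<epsilon>(1) by (intro psd_on_add[OF A(1)] psd_on_diagonal) auto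
    ultimately show ?thesis
      using A(2) TH unfolding fits_def by (intro exI[of _ "\<lambda>a b. A a b + (if a = b then \<epsilon> else 0)"]) auto
  qed
  then obtain Q where Q: "\<And>e. e \<in> arcs D \<Longrightarrow> fits e (Q e)" by metis
  have Msym: "M u w = M w u" if "u \<in> pverts L" "w \<in> pverts L" for u w using psd_on_sym[OF M(1) that] .
  have Q_ends: "Q e a b = M (emb e a) (emb e b)"
    if e: "e \<in> arcs D" and ab: "a \<in> {T e, H e}" "b \<in> {T e, H e}" for e a b
  proof -
    have ends: "T e \<in> pverts (C e)" "H e \<in> pverts (C e)" using pieces[OF e] by auto
    have q: "psd_on (pverts (C e)) (Q e)" "Q e (T e) (H e) = M (emb e (T e)) (emb e (H e))"
      using Q[OF e] by (auto simp: fits_def)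
    have p: "T e \<in> set (p e)" "H e \<in> set (p e)" using p_facts[OF e] by auto
    have diag: "Q e c c = M (emb e c) (emb e c)" if c: "c \<in> {T e, H e}" for c
    proof -
      have "(c, c) \<in> specified (path_graph (p e))" using c p by auto
      then have "M (emb e c) (emb e c) = X (emb e c) (emb e c) + \<epsilon>"
        using M_emb[OF e, of c c] Z_ends[OF e c c] by simp
      then show ?thesis using Q[OF e] TH_spec[OF e c] unfolding fits_def by simp
    qed
    have "Q e (H e) (T e) = M (emb e (H e)) (emb e (T e))"
      using q(2) psd_on_sym[OF q(1) ends] Msym[OF emb_L[OF e p(1)] emb_L[OF e p(2)]] by simp
    then show ?thesis using diag q(2) ab by auto
  qed
  let ?W = "\<lambda>e. emb e ` pverts (C e)"
  have BL: "B \<subseteq> pverts L" unfolding L.glue_verts by blast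
  have finW: "finite (?W e)" if "e \<in> arcs D" for e
    using pair_graph_finite[OF pair_graph_piece[OF that]] by simp
  have finB: "finite B" using finite_D by simp
  \<comment> \<open>Starting from \<open>M\<close> on \<open>B\<close>, pieces are attached one by
    one. A new piece meets the union so far only in its two ends, where both matrices copy
    \<open>M\<close>, also at the off-diagonal entry.\<close>
  have extend: "\<exists>A. psd_on (B \<union> (\<Union>e\<in>F. ?W e)) A \<and> (\<forall>u\<in>B. \<forall>w\<in>B. A u w = M u w) \<and>
      (\<forall>e\<in>F. \<forall>a\<in>pverts (C e). \<forall>b\<in>pverts (C e). A (emb e a) (emb e b) = Q e a b)"
    if "finite F" "F \<subseteq> arcs D" for F
    using that
  proof (induction F rule: finite_induct)
    case empty
    show ?case using psd_on_subset[OF M(1) finL BL] by (intro exI[of _ M]) auto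
  next
    case (insert e F)
    let ?V = "B \<union> (\<Union>e\<in>F. ?W e)"
    have e: "e \<in> arcs D" and F: "F \<subseteq> arcs D" using insert.prems by auto
    obtain A where A: "psd_on ?V A" "\<forall>u\<in>B. \<forall>w\<in>B. A u w = M u w"
      "\<forall>e\<in>F. \<forall>a\<in>pverts (C e). \<forall>b\<in>pverts (C e). A (emb e a) (emb e b) = Q e a b"
      using insert.IH[OF F] by blast
    define g where "g = inv_into (pverts (C e)) (emb e)"
    have g: "g (emb e a) = a" if "a \<in> pverts (C e)" for a
      unfolding g_def using that emb_eq_iff[OF e] by (intro inv_into_f_f) (auto simp: inj_on_def)
    have q: "psd_on (pverts (C e)) (Q e)" using Q[OF e] by (simp add: fits_def)
    have psdW: "psd_on (?W e) (\<lambda>u w. Q e (g u) (g w))"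
      using finW[OF e] pair_graph_finite[OF pair_graph_piece[OF e]] g
      by (intro psd_on_compose[OF q]) auto
    have common: "\<exists>a\<in>{T e, H e}. u = emb e a \<and> u \<in> B" if u: "u \<in> ?V \<inter> ?W e" for u
    proof -
      obtain a where a: "a \<in> pverts (C e)" "u = emb e a" using u by blast
      have "a \<in> {T e, H e}"
      proof (cases "u \<in> B")
        case True
        then show ?thesis using a emb_in_B_iff[OF e] by blast
      next
        case False
        then obtain f b where "f \<in> F" "u = emb f b" using u by blast
        then show ?thesis using emb_eqD(1)[OF e, of f a b] a(2) F insert.hyps(2) by blast
      qed
      then show ?thesis using a(2) emb_in_B_iff[OF e] by blast
    qed
    have "\<exists>N. psd_on (?V \<union> ?W e) N \<and> (\<forall>u\<in>?V. \<forall>w\<in>?V. N u w = A u w) \<and>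
        (\<forall>u\<in>?W e. \<forall>w\<in>?W e. N u w = Q e (g u) (g w))"
    proof (rule psd_on_amalgamate[OF A(1) psdW])
      show "finite ?V" using finB finW F insert.hyps(1) by auto
      show "finite (?W e)" by (rule finW[OF e])
      fix u w assume uw: "u \<in> ?V \<inter> ?W e" "w \<in> ?V \<inter> ?W e"
      obtain a where a: "a \<in> {T e, H e}" "u = emb e a" "u \<in> B" using common[OF uw(1)] by blast
      obtain b where b: "b \<in> {T e, H e}" "w = emb e b" "w \<in> B" using common[OF uw(2)] by blast
      have "a \<in> pverts (C e)" "b \<in> pverts (C e)" using a b pieces[OF e] by auto
      moreover have "A u w = M u w" using A(2) a(3) b(3) by blast
      ultimately show "A u w = Q e (g u) (g w)"
        using a(2) b(2) g Q_ends[OF e a(1) b(1)] by simp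
    qed
    then obtain N where N: "psd_on (?V \<union> ?W e) N" "\<forall>u\<in>?V. \<forall>w\<in>?V. N u w = A u w"
      "\<forall>u\<in>?W e. \<forall>w\<in>?W e. N u w = Q e (g u) (g w)" by (elim exE conjE) (rule that)
    have "\<forall>u\<in>B. \<forall>w\<in>B. N u w = M u w"
    proof (intro ballI)
      fix u w assume uw: "u \<in> B" "w \<in> B"
      then have "N u w = A u w" by (intro N(2)[rule_format] UnI1)
      then show "N u w = M u w" using A(2) uw by simp
    qed
    moreover have "N (emb f a) (emb f b) = Q f a b"
      if f: "f \<in> insert e F" "a \<in> pverts (C f)" "b \<in> pverts (C f)" for f a b
    proof (cases "f = e")
      case True
      then show ?thesis using N(3) f g by simp
    next
      case False
      then have "emb f a \<in> ?V" "emb f b \<in> ?V" "f \<in> F" using f by auto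
      then show ?thesis using N(2) A(3) f by simp
    qed
    moreover have "B \<union> (\<Union>e\<in>insert e F. ?W e) = ?V \<union> ?W e" by blast
    ultimately show ?case using N(1) by (intro exI[of _ N]) simp
  qed
  obtain A where A: "psd_on (pverts G) A" "\<forall>u\<in>B. \<forall>w\<in>B. A u w = M u w"
      "\<forall>e\<in>arcs D. \<forall>a\<in>pverts (C e). \<forall>b\<in>pverts (C e). A (emb e a) (emb e b) = Q e a b"
    using extend[OF finite_D(2) order_refl] unfolding glue_verts by blast
  show ?thesis
  proof (rule psd_completableI[OF shifted_partial_matrices[OF Xp] A(1)])
    fix u w assume uw: "(u, w) \<in> specified G"
    have goal: "shifted G X \<epsilon> u w = X u w + (if u = w then \<epsilon> else 0)"
      by (rule shifted_specified[OF pair_graph_G uw])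
    show "A u w = shifted G X \<epsilon> u w"
      using uw
    proof (cases rule: glue_specified_cases)
      case (1 v)
      then have "vtx v \<in> B" by blast
      then have "A u w = M (vtx v) (vtx v)" using A(2) 1 by simp
      also have "\<dots> = X u w + \<epsilon>" using M_spec[of "vtx v" "vtx v"] Y_vtx[OF 1(1)] 1 \<open>vtx v \<in> B\<close> BL by auto
      finally show ?thesis using 1 goal by simp
    next
      case (2 e a b)
      have "a \<in> pverts (C e)" "b \<in> pverts (C e)"
        using pair_graph_specified_verts[OF pair_graph_piece[OF 2(1)] 2(2)] by auto
      then have "A u w = Q e a b" using A(3) 2 by simp
      also have "\<dots> = X u w + (if a = b then \<epsilon> else 0)" using Q[OF 2(1)] 2 unfolding fits_def by simp
      finally show ?thesis using 2 emb_eq_iff[OF 2(1)] goal by simp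
    qed
  qed
qed

section \<open>Reduction to pieces of rank one\<close>

definition trace_shift_completable :: "(('v + 'e \<times> 'c) set \<Rightarrow> ('v + 'e \<times> 'c) set \<Rightarrow> real) \<Rightarrow> bool" where
  "trace_shift_completable X \<longleftrightarrow> shifted G X (additive_distance L * pm_trace G X) \<in> psd_completable G"

lemma trace_shift_completable_sum:
  assumes "\<forall>(l, y)\<in>set ws. trace_shift_completable (h l y)"
  shows "trace_shift_completable (\<lambda>u w. \<Sum>(l, y)\<leftarrow>ws. h l y u w)"
  using assms
proof (induction ws)
  case Nil
  then show ?case
    using psd_on_zero[of "pverts G"]
    by (auto simp: trace_shift_completable_def psd_completable_iff shifted_def pm_trace_def partial_matrices_def)
next
  case (Cons ly ws)
  obtain l y where ly: "ly = (l, y)" by (cases ly)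
  let ?S = "\<lambda>u w. \<Sum>(l, y)\<leftarrow>ws. h l y u w"
  have "trace_shift_completable (h l y)" "trace_shift_completable ?S" using Cons ly by auto
  then have "(\<lambda>u w. shifted G (h l y) (additive_distance L * pm_trace G (h l y)) u w
      + shifted G ?S (additive_distance L * pm_trace G ?S) u w) \<in> psd_completable G"
    unfolding trace_shift_completable_def by (rule psd_completable_add)
  moreover have "(\<lambda>u w. shifted G (h l y) (additive_distance L * pm_trace G (h l y)) u w
      + shifted G ?S (additive_distance L * pm_trace G ?S) u w)
      = shifted G (\<lambda>u w. h l y u w + ?S u w) (additive_distance L * pm_trace G (\<lambda>u w. h l y u w + ?S u w))"
    by (intro ext) (simp add: shifted_def pm_trace_def sum.distrib algebra_simps)
  ultimately show ?case unfolding trace_shift_completable_def ly by simp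
qed

text \<open>The test asks for a pair specified within the piece, not for two vertices of the piece:
  ends that are nonadjacent in \<open>C e\<close> may be adjacent through a parallel piece, and that
  entry has to be scaled along with the rest of \<open>X\<close>.\<close>

definition replace_piece ::
  "'e \<Rightarrow> (('v + 'e \<times> 'c) set \<Rightarrow> ('v + 'e \<times> 'c) set \<Rightarrow> real) \<Rightarrow> real \<Rightarrow> ('c \<Rightarrow> real) \<Rightarrow>
     ('v + 'e \<times> 'c) set \<Rightarrow> ('v + 'e \<times> 'c) set \<Rightarrow> real" where
  "replace_piece e X l y u w =
     (if \<exists>a b. (a, b) \<in> specified (C e) \<and> u = emb e a \<and> w = emb e b
      then y (inv_into (pverts (C e)) (emb e) u) * y (inv_into (pverts (C e)) (emb e) w)
      else l * X u w)"

lemma replace_piece_emb: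
  assumes e: "e \<in> arcs D" and ab: "(a, b) \<in> specified (C e)"
  shows "replace_piece e X l y (emb e a) (emb e b) = y a * y b"
proof -
  have inj: "inj_on (emb e) (pverts (C e))" using emb_eq_iff[OF e] by (auto simp: inj_on_def)
  show ?thesis
    using ab pair_graph_specified_verts[OF pair_graph_piece[OF e] ab] inv_into_f_f[OF inj]
    unfolding replace_piece_def by auto
qed

lemma replace_piece_other:
  assumes "\<And>a b. (a, b) \<in> specified (C e) \<Longrightarrow> u = emb e a \<Longrightarrow> w = emb e b \<Longrightarrow> y a * y b = l * X u w"
    and e: "e \<in> arcs D"
  shows "replace_piece e X l y u w = l * X u w"
proof (cases "\<exists>a b. (a, b) \<in> specified (C e) \<and> u = emb e a \<and> w = emb e b")
  case True
  then show ?thesis using replace_piece_emb[OF e] assms(1) by metis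
next
  case False
  then show ?thesis unfolding replace_piece_def by (rule if_not_P)
qed

text \<open>
  A weighted rank one summand on one piece extends to the whole graph by scaling everything else
  with its weight: the two matrices agree on the diagonal entries at the end points.
\<close>

lemma replace_piece_properties:
  assumes e: "e \<in> arcs D" "nonadjacent e" and X: "X \<in> clique_psd G" and l: "0 \<le> l"
    and y: "(y (T e))\<^sup>2 = l * X (emb e (T e)) (emb e (T e))" "(y (H e))\<^sup>2 = l * X (emb e (H e)) (emb e (H e))"
  shows "replace_piece e X l y \<in> clique_psd G"
    and "rank_one_on e (replace_piece e X l y)"
    and "f \<in> arcs D \<Longrightarrow> f \<noteq> e \<Longrightarrow> rank_one_on f X \<Longrightarrow> rank_one_on f (replace_piece e X l y)"
proof -
  let ?Y = "replace_piece e X l y"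
  have "(H e, T e) \<notin> parcs (C e)" using e(2) pair_graph_symD[OF pair_graph_piece[OF e(1)]] by blast
  \<comment> \<open>Nonadjacency leaves only the diagonal pairs, so the signs of \<open>y\<close> at
    the ends do not matter.\<close>
  then have ends_diag: "y a * y b = l * X (emb e a) (emb e b)"
    if "(a, b) \<in> specified (C e)" "a \<in> {T e, H e}" "b \<in> {T e, H e}" for a b
    using that e(2) y by (auto simp: specified_def power2_eq_square)
  have Xp: "X \<in> partial_matrices G" by (rule clique_psd_partial[OF X])
  have Xsym: "X u w = X w u" for u w by (rule partial_matrices_sym[OF pair_graph_G Xp])
  have sym: "?Y u w = ?Y w u" for u w
  proof (cases "\<exists>a b. (a, b) \<in> specified (C e) \<and> u = emb e a \<and> w = emb e b")
    case True
    then obtain a b where ab: "(a, b) \<in> specified (C e)" "u = emb e a" "w = emb e b" by blast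
    then have "(b, a) \<in> specified (C e)" using pair_graph_specified_sym[OF pair_graph_piece[OF e(1)]] by blast
    then show ?thesis using ab by (simp add: replace_piece_emb[OF e(1)])
  next
    case False
    then have "\<not> (\<exists>a b. (a, b) \<in> specified (C e) \<and> w = emb e a \<and> u = emb e b)"
      using pair_graph_specified_sym[OF pair_graph_piece[OF e(1)]] by blast
    then have "?Y w u = l * X w u" unfolding replace_piece_def by (rule if_not_P)
    moreover have "?Y u w = l * X u w" using False unfolding replace_piece_def by (rule if_not_P)
    ultimately show ?thesis by (simp add: Xsym[of u w])
  qed
  have zero: "?Y u w = 0" if "(u, w) \<notin> specified G" for u w
    using that glue_specified_emb[OF e(1)] Xp
    by (subst replace_piece_other[OF _ e(1)]) (auto simp: partial_matrices_def)
  \<comment> \<open>On a clique through an interior vertex of the piece the new matrix is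
    \<open>y y^T\<close>, by \<open>interior_clique\<close>. Any other clique meets the piece at
    most in its ends, so the new matrix is \<open>l X\<close> on it.\<close>
  have "psd_on K ?Y" if K: "is_clique G K" for K
  proof (cases "\<exists>a\<in>pverts (C e). a \<notin> {T e, H e} \<and> emb e a \<in> K")
    case True
    then have "is_clique (glue_piece D C T H e) K" using interior_clique[OF K e(1)] by blast
    then obtain K' where K': "is_clique (C e) K'" "K = emb e ` K'"
      by (rule glue_piece_cliqueE[OF e(1)])
    have spec: "(a, b) \<in> specified (C e)" if "a \<in> K'" "b \<in> K'" for a b
      using is_cliqueD[OF K'(1)] that by (cases "a = b") (auto simp: specified_def)
    define g where "g = inv_into K' (emb e)"
    have g: "g u \<in> K'" "emb e (g u) = u" if "u \<in> K" for u
      using that unfolding K'(2) g_def by (rule inv_into_into, rule f_inv_into_f)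
    have "?Y u w = y (g u) * y (g w)" if "u \<in> K" "w \<in> K" for u w
      using replace_piece_emb[OF e(1) spec[OF g(1)[OF that(1)] g(1)[OF that(2)]]]
        g(2)[OF that(1)] g(2)[OF that(2)] by metis
    then show ?thesis
      using psd_on_cong[of K ?Y "\<lambda>u w. y (g u) * y (g w)"] psd_on_rank_one[of K "\<lambda>u. y (g u)"] by blast
  next
    case False
    have "?Y u w = l * X u w" if uw: "u \<in> K" "w \<in> K" for u w
    proof (rule replace_piece_other[OF _ e(1)])
      fix a b assume ab: "(a, b) \<in> specified (C e)" "u = emb e a" "w = emb e b"
      have "a \<in> pverts (C e)" "b \<in> pverts (C e)"
        using pair_graph_specified_verts[OF pair_graph_piece[OF e(1)] ab(1)] by auto
      then have "a \<in> {T e, H e}" "b \<in> {T e, H e}" using False uw ab by blast+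
      then show "y a * y b = l * X u w" using ends_diag[OF ab(1)] ab(2,3) by simp
    qed
    moreover have "psd_on K (\<lambda>u w. l * X u w)"
      using X K l by (intro psd_on_scale) (simp_all add: clique_psd_def)
    ultimately show ?thesis using psd_on_cong[of K ?Y "\<lambda>u w. l * X u w"] by blast
  qed
  then show "?Y \<in> clique_psd G"
    using sym zero by (auto simp: clique_psd_def partial_matrices_def)
  show "rank_one_on e ?Y" using replace_piece_emb[OF e(1)] unfolding rank_one_on_def by blast
  assume f: "f \<in> arcs D" "f \<noteq> e" "rank_one_on f X"
  then obtain x where x: "\<forall>a b. (a, b) \<in> specified (C f) \<longrightarrow> X (emb f a) (emb f b) = x a * x b"
    unfolding rank_one_on_def by blast
  have "?Y (emb f a) (emb f b) = (sqrt l * x a) * (sqrt l * x b)" if ab: "(a, b) \<in> specified (C f)" for a b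
  proof -
    have "?Y (emb f a) (emb f b) = l * X (emb f a) (emb f b)"
    proof (rule replace_piece_other[OF _ e(1)])
      fix c d assume cd: "(c, d) \<in> specified (C e)" "emb f a = emb e c" "emb f b = emb e d"
      then have "c \<in> {T e, H e}" "d \<in> {T e, H e}" using emb_eqD(2)[OF f(1) e(1) _ f(2)] by blast+
      then show "y c * y d = l * X (emb f a) (emb f b)" using ends_diag[OF cd(1)] cd(2,3) by simp
    qed
    also have "\<dots> = l * (x a * x b)" using x ab by simp
    also have "\<dots> = (sqrt l * sqrt l) * (x a * x b)" using l by simp
    finally show ?thesis by (simp add: mult_ac)
  qed
  then show "rank_one_on f ?Y" unfolding rank_one_on_def by (intro exI[of _ "\<lambda>a. sqrt l * x a"]) blast
qed

text \<open>\<open>F\<close> contains all pieces that may still fail to be rank one. Decomposing one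
  of them only rescales the others, so pieces already of rank one stay so in every summand and
  \<open>F\<close> shrinks. The shift is proportional to the trace and thus additive, which allows
  the summands to be completed separately.\<close>

lemma clique_psd_trace_shift_completable:
  assumes uv: "u0 \<in> pverts L" "v0 \<in> pverts L" "u0 \<noteq> v0"
    and "finite F" "F \<subseteq> arcs D" "X \<in> clique_psd G"
    and "\<And>e. e \<in> arcs D - F \<Longrightarrow> nonadjacent e \<Longrightarrow> rank_one_on e X"
  shows "trace_shift_completable X"
  using assms(4-)
proof (induction F arbitrary: X rule: finite_induct)
  case empty
  have "0 \<le> pm_trace G X" unfolding pm_trace_def
    using clique_psd_diag_nonneg[OF empty.prems(2)] by (intro sum_nonneg)
  then have "0 \<le> additive_distance L * pm_trace G X"
    using additive_distance_nonneg[OF pair_graph_L uv] by simp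
  then show ?case
    unfolding trace_shift_completable_def
    using empty by (intro completion_of_rank_one_pieces[OF _ _ uv]) auto
next
  case (insert e F)
  have e: "e \<in> arcs D" and F: "F \<subseteq> arcs D" using insert.prems by auto
  note X = insert.prems(2)
  show ?case
  proof (cases "nonadjacent e")
    case False
    show ?thesis by (rule insert.IH[OF F X]) (use insert.prems(3) False in blast)
  next
    case True
    obtain A where A: "psd_on (pverts (C e)) A"
      "\<forall>a b. (a, b) \<in> specified (C e) \<longrightarrow> A a b = X (emb e a) (emb e b)"
      using clique_psd_piece_completion[OF e X] by blast
    have TH: "T e \<in> pverts (C e)" "H e \<in> pverts (C e)" using pieces[OF e] by auto
    obtain ws :: "(real \<times> ('c \<Rightarrow> real)) list" where
      ws: "\<forall>(l, y)\<in>set ws. 0 \<le> l \<and> (y (T e))\<^sup>2 = l * A (T e) (T e) \<and> (y (H e))\<^sup>2 = l * A (H e) (H e)"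
        "(\<Sum>(l, y)\<leftarrow>ws. l) = 1" "\<forall>a\<in>pverts (C e). \<forall>b\<in>pverts (C e). A a b = (\<Sum>(l, y)\<leftarrow>ws. y a * y b)"
      using psd_on_weighted_rank_one_decomposition[OF pair_graph_finite[OF pair_graph_piece[OF e]] A(1) TH]
      by blast
    have AX: "A (T e) (T e) = X (emb e (T e)) (emb e (T e))" "A (H e) (H e) = X (emb e (H e)) (emb e (H e))"
      using A(2) TH by auto
    have "trace_shift_completable (replace_piece e X l y)" if ly: "(l, y) \<in> set ws" for l y
    proof (rule insert.IH[OF F])
      have l: "0 \<le> l" and y: "(y (T e))\<^sup>2 = l * X (emb e (T e)) (emb e (T e))"
        "(y (H e))\<^sup>2 = l * X (emb e (H e)) (emb e (H e))"
        using ws(1) ly AX by auto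
      note props = replace_piece_properties[where y = y, OF e True X l y]
      show "replace_piece e X l y \<in> clique_psd G" by (rule props(1))
      show "rank_one_on f (replace_piece e X l y)" if "f \<in> arcs D - F" "nonadjacent f" for f
        using props(2,3) insert.prems(3)[of f] that by (cases "f = e") auto
    qed
    then have "trace_shift_completable (\<lambda>u w. \<Sum>(l, y)\<leftarrow>ws. replace_piece e X l y u w)"
      by (intro trace_shift_completable_sum) auto
    \<comment> \<open>On the piece the products \<open>y a * y b\<close> add up to a completion of
      \<open>X\<close>; elsewhere the copies \<open>l X\<close> add up to \<open>X\<close>, because
      the weights sum to 1.\<close>
    moreover have "(\<lambda>u w. \<Sum>(l, y)\<leftarrow>ws. replace_piece e X l y u w) = X"
    proof (intro ext)
      fix u w
      show "(\<Sum>(l, y)\<leftarrow>ws. replace_piece e X l y u w) = X u w"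
      proof (cases "\<exists>a b. (a, b) \<in> specified (C e) \<and> u = emb e a \<and> w = emb e b")
        case True
        then obtain a b where ab: "(a, b) \<in> specified (C e)" "u = emb e a" "w = emb e b" by blast
        have "a \<in> pverts (C e)" "b \<in> pverts (C e)"
          using pair_graph_specified_verts[OF pair_graph_piece[OF e] ab(1)] by auto
        then have "A a b = (\<Sum>(l, y)\<leftarrow>ws. y a * y b)" using ws(3) by blast
        then have "X u w = (\<Sum>(l, y)\<leftarrow>ws. y a * y b)" using A(2) ab by metis
        then show ?thesis using ab by (simp add: replace_piece_emb[OF e ab(1)])
      next
        case False
        then have "replace_piece e X l y u w = l * X u w" for l y unfolding replace_piece_def by (rule if_not_P)
        then have "(\<Sum>(l, y)\<leftarrow>ws. replace_piece e X l y u w) = (\<Sum>ly\<leftarrow>ws. fst ly * X u w)"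
          unfolding case_prod_unfold by (simp only:)
        also have "\<dots> = (\<Sum>(l, y)\<leftarrow>ws. l) * X u w" by (simp add: sum_list_mult_const case_prod_unfold)
        finally show ?thesis using ws(2) by simp
      qed
    qed
    ultimately show ?thesis by simp
  qed
qed

lemma additive_distance_G_le_L:
  assumes uv: "u0 \<in> pverts L" "v0 \<in> pverts L" "u0 \<noteq> v0"
  shows "additive_distance G \<le> additive_distance L"
proof -
  have ne: "pverts G \<noteq> {}" using uv L_subset_G by blast
  have "shifted G X (additive_distance L) \<in> psd_completable G" if X: "X \<in> clique_psd_normalized G" for X
  proof -
    have "X \<in> clique_psd G" "pm_trace G X = 1" using X by (auto simp: clique_psd_normalized_def)
    moreover from this(1) have "trace_shift_completable X"
      by (intro clique_psd_trace_shift_completable[OF uv finite_D(2)]) auto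
    ultimately show ?thesis by (simp add: trace_shift_completable_def)
  qed
  then show ?thesis using additive_distance_le_iff[OF pair_graph_G ne] by blast
qed

end

theorem theorem3p1:
  fixes D :: "('v, 'e) pre_digraph"
    and C :: "'e \<Rightarrow> 'c pair_pre_digraph"
    and T H :: "'e \<Rightarrow> 'c"
    and p :: "'e \<Rightarrow> 'c list"
  assumes "multidigraph D"
    and "\<And>e. e \<in> arcs D \<Longrightarrow> connected_graph (C e) \<and> chordal (C e)"
    and "\<And>e. e \<in> arcs D \<Longrightarrow> T e \<in> pverts (C e) \<and> H e \<in> pverts (C e) \<and> T e \<noteq> H e"
    and "thickening D C T H"
    and "\<And>e. e \<in> arcs D \<Longrightarrow> shortest_path (C e) (T e) (H e) (p e)"
  shows "additive_distance (glue D C T H) = additive_distance (glue D (\<lambda>e. path_graph (p e)) T H)"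
proof (cases "arcs D = {}")
  case True
  then show ?thesis by (simp add: glue_def)
next
  case False
  interpret path_replacement D C T H p
    using assms(1,4,5) by unfold_locales
  obtain e where e: "e \<in> arcs D" using False by blast
  have "T e \<noteq> H e" using pieces[OF e] by blast
  then have neq: "emb e (T e) \<noteq> emb e (H e)" using emb_eq_iff[OF e] by simp
  have inL: "emb e (T e) \<in> pverts L" "emb e (H e) \<in> pverts L"
    using e p_facts[OF e] unfolding L.glue_verts by auto
  show ?thesis
    using additive_distance_G_le_L[OF inL neq] additive_distance_L_le_G inL by fastforce
qed

end
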